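(* Let $T>0$ and, for $\rho>0$, $Q_\rho=(-\rho,\rho)\times(0,\rho^2)$. For $i=1,2$ let $$v_i\in\Big\{\bigcap_{\rho>0}W^{2,1}_\infty\big((\mathbb R\times[0,T])\setminus\overline{Q}_\rho\big)\Big\}\cap W^{1,0}_\infty(\mathbb R\times[0,T])$$ be a solution of $$\min\{\mathcal L v,\ 1-v\}=0,\qquad v(\xi,0)=\min\{1,e^{-\xi}\},$$ satisfying $\frac{\partial^2v_i}{\partial\xi^2}+\frac{\partial v_i}{\partial\xi}\le0$. Suppose that for $i=1,2$ there exists $B_i>0$ such that $v_i=1$ for $\xi<-B_i$ and $v_i\le e^{-\xi}$ for $\xi>B_i$. Then $v_1=v_2$.
   Context: Constants: $\delta>0$, $0<\sigma_H<\sigma_L$ with $\frac12\sigma_H^2<\delta<\frac12\sigma_L^2$, and $0<\gamma<1$. The operator is $$\mathcal L v=-\frac{\partial v}{\partial t}+\frac12\sigma^2(v)\left(\frac{\partial^2 v}{\partial\xi^2}+\frac{\partial v}{\partial\xi}\right)+\delta\left(\frac{\partial v}{\partial\xi}+v\right),\qquad \sigma(v)=\sigma_H\mathbf 1_{\{v<\gamma\}}+\sigma_L\mathbf 1_{\{v\ge\gamma\}}.$$ $W^{2,1}_\infty(\Omega)$ is the space of bounded functions on $\Omega\subset\mathbb R\times[0,T]$ whose (weak) derivatives up to second order in $\xi$ and first order in $t$ are bounded; $W^{1,0}_\infty(\Omega)$ is the space of bounded functions whose derivative with respect to $\xi$ is bounded. Equations and inequalities involving second-order or time derivatives are understood almost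 everywhere in $\mathbb R\times(0,T]$. *)

theory Defs
  imports "HOL-Analysis.Analysis"
begin

text \<open>Points of the plane are pairs \<open>(\<xi>, t)\<close>.\<close>

definition strip :: "real \<Rightarrow> (real \<times> real) set" where
  "strip T = UNIV \<times> {0..T}"

definition Q :: "real \<Rightarrow> (real \<times> real) set" where
  "Q \<rho> = {-\<rho><..<\<rho>} \<times> {0<..<\<rho>\<^sup>2}"

definition locally_integrable :: "(real \<times> real) set \<Rightarrow> (real \<times> real \<Rightarrow> real) \<Rightarrow> bool" where
  "locally_integrable U f \<longleftrightarrow> (\<forall>K. compact K \<and> K \<subseteq> U \<longrightarrow> set_integrable lebesgue K f)"

text \<open>\<open>\<phi>\<close> is a \<open>C\<^sup>1\<close> function with compact support in the open set \<open>U\<close>, and \<open>\<phi>' p\<close> is its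
  (total) derivative at \<open>p\<close>.\<close>

definition test_function ::
    "(real \<times> real) set \<Rightarrow> (real \<times> real \<Rightarrow> real) \<Rightarrow> (real \<times> real \<Rightarrow> real \<times> real \<Rightarrow> real) \<Rightarrow> bool" where
  "test_function U \<phi> \<phi>' \<longleftrightarrow>
     (\<forall>p. (\<phi> has_derivative \<phi>' p) (at p)) \<and>
     (\<forall>h. continuous_on UNIV (\<lambda>p. \<phi>' p h)) \<and>
     (\<exists>K. compact K \<and> K \<subseteq> U \<and> (\<forall>p. p \<notin> K \<longrightarrow> \<phi> p = 0))"

text \<open>First-order weak derivative in direction \<open>e\<close> on the open set \<open>U\<close>, with test functions of the
  same order as the derivative (the convention of Gilbarg and Trudinger). Second-order weak
  derivatives are obtained by iteration.\<close>

definition has_weak_deriv ::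
    "real \<times> real \<Rightarrow> (real \<times> real) set \<Rightarrow> (real \<times> real \<Rightarrow> real) \<Rightarrow> (real \<times> real \<Rightarrow> real) \<Rightarrow> bool" where
  "has_weak_deriv e U v g \<longleftrightarrow>
     locally_integrable U v \<and> locally_integrable U g \<and>
     (\<forall>\<phi> \<phi>'. test_function U \<phi> \<phi>' \<longrightarrow>
        (LINT p:U|lebesgue. v p * \<phi>' p e) = - (LINT p:U|lebesgue. g p * \<phi> p))"

text \<open>The weak derivative is determined up to a null set of \<open>U\<close>; the choice below is immaterial for
  statements that hold almost everywhere in \<open>U\<close>.\<close>

definition weak_deriv ::
    "real \<times> real \<Rightarrow> (real \<times> real) set \<Rightarrow> (real \<times> real \<Rightarrow> real) \<Rightarrow> real \<times> real \<Rightarrow> real" where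
  "weak_deriv e U v = (SOME g. has_weak_deriv e U v g)"

definition ess_bounded_on :: "(real \<times> real) set \<Rightarrow> (real \<times> real \<Rightarrow> real) \<Rightarrow> bool" where
  "ess_bounded_on U g \<longleftrightarrow> (\<exists>C. AE p in lebesgue. p \<in> U \<longrightarrow> \<bar>g p\<bar> \<le> C)"

text \<open>The sets \<open>\<Omega>\<close> need not be open (they may contain parts of the lines \<open>t = 0\<close> and \<open>t = T\<close>);
  weak derivatives are taken in the interior.\<close>

definition W21_inf :: "(real \<times> real) set \<Rightarrow> (real \<times> real \<Rightarrow> real) set" where
  "W21_inf \<Omega> = {v. bounded (v ` \<Omega>) \<and>
     (\<exists>v\<^sub>\<xi> v\<^sub>\<xi>\<^sub>\<xi> v\<^sub>t.
        has_weak_deriv (1, 0) (interior \<Omega>) v v\<^sub>\<xi> \<and>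
        has_weak_deriv (1, 0) (interior \<Omega>) v\<^sub>\<xi> v\<^sub>\<xi>\<^sub>\<xi> \<and>
        has_weak_deriv (0, 1) (interior \<Omega>) v v\<^sub>t \<and>
        ess_bounded_on (interior \<Omega>) v\<^sub>\<xi> \<and>
        ess_bounded_on (interior \<Omega>) v\<^sub>\<xi>\<^sub>\<xi> \<and>
        ess_bounded_on (interior \<Omega>) v\<^sub>t)}"

definition W10_inf :: "(real \<times> real) set \<Rightarrow> (real \<times> real \<Rightarrow> real) set" where
  "W10_inf \<Omega> = {v. bounded (v ` \<Omega>) \<and>
     (\<exists>v\<^sub>\<xi>. has_weak_deriv (1, 0) (interior \<Omega>) v v\<^sub>\<xi> \<and> ess_bounded_on (interior \<Omega>) v\<^sub>\<xi>)}"

definition D_xi :: "real \<Rightarrow> (real \<times> real \<Rightarrow> real) \<Rightarrow> real \<times> real \<Rightarrow> real" where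
  "D_xi T v = weak_deriv (1, 0) (interior (strip T)) v"

definition D_xi_xi :: "real \<Rightarrow> (real \<times> real \<Rightarrow> real) \<Rightarrow> real \<times> real \<Rightarrow> real" where
  "D_xi_xi T v = D_xi T (D_xi T v)"

definition D_t :: "real \<Rightarrow> (real \<times> real \<Rightarrow> real) \<Rightarrow> real \<times> real \<Rightarrow> real" where
  "D_t T v = weak_deriv (0, 1) (interior (strip T)) v"

definition sigma :: "real \<Rightarrow> real \<Rightarrow> real \<Rightarrow> real \<Rightarrow> real" where
  "sigma \<sigma>\<^sub>H \<sigma>\<^sub>L \<gamma> y = (if y < \<gamma> then \<sigma>\<^sub>H else \<sigma>\<^sub>L)"

definition L_op ::
    "real \<Rightarrow> real \<Rightarrow> real \<Rightarrow> real \<Rightarrow> real \<Rightarrow> (real \<times> real \<Rightarrow> real) \<Rightarrow> real \<times> real \<Rightarrow> real" where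
  "L_op \<delta> \<sigma>\<^sub>H \<sigma>\<^sub>L \<gamma> T v p =
     - D_t T v p
     + 1 / 2 * (sigma \<sigma>\<^sub>H \<sigma>\<^sub>L \<gamma> (v p))\<^sup>2 * (D_xi_xi T v p + D_xi T v p)
     + \<delta> * (D_xi T v p + v p)"

text \<open>A function that belongs to \<open>W21_inf (strip T - closure (Q \<rho>))\<close> for every \<open>\<rho> > 0\<close> is locally
  Lipschitz away from the origin after modification on a null set. The continuity clause selects
  this representative, which is what gives the pointwise initial condition a meaning.\<close>

definition is_solution ::
    "real \<Rightarrow> real \<Rightarrow> real \<Rightarrow> real \<Rightarrow> real \<Rightarrow> (real \<times> real \<Rightarrow> real) \<Rightarrow> bool" where
  "is_solution \<delta> \<sigma>\<^sub>H \<sigma>\<^sub>L \<gamma> T v \<longleftrightarrow>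
     continuous_on (strip T - {(0, 0)}) v \<and>
     (AE p in lebesgue. p \<in> UNIV \<times> {0<..T} \<longrightarrow> min (L_op \<delta> \<sigma>\<^sub>H \<sigma>\<^sub>L \<gamma> T v p) (1 - v p) = 0) \<and>
     (\<forall>\<xi>. v (\<xi>, 0) = min 1 (exp (- \<xi>)))"

end

theory Submission
  imports Defs
begin

text \<open>The equation is contractive in a weighted \<open>L\<^sup>1\<close> norm. Put \<open>b(y) = 2 / \<sigma>(y)\<^sup>2\<close>, let \<open>\<beta>\<close> be a
  primitive of \<open>b\<close>, and let \<open>w = v\<^sub>1 - v\<^sub>2\<close>. On \<open>{w > 0}\<close> we have \<open>v\<^sub>2 < 1\<close>, so that \<open>v\<^sub>2\<close> solves the
  equation there while \<open>v\<^sub>1\<close> is a subsolution; dividing both by \<open>\<sigma>\<^sup>2 / 2\<close> and subtracting gives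
  \<open>(\<beta>(v\<^sub>1) - \<beta>(v\<^sub>2))\<^sub>t \<le> w\<^sub>\<xi>\<^sub>\<xi> + w\<^sub>\<xi> + \<delta> (\<beta>(v\<^sub>1) - \<beta>(v\<^sub>2))\<^sub>\<xi> + \<delta> (b(v\<^sub>1) v\<^sub>1 - b(v\<^sub>2) v\<^sub>2)\<close>,
  whose right-hand side is in divergence form except for the last term, and \<open>y \<mapsto> b(y) y\<close> is one-sided
  Lipschitz because its only jump, at \<open>\<gamma>\<close>, is downwards. Multiply by \<open>e\<^bsup>-\<xi>\<^esup>\<close> times the indicator of
  \<open>{w > 0}\<close> and integrate over \<open>[A, L] \<times> [s, t]\<close>, where \<open>w = 0\<close> for \<open>\<xi> \<le> A\<close>. By Kato's inequality the
  energy \<open>E(t) = \<integral> e\<^bsup>-\<xi>\<^esup> (\<beta>(v\<^sub>1) - \<beta>(v\<^sub>2))\<^sup>+ d\<xi>\<close> over \<open>[A, L]\<close> satisfies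
  \<open>E(t) - E(s) \<le> \<integral>\<^sub>s\<^sup>t (K e\<^bsup>-L\<^esup> + C E)\<close> with \<open>K\<close> and \<open>C\<close> independent of \<open>s\<close> and \<open>L\<close>. Gronwall's inequality,
  \<open>s \<rightarrow> 0\<close> and \<open>L \<rightarrow> \<infinity>\<close> yield \<open>v\<^sub>1 \<le> v\<^sub>2\<close>.\<close>

section \<open>Primitives of bounded functions on an interval\<close>

text \<open>A discontinuous factor in front of the second derivative could not be integrated by
  parts. After the division by \<open>\<sigma>\<^sup>2 / 2\<close> it stands only in front of first
  derivatives and the zeroth-order term, and the first derivatives are absorbed in the Lipschitz
  function \<open>\<beta>\<close>. The weight makes the boundary terms at L vanish as L grows, given
  bounds on v and on its \<xi>-derivative. The delicate point is regularity. The bounds used for the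
  time derivative and the second \<xi>-derivative depend on s, so they serve for integrability
  alone; the constants come from the sup norm and the first \<xi>-derivative, both controlled up to
  t = 0. Moreover, regularity in time is available on almost every line of fixed \<xi>, regularity
  in space on almost every line of fixed t. Each estimate is therefore made on lines, and the two
  families meet through Fubini's theorem for one double integral, that of the weighted time
  derivative of the excess. On a line, functions are primitives of bounded densities defined at
  every point, so the formulas at w = 0 and v = \<gamma> are pointwise identities.\<close>

text \<open>This is Lipschitz continuity of \<open>u\<close> with a chosen density \<open>g\<close>.
  Measurability and boundedness of \<open>g\<close> keep it integrable after multiplication by
  continuous functions, and the formula for all subintervals needs no base point.\<close>

definition primitive_on :: "real \<Rightarrow> real \<Rightarrow> (real \<Rightarrow> real) \<Rightarrow> (real \<Rightarrow> real) \<Rightarrow> bool" where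
  "primitive_on c d u g \<longleftrightarrow>
     g \<in> borel_measurable (lebesgue_on {c..d}) \<and> (\<exists>M. \<forall>x\<in>{c..d}. \<bar>g x\<bar> \<le> M) \<and>
     (\<forall>x y. c \<le> x \<and> x \<le> y \<and> y \<le> d \<longrightarrow> (g has_integral (u y - u x)) {x..y})"

lemma primitive_onD:
  "primitive_on c d u g \<Longrightarrow> c \<le> x \<Longrightarrow> x \<le> y \<Longrightarrow> y \<le> d \<Longrightarrow> (g has_integral (u y - u x)) {x..y}"
  unfolding primitive_on_def by blast

lemma bounded_measurable_integrable_on:
  fixes g :: "real \<Rightarrow> real"
  assumes "g \<in> borel_measurable (lebesgue_on {c..d})" "\<And>x. x \<in> {c..d} \<Longrightarrow> \<bar>g x\<bar> \<le> M"
    and "{x..y} \<subseteq> {c..d}"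
  shows "g integrable_on {x..y}"
proof -
  have "g integrable_on {c..d}"
    by (rule measurable_bounded_by_integrable_imp_integrable[where g="\<lambda>_. M"])
      (use assms in auto)
  then show ?thesis
    using assms(3) integrable_on_subinterval by blast
qed

lemma primitive_on_continuous:
  assumes "primitive_on c d u g" shows "continuous_on {c..d} u"
proof (cases "c \<le> d")
  case True
  have gi: "g integrable_on {c..d}"
    using assms True unfolding primitive_on_def by blast
  have "u x = u c + integral {c..x} g" if "x \<in> {c..d}" for x
  proof -
    have "(g has_integral (u x - u c)) {c..x}"
      using assms that unfolding primitive_on_def by auto
    then show ?thesis by (simp add: integral_unique)
  qed
  moreover have "continuous_on {c..d} (\<lambda>x. u c + integral {c..x} g)"
    by (intro continuous_intros indefinite_integral_continuous_1 gi)
  ultimately show ?thesis by (metis (mono_tags, lifting) continuous_on_cong)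
qed auto

text \<open>If the increments of \<open>U\<close> and of the indefinite integral of \<open>G\<close> agree up to \<open>o(y - x)\<close>, their
  difference has derivative zero everywhere. This avoids almost everywhere differentiability in the
  chain rule below.\<close>

lemma primitive_onI:
  assumes meas: "G \<in> borel_measurable (lebesgue_on {c..d})"
    and bnd: "\<And>x. x \<in> {c..d} \<Longrightarrow> \<bar>G x\<bar> \<le> M"
    and loc: "\<And>e. e > 0 \<Longrightarrow> \<exists>\<delta>>0. \<forall>x y. c \<le> x \<and> x \<le> y \<and> y \<le> d \<and> y - x < \<delta> \<longrightarrow>
        \<bar>U y - U x - integral {x..y} G\<bar> \<le> e * (y - x)"
  shows "primitive_on c d U G"
proof -
  have Gi: "G integrable_on {x..y}" if "c \<le> x" "y \<le> d" for x y
    by (rule bounded_measurable_integrable_on[OF meas bnd]) (use that in auto)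
  define D where "D = (\<lambda>x. U x - integral {c..x} G)"
  have incr: "D y - D x = U y - U x - integral {x..y} G" if "c \<le> x" "x \<le> y" "y \<le> d" for x y
  proof -
    have "integral {c..x} G + integral {x..y} G = integral {c..y} G"
      by (intro Henstock_Kurzweil_Integration.integral_combine) (use that Gi in auto)
    then show ?thesis unfolding D_def by simp
  qed
  have "(D has_field_derivative 0) (at x within {c..d})" if x: "x \<in> {c..d}" for x
    unfolding has_field_derivative_def has_derivative_within_alt2
  proof (intro conjI allI impI)
    show "bounded_linear ((*) (0::real))" by (simp add: bounded_linear_mult_right)
    fix e :: real assume "e > 0"
    then obtain \<delta> where \<delta>: "\<delta> > 0" "\<And>x y. c \<le> x \<Longrightarrow> x \<le> y \<Longrightarrow> y \<le> d \<Longrightarrow> y - x < \<delta> \<Longrightarrow>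
        \<bar>U y - U x - integral {x..y} G\<bar> \<le> e * (y - x)" using loc by meson
    have "norm (D y - D x - 0 * (y - x)) \<le> e * norm (y - x)" if "y \<in> {c..d}" "dist y x < \<delta>" for y
      using \<delta>(2)[of x y] \<delta>(2)[of y x] incr[of x y] incr[of y x] that x
      by (cases "x \<le> y") (auto simp: dist_real_def abs_minus_commute)
    then show "\<forall>\<^sub>F y in at x within {c..d}. norm (D y - D x - 0 * (y - x)) \<le> e * norm (y - x)"
      unfolding eventually_at using \<open>\<delta> > 0\<close> by blast
  qed
  then obtain k where k: "\<And>x. x \<in> {c..d} \<Longrightarrow> D x = k"
    using has_field_derivative_zero_constant[of "{c..d}" D] by auto
  show ?thesis unfolding primitive_on_def
  proof (intro conjI allI impI)
    show "\<exists>M. \<forall>x\<in>{c..d}. \<bar>G x\<bar> \<le> M" using bnd by blast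
    fix x y assume xy: "c \<le> x \<and> x \<le> y \<and> y \<le> d"
    then have "U y - U x = integral {x..y} G" using incr[of x y] k[of x] k[of y] by auto
    then show "(G has_integral U y - U x) {x..y}" using Gi[of x y] xy by auto
  qed (rule meas)
qed

text \<open>The mean value theorem gives
  \<open>F (u y) - F (u x) = f \<theta> * (u y - u x)\<close>, and the intermediate value theorem
  writes \<open>\<theta>\<close> as \<open>u p\<close> with \<open>p\<close> in
  \<open>{x..y}\<close>. The error against the integral of \<open>f (u r) * g r\<close> is then the
  integral of \<open>(f (u p) - f (u r)) * g r\<close>, which is small relative to
  \<open>y - x\<close> by uniform continuity of \<open>f\<close> along \<open>u\<close>.\<close>

lemma primitive_on_chain:
  assumes u: "primitive_on c d u g"
    and F: "\<And>y. (F has_real_derivative f y) (at y)" and f: "continuous_on UNIV f"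
  shows "primitive_on c d (\<lambda>x. F (u x)) (\<lambda>x. f (u x) * g x)"
proof -
  obtain M where M: "\<And>x. x \<in> {c..d} \<Longrightarrow> \<bar>g x\<bar> \<le> M" using u unfolding primitive_on_def by blast
  define M' where "M' = max M 1"
  have M': "\<bar>g x\<bar> \<le> M'" if "x \<in> {c..d}" for x using M[OF that] unfolding M'_def by auto
  have "M' > 0" unfolding M'_def by auto
  have gm: "g \<in> borel_measurable (lebesgue_on {c..d})" using u unfolding primitive_on_def by blast
  have uc: "continuous_on {c..d} u" by (rule primitive_on_continuous[OF u])
  have fuc: "continuous_on {c..d} (\<lambda>x. f (u x))"
    by (rule continuous_on_compose2[OF f uc]) auto
  have meas: "(\<lambda>x. f (u x) * g x) \<in> borel_measurable (lebesgue_on {c..d})"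
    by (intro borel_measurable_times gm continuous_imp_measurable_on_sets_lebesgue fuc) auto
  have "bounded ((\<lambda>x. f (u x)) ` {c..d})"
    by (intro compact_imp_bounded compact_continuous_image fuc) auto
  then obtain N where N: "\<And>x. x \<in> {c..d} \<Longrightarrow> \<bar>f (u x)\<bar> \<le> N"
    unfolding bounded_iff ball_simps real_norm_def by blast
  show ?thesis
  proof (rule primitive_onI[OF meas])
    show bd: "\<bar>f (u x) * g x\<bar> \<le> N * M'" if "x \<in> {c..d}" for x
      unfolding abs_mult using N[OF that] M'[OF that] by (intro mult_mono) linarith+
    fix e :: real assume "e > 0"
    have "uniformly_continuous_on {c..d} (\<lambda>x. f (u x))"
      by (rule compact_uniformly_continuous[OF fuc]) auto
    then obtain \<delta> where \<delta>: "\<delta> > 0" "\<And>x y. x \<in> {c..d} \<Longrightarrow> y \<in> {c..d} \<Longrightarrow> dist y x < \<delta> \<Longrightarrow> dist (f (u y)) (f (u x)) < e / M'"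
      unfolding uniformly_continuous_on_def using divide_pos_pos[OF \<open>e > 0\<close> \<open>M' > 0\<close>] by blast
    have "\<bar>F (u y) - F (u x) - integral {x..y} (\<lambda>x. f (u x) * g x)\<bar> \<le> e * (y - x)"
      if xy: "c \<le> x" "x \<le> y" "y \<le> d" "y - x < \<delta>" for x y
    proof -
      have "\<exists>\<theta>. \<theta> \<in> closed_segment (u x) (u y) \<and> F (u y) - F (u x) = f \<theta> * (u y - u x)"
      proof (cases "u x" "u y" rule: linorder_cases)
        case less
        then obtain z where "u x < z" "z < u y" "F (u y) - F (u x) = (u y - u x) * f z"
          using MVT2[OF less, of F f] F by blast
        then show ?thesis by (intro exI[of _ z]) (auto simp: closed_segment_eq_real_ivl algebra_simps)
      next
        case equal then show ?thesis by auto
      next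
        case greater
        then obtain z where "u y < z" "z < u x" "F (u x) - F (u y) = (u x - u y) * f z"
          using MVT2[OF greater, of F f] F by blast
        then show ?thesis by (intro exI[of _ z]) (auto simp: closed_segment_eq_real_ivl algebra_simps)
      qed
      then obtain \<theta> where th: "\<theta> \<in> closed_segment (u x) (u y)" "F (u y) - F (u x) = f \<theta> * (u y - u x)" by blast
      have "\<exists>p\<in>{x..y}. u p = \<theta>"
      proof -
        have "continuous_on {x..y} u" using uc by (rule continuous_on_subset) (use xy in auto)
        then show ?thesis
          using th(1) IVT'[of u x \<theta> y] IVT2'[of u y \<theta> x] xy
          unfolding closed_segment_eq_real_ivl by (metis atLeastAtMost_iff)
      qed
      then obtain p where p: "p \<in> {x..y}" "u p = \<theta>" by blast
      have g: "(g has_integral u y - u x) {x..y}" using u xy unfolding primitive_on_def by blast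
      have h1: "((\<lambda>r. f (u p) * g r) has_integral f (u p) * (u y - u x)) {x..y}"
        by (rule has_integral_mult_right[OF g])
      have fg: "(\<lambda>x. f (u x) * g x) integrable_on {x..y}"
        by (rule bounded_measurable_integrable_on[OF meas bd]) (use xy in auto)
      have "((\<lambda>r. f (u p) * g r - f (u r) * g r) has_integral 
         (F (u y) - F (u x) - integral {x..y} (\<lambda>x. f (u x) * g x))) {x..y}"
        unfolding th(2) p(2)[symmetric]
        by (rule has_integral_diff[OF h1 integrable_integral[OF fg]])
      moreover have "norm (f (u p) * g r - f (u r) * g r) \<le> e" if r: "r \<in> cbox x y" for r
      proof -
        have "\<bar>f (u p) - f (u r)\<bar> * \<bar>g r\<bar> \<le> e / M' * M'"
          using \<delta>(2)[of r p] r p(1) xy M'[of r] \<open>e>0\<close> \<open>M'>0\<close>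
          by (intro mult_mono) (simp_all add: dist_real_def, linarith)
        then show ?thesis using \<open>M' > 0\<close> by (simp add: abs_mult[symmetric] algebra_simps)
      qed
      ultimately have "norm (F (u y) - F (u x) - integral {x..y} (\<lambda>x. f (u x) * g x)) \<le> e * measure lborel (cbox x y)"
        using \<open>e > 0\<close> by (intro has_integral_bound[of e]) auto
      then show ?thesis using xy by simp
    qed
    then show "\<exists>\<delta>>0. \<forall>x y. c \<le> x \<and> x \<le> y \<and> y \<le> d \<and> y - x < \<delta> \<longrightarrow>
        \<bar>F (u y) - F (u x) - integral {x..y} (\<lambda>x. f (u x) * g x)\<bar> \<le> e * (y - x)"
      using \<delta>(1) by blast
  qed
qed

text \<open>Extends the chain rule to functions with a kink by dominated convergence. Since
  \<open>u\<close> may stay at the kink on a set of positive measure, the derivatives are required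
  to converge at every point.\<close>

lemma primitive_on_chain_limit:
  assumes u: "primitive_on c d u g"
    and F: "\<And>n y. (F n has_real_derivative f n y) (at y)" and f: "\<And>n. continuous_on UNIV (f n)"
    and fb: "\<And>n y. \<bar>f n y\<bar> \<le> N"
    and Fl: "\<And>y. (\<lambda>n. F n y) \<longlonglongrightarrow> F' y" and fl: "\<And>y. (\<lambda>n. f n y) \<longlonglongrightarrow> f' y"
  shows "primitive_on c d (\<lambda>x. F' (u x)) (\<lambda>x. f' (u x) * g x)"
proof -
  have ch: "primitive_on c d (\<lambda>x. F n (u x)) (\<lambda>x. f n (u x) * g x)" for n
    by (rule primitive_on_chain[OF u F f])
  obtain M where M: "\<And>x. x \<in> {c..d} \<Longrightarrow> \<bar>g x\<bar> \<le> M" using u unfolding primitive_on_def by blast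
  have f'b: "\<bar>f' y\<bar> \<le> N" for y
    by (rule LIMSEQ_le_const2[OF tendsto_rabs[OF fl]]) (use fb in auto)
  have lim: "(\<lambda>n. f n (u x) * g x) \<longlonglongrightarrow> f' (u x) * g x" for x
    by (intro tendsto_intros fl)
  have bb: "\<bar>f n (u x) * g x\<bar> \<le> N * M" if "x \<in> {c..d}" for n x
    unfolding abs_mult using fb[of n "u x"] M[OF that] by (intro mult_mono) auto
  have bb': "\<bar>f' (u x) * g x\<bar> \<le> N * M" if "x \<in> {c..d}" for x
    unfolding abs_mult using f'b[of "u x"] M[OF that] by (intro mult_mono) auto
  have meas: "(\<lambda>x. f' (u x) * g x) \<in> borel_measurable (lebesgue_on {c..d})"
    by (rule borel_measurable_LIMSEQ_real[OF lim])
      (use ch in \<open>auto simp: primitive_on_def\<close>)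
  show ?thesis unfolding primitive_on_def
  proof (intro conjI allI impI)
    show "\<exists>M. \<forall>x\<in>{c..d}. \<bar>f' (u x) * g x\<bar> \<le> M" using bb' by blast
    fix x y assume xy: "c \<le> x \<and> x \<le> y \<and> y \<le> d"
    have hi: "((\<lambda>x. f n (u x) * g x) has_integral F n (u y) - F n (u x)) {x..y}" for n
      using ch[of n] xy unfolding primitive_on_def by blast
    have hii: "(\<lambda>x. f n (u x) * g x) integrable_on {x..y}" for n
      using hi[of n] by blast
    have bn: "norm (f n (u r) * g r) \<le> N * M" if "r \<in> {x..y}" for n r
      using bb[of r n] that xy by auto
    have "(\<lambda>_. N * M) integrable_on {x..y}" by auto
    note dc = dominated_convergence[of "\<lambda>n x. f n (u x) * g x" "{x..y}" "\<lambda>_. N * M" "\<lambda>x. f' (u x) * g x",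
        OF hii this bn lim]
    have i: "(\<lambda>x. f' (u x) * g x) integrable_on {x..y}"
      and l: "(\<lambda>n. integral {x..y} (\<lambda>x. f n (u x) * g x)) \<longlonglongrightarrow> integral {x..y} (\<lambda>x. f' (u x) * g x)"
      using dc by blast+
    have "(\<lambda>n. F n (u y) - F n (u x)) \<longlonglongrightarrow> integral {x..y} (\<lambda>x. f' (u x) * g x)"
      using l integral_unique[OF hi] by simp
    then have "integral {x..y} (\<lambda>x. f' (u x) * g x) = F' (u y) - F' (u x)"
      by (rule LIMSEQ_unique) (intro tendsto_intros Fl)
    then show "((\<lambda>x. f' (u x) * g x) has_integral F' (u y) - F' (u x)) {x..y}"
      using integrable_integral[OF i] by (simp only:)
  qed (rule meas)
qed

section \<open>Algebra of primitives\<close>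

lemma primitive_on_add:
  assumes "primitive_on c d u g" "primitive_on c d v h"
  shows "primitive_on c d (\<lambda>x. u x + v x) (\<lambda>x. g x + h x)"
  unfolding primitive_on_def
proof (intro conjI allI impI)
  obtain M N where "\<forall>x\<in>{c..d}. \<bar>g x\<bar> \<le> M" "\<forall>x\<in>{c..d}. \<bar>h x\<bar> \<le> N"
    using assms unfolding primitive_on_def by blast
  then have "\<forall>x\<in>{c..d}. \<bar>g x + h x\<bar> \<le> M + N" by (meson abs_triangle_ineq add_mono order_trans)
  then show "\<exists>M. \<forall>x\<in>{c..d}. \<bar>g x + h x\<bar> \<le> M" by blast
  show "(\<lambda>x. g x + h x) \<in> borel_measurable (lebesgue_on {c..d})"
    using assms unfolding primitive_on_def by (intro borel_measurable_add) blast+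
  fix x y assume "c \<le> x \<and> x \<le> y \<and> y \<le> d"
  then have "(g has_integral u y - u x) {x..y}" "(h has_integral v y - v x) {x..y}"
    using assms unfolding primitive_on_def by blast+
  from has_integral_add[OF this]
  show "((\<lambda>x. g x + h x) has_integral u y + v y - (u x + v x)) {x..y}"
    by (simp only: add_diff_add)
qed

lemma primitive_on_cmult:
  assumes "primitive_on c d u g"
  shows "primitive_on c d (\<lambda>x. k * u x) (\<lambda>x. k * g x)"
  unfolding primitive_on_def
proof (intro conjI allI impI)
  obtain M where "\<forall>x\<in>{c..d}. \<bar>g x\<bar> \<le> M" using assms unfolding primitive_on_def by blast
  then have "\<forall>x\<in>{c..d}. \<bar>k * g x\<bar> \<le> \<bar>k\<bar> * M" by (simp add: abs_mult mult_left_mono)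
  then show "\<exists>M. \<forall>x\<in>{c..d}. \<bar>k * g x\<bar> \<le> M" by blast
  show "(\<lambda>x. k * g x) \<in> borel_measurable (lebesgue_on {c..d})"
    using assms unfolding primitive_on_def by (intro borel_measurable_times) auto
  fix x y assume "c \<le> x \<and> x \<le> y \<and> y \<le> d"
  then have "(g has_integral u y - u x) {x..y}"
    using assms unfolding primitive_on_def by blast
  from has_integral_mult_right[OF this, of k]
  show "((\<lambda>x. k * g x) has_integral k * u y - k * u x) {x..y}"
    by (simp only: right_diff_distrib)
qed

lemma primitive_on_diff:
  assumes "primitive_on c d u g" "primitive_on c d v h"
  shows "primitive_on c d (\<lambda>x. u x - v x) (\<lambda>x. g x - h x)"
  using primitive_on_add[OF assms(1) primitive_on_cmult[OF assms(2), of "-1"]] by simp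

text \<open>Polarization: a product is a quarter of the difference of two squares, so the chain rule
  for squaring suffices.\<close>

lemma primitive_on_mult:
  assumes "primitive_on c d u g" "primitive_on c d v h"
  shows "primitive_on c d (\<lambda>x. u x * v x) (\<lambda>x. g x * v x + u x * h x)"
proof -
  have sq: "primitive_on c d (\<lambda>x. (k x)\<^sup>2) (\<lambda>x. 2 * k x * k' x)" if "primitive_on c d k k'" for k k'
    by (rule primitive_on_chain[OF that, where f="\<lambda>y. 2 * y"])
      (auto intro!: derivative_eq_intros continuous_intros)
  have "primitive_on c d (\<lambda>x. 1/4 * ((u x + v x)\<^sup>2 - (u x - v x)\<^sup>2))
     (\<lambda>x. 1/4 * (2 * (u x + v x) * (g x + h x) - 2 * (u x - v x) * (g x - h x)))"
    by (intro primitive_on_cmult primitive_on_diff sq primitive_on_add assms)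
  moreover have "1/4 * ((u x + v x)\<^sup>2 - (u x - v x)\<^sup>2) = u x * v x" for x
    by (simp add: power2_eq_square algebra_simps)
  moreover have "1/4 * (2 * (u x + v x) * (g x + h x) - 2 * (u x - v x) * (g x - h x)) = g x * v x + u x * h x" for x
    by (simp add: field_simps)
  ultimately show ?thesis by (simp only:)
qed

lemma primitive_on_C1:
  assumes F: "\<And>y. (F has_real_derivative f y) (at y)" and f: "continuous_on UNIV f"
  shows "primitive_on c d F f"
proof -
  have "primitive_on c d (\<lambda>x. x) (\<lambda>x. 1)"
    unfolding primitive_on_def
  proof (intro conjI allI impI)
    fix x y assume "c \<le> x \<and> x \<le> y \<and> y \<le> d"
    then show "((\<lambda>x. 1) has_integral y - x) {x..y}"
      using has_integral_const_real[of "1::real" x y] by simp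
  qed auto
  from primitive_on_chain[OF this F f] show ?thesis by simp
qed

section \<open>The slice inequality\<close>

text \<open>\<open>C\<^sup>1\<close> approximations of the Heaviside function that vanish on \<open>{..0}\<close>; the square makes the
  positive part differentiable.\<close>

definition smooth_step :: "nat \<Rightarrow> real \<Rightarrow> real" where
  "smooth_step n y = real n * (max 0 y)\<^sup>2 / (1 + real n * (max 0 y)\<^sup>2)"

lemma has_real_derivative_max_0_sq:
  "((\<lambda>y. (max 0 y)\<^sup>2) has_real_derivative 2 * max 0 y) (at (y::real))"
proof (cases y "0::real" rule: linorder_cases)
  case less
  have "((\<lambda>y. 0) has_real_derivative 0) (at y)" by simp
  then have "((\<lambda>y. (max 0 y)\<^sup>2) has_real_derivative 0) (at y)"
    by (rule has_field_derivative_transform_within_open[of _ _ _ "{..<0}"]) (use less in auto)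
  then show ?thesis using less by simp
next
  case greater
  have "((\<lambda>y. y\<^sup>2) has_real_derivative 2 * y) (at y)" by (auto intro!: derivative_eq_intros)
  then have "((\<lambda>y. (max 0 y)\<^sup>2) has_real_derivative 2 * y) (at y)"
    by (rule has_field_derivative_transform_within_open[of _ _ _ "{0<..}"]) (use greater in auto)
  then show ?thesis using greater by simp
next
  case equal
  have "((\<lambda>h. ((max 0 (0 + h))\<^sup>2 - (max 0 0)\<^sup>2) / h) \<longlongrightarrow> 0) (at (0::real))"
  proof (rule Lim_null_comparison[where g="\<lambda>h. \<bar>h\<bar>"])
    show "\<forall>\<^sub>F h in at (0::real). norm (((max 0 (0 + h))\<^sup>2 - (max 0 0)\<^sup>2) / h) \<le> \<bar>h\<bar>"
      by (rule always_eventually) (auto simp: max_def power2_eq_square)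
    show "((\<lambda>h. \<bar>h\<bar>) \<longlongrightarrow> 0) (at (0::real))" by (rule tendsto_eq_intros refl | simp)+
  qed
  then show ?thesis using equal unfolding DERIV_def by simp
qed

lemma one_plus_max_sq_pos: "1 + real n * (max 0 y)\<^sup>2 > 0"
  by (simp add: add_pos_nonneg)

lemma smooth_step_has_derivative:
  "(smooth_step n has_real_derivative 2 * real n * max 0 y / (1 + real n * (max 0 y)\<^sup>2)\<^sup>2) (at y)"
proof -
  have "1 + real n * (max 0 y)\<^sup>2 \<noteq> 0" using one_plus_max_sq_pos[of n y] by simp
  moreover have d: "((\<lambda>y. real n * (max 0 y)\<^sup>2) has_real_derivative real n * (2 * max 0 y)) (at y)"
    by (rule DERIV_cmult[OF has_real_derivative_max_0_sq])
  moreover have "((\<lambda>y. 1 + real n * (max 0 y)\<^sup>2) has_real_derivative real n * (2 * max 0 y)) (at y)"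
    using DERIV_add[OF DERIV_const d, of 1] by simp
  ultimately show ?thesis
    unfolding smooth_step_def[abs_def]
    by (intro DERIV_cong[OF DERIV_divide]) (auto simp: power2_eq_square algebra_simps)
qed

lemma smooth_step_deriv_continuous:
  "continuous_on UNIV (\<lambda>y. 2 * real n * max 0 y / (1 + real n * (max 0 y)\<^sup>2)\<^sup>2)"
proof -
  have "(1 + real n * (max 0 y)\<^sup>2)\<^sup>2 \<noteq> 0" for y using one_plus_max_sq_pos[of n y] by simp
  then show ?thesis by (intro continuous_intros) auto
qed

lemma smooth_step_continuous: "continuous_on UNIV (smooth_step n)"
  by (rule DERIV_continuous_on[OF has_field_derivative_at_within[OF smooth_step_has_derivative]])

lemma smooth_step_bounds: "0 \<le> smooth_step n y" "smooth_step n y \<le> 1"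
  unfolding smooth_step_def using one_plus_max_sq_pos[of n y] by (simp_all add: divide_le_eq)

lemma smooth_step_nonpos: "y \<le> 0 \<Longrightarrow> smooth_step n y = 0"
  unfolding smooth_step_def by simp

lemma smooth_step_tendsto: "(\<lambda>n. smooth_step n y) \<longlonglongrightarrow> of_bool (y > 0)"
proof (cases "y > 0")
  case True
  have "smooth_step n y = 1 - 1 / (1 + real n * y\<^sup>2)" for n
    unfolding smooth_step_def using True one_plus_max_sq_pos[of n y] by (simp add: field_simps)
  moreover have "(\<lambda>n. 1 - 1 / (1 + real n * y\<^sup>2)) \<longlonglongrightarrow> 1 - 0"
  proof (intro tendsto_intros)
    have "filterlim (\<lambda>n. 1 + real n * y\<^sup>2) at_top sequentially"
      by (intro filterlim_tendsto_add_at_top[OF tendsto_const]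
          filterlim_at_top_mult_tendsto_pos[OF tendsto_const _ filterlim_real_sequentially])
        (use True in auto)
    then show "(\<lambda>n. 1 / (1 + real n * y\<^sup>2)) \<longlonglongrightarrow> 0"
      by (intro tendsto_divide_0[OF tendsto_const] filterlim_at_top_imp_at_infinity)
  qed
  ultimately show ?thesis using True by simp
qed (simp add: smooth_step_nonpos)

text \<open>The approximations \<open>sqrt ((max 0 y)\<^sup>2 + (e n)\<^sup>2)\<close> have
  derivatives bounded by 1 that are exactly zero for \<open>y \<le> 0\<close>. In the limit the kink
  therefore receives the value 0, which produces the strict inequality in the density.\<close>

lemma primitive_on_pos_part:
  assumes u: "primitive_on c d u g"
  shows "primitive_on c d (\<lambda>x. max 0 (u x)) (\<lambda>x. of_bool (u x > 0) * g x)"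
proof -
  define e where "e = (\<lambda>n. 1 / real (Suc n))"
  have e0: "e n > 0" for n unfolding e_def by simp
  have el: "e \<longlonglongrightarrow> 0" unfolding e_def using LIMSEQ_inverse_real_of_nat by (simp add: inverse_eq_divide)
  have pos: "(max 0 y)\<^sup>2 + (e n)\<^sup>2 > 0" for n and y :: real using e0[of n] by (simp add: add_nonneg_pos)
  show ?thesis
  proof (rule primitive_on_chain_limit[OF u, where F="\<lambda>n y. sqrt ((max 0 y)\<^sup>2 + (e n)\<^sup>2)"
        and f="\<lambda>n y. max 0 y / sqrt ((max 0 y)\<^sup>2 + (e n)\<^sup>2)" and N=1])
    fix n y
    have d: "((\<lambda>y. (max 0 y)\<^sup>2 + (e n)\<^sup>2) has_real_derivative 2 * max 0 y) (at y)"
      using DERIV_add[OF has_real_derivative_max_0_sq DERIV_const] by simp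
    have "((\<lambda>y. sqrt ((max 0 y)\<^sup>2 + (e n)\<^sup>2)) has_real_derivative
        inverse (sqrt ((max 0 y)\<^sup>2 + (e n)\<^sup>2)) / 2 * (2 * max 0 y)) (at y)"
      by (rule DERIV_chain2[OF DERIV_real_sqrt[OF pos] d])
    then show "((\<lambda>y. sqrt ((max 0 y)\<^sup>2 + (e n)\<^sup>2)) has_real_derivative
        max 0 y / sqrt ((max 0 y)\<^sup>2 + (e n)\<^sup>2)) (at y)" 
      by (rule DERIV_cong) (simp add: inverse_eq_divide)
    have "max 0 y \<le> sqrt ((max 0 y)\<^sup>2 + (e n)\<^sup>2)" by (rule real_le_rsqrt) simp
    then show "\<bar>max 0 y / sqrt ((max 0 y)\<^sup>2 + (e n)\<^sup>2)\<bar> \<le> 1"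
      using pos[of y n] by (simp add: abs_div divide_le_eq)
    show "continuous_on UNIV (\<lambda>y. max 0 y / sqrt ((max 0 y)\<^sup>2 + (e n)\<^sup>2))"
      using pos by (intro continuous_intros) (auto simp: less_le)
  next
    fix y :: real
    have "(\<lambda>n. sqrt ((max 0 y)\<^sup>2 + (e n)\<^sup>2)) \<longlonglongrightarrow> sqrt ((max 0 y)\<^sup>2 + 0\<^sup>2)"
      by (intro tendsto_intros el)
    then show l: "(\<lambda>n. sqrt ((max 0 y)\<^sup>2 + (e n)\<^sup>2)) \<longlonglongrightarrow> max 0 y" by simp
    show "(\<lambda>n. max 0 y / sqrt ((max 0 y)\<^sup>2 + (e n)\<^sup>2)) \<longlonglongrightarrow> of_bool (y > 0)"
    proof (cases "y > 0")
      case True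
      then have "(\<lambda>n. max 0 y / sqrt ((max 0 y)\<^sup>2 + (e n)\<^sup>2)) \<longlonglongrightarrow> max 0 y / max 0 y"
        by (intro tendsto_divide tendsto_const l) auto
      then show ?thesis using True by simp
    qed (simp add: max_def)
  qed
qed

text \<open>\<open>beta\<close> is, up to an additive constant, the primitive of the step function \<open>bcoef\<close>.\<close>

definition bcoef :: "real \<Rightarrow> real \<Rightarrow> real \<Rightarrow> real \<Rightarrow> real" where
  "bcoef bH bL \<gamma> y = (if y < \<gamma> then bH else bL)"

definition beta :: "real \<Rightarrow> real \<Rightarrow> real \<Rightarrow> real \<Rightarrow> real" where
  "beta bH bL \<gamma> y = bL * y - (bH - bL) * max 0 (\<gamma> - y)"

text \<open>The strict inequality in the density of the positive part of \<open>\<gamma> - u\<close>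
  matches the condition \<open>y < \<gamma>\<close> in \<open>bcoef\<close>. The formula for the
  density thus holds also on the level set \<open>u = \<gamma>\<close>, without an exceptional
  set.\<close>

lemma primitive_on_beta:
  assumes u: "primitive_on c d u g"
  shows "primitive_on c d (\<lambda>x. beta bH bL \<gamma> (u x)) (\<lambda>x. bcoef bH bL \<gamma> (u x) * g x)"
proof -
  have "primitive_on c d (\<lambda>x. \<gamma>) (\<lambda>x. 0)" by (rule primitive_on_C1) auto
  from primitive_on_diff[OF this u]
  have "primitive_on c d (\<lambda>x. \<gamma> - u x) (\<lambda>x. 0 - g x)" .
  note primitive_on_diff[OF primitive_on_cmult[OF u, of bL]
      primitive_on_cmult[OF primitive_on_pos_part[OF this], of "bH - bL"]]
  moreover have "bL * g x - (bH - bL) * (of_bool (0 < \<gamma> - u x) * (0 - g x)) = bcoef bH bL \<gamma> (u x) * g x" for x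
    by (auto simp: bcoef_def algebra_simps)
  ultimately show ?thesis unfolding beta_def by (simp only:)
qed

text \<open>The smaller slope \<open>bL\<close> is a lower bound for the growth of
  \<open>beta\<close>. This is what bounds the positive part of a difference of solutions by
  \<open>1 / bL\<close> times the positive part of the difference of their images.\<close>

lemma beta_mono:
  assumes "bL > 0" "bH > bL" "x \<le> y"
  shows "bL * (y - x) \<le> beta bH bL \<gamma> y - beta bH bL \<gamma> x"
proof -
  have "(bH - bL) * max 0 (\<gamma> - y) \<le> (bH - bL) * max 0 (\<gamma> - x)"
    using assms by (intro mult_left_mono) auto
  then show ?thesis unfolding beta_def by (simp add: algebra_simps)
qed

text \<open>Lets one indicator serve both as the set where the difference of the solutions is
  positive and as the set where the difference of their images under \<open>beta\<close> is
  positive.\<close>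

lemma beta_less_iff:
  assumes "bL > 0" "bH > bL"
  shows "beta bH bL \<gamma> x < beta bH bL \<gamma> y \<longleftrightarrow> x < y"
proof -
  have "beta bH bL \<gamma> x < beta bH bL \<gamma> y" if "x < y" for x y
    using beta_mono[OF assms, of x y \<gamma>] that mult_pos_pos[of bL "y - x"] assms by linarith
  then show ?thesis by (metis linorder_neqE_linordered_idom order_less_asym)
qed

lemma continuous_on_beta: "continuous_on S (beta bH bL \<gamma>)"
  unfolding beta_def[abs_def] by (intro continuous_intros)

text \<open>Both slopes are at most \<open>bH\<close>. If \<open>x\<close> and \<open>y\<close> lie
  on different sides of \<open>\<gamma>\<close>, positivity of \<open>\<gamma>\<close> gives
  \<open>y > 0\<close>, hence \<open>bL * y \<le> bH * y\<close>, and the bound persists. The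
  increment is then measured by \<open>beta\<close>, because the energy is built from
  \<open>beta\<close>.\<close>

lemma bcoef_mult_one_sided_Lipschitz:
  assumes "bL > 0" "bH > bL" "\<gamma> > 0" "x < y"
  shows "bcoef bH bL \<gamma> y * y - bcoef bH bL \<gamma> x * x \<le> bH / bL * (beta bH bL \<gamma> y - beta bH bL \<gamma> x)"
proof -
  have "bcoef bH bL \<gamma> y * y - bcoef bH bL \<gamma> x * x \<le> bH * (y - x)"
  proof (cases "x < \<gamma> \<and> \<not> y < \<gamma>")
    case True
    then have "bL * y \<le> bH * y" using assms by (intro mult_right_mono) auto
    then show ?thesis using True by (auto simp: bcoef_def algebra_simps)
  next
    case False
    have "bL * (y - x) \<le> bH * (y - x)" using assms by (intro mult_right_mono) auto
    then show ?thesis using False assms(4) by (auto simp: bcoef_def algebra_simps)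
  qed
  also have "\<dots> = bH / bL * (bL * (y - x))" using assms by simp
  also have "\<dots> \<le> bH / bL * (beta bH bL \<gamma> y - beta bH bL \<gamma> x)"
    using assms by (intro mult_left_mono beta_mono) auto
  finally show ?thesis .
qed

text \<open>Test with \<open>exp (-x) * smooth_step n (w x)\<close>: the term containing the derivative of
  \<open>smooth_step n\<close> is \<open>\<le> 0\<close>.\<close>

lemma kato_slice:
  assumes w: "primitive_on A L w p" and p: "primitive_on A L p q" and AL: "A \<le> L" and wA: "w A \<le> 0"
  shows "(\<lambda>x. exp (-x) * (of_bool (w x > 0) * (q x - p x))) integrable_on {A..L}"
    and "integral {A..L} (\<lambda>x. exp (-x) * (of_bool (w x > 0) * (q x - p x))) \<le> exp (-L) * \<bar>p L\<bar>"
proof -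
  define s' where "s' = (\<lambda>n y. 2 * real n * max 0 y / (1 + real n * (max 0 y)\<^sup>2)\<^sup>2)"
  have ph: "primitive_on A L (\<lambda>x. exp (-x)) (\<lambda>x. - exp (-x) :: real)"
    by (rule primitive_on_C1) (auto intro!: derivative_eq_intros continuous_intros)
  have s: "primitive_on A L (\<lambda>x. smooth_step n (w x)) (\<lambda>x. s' n (w x) * p x)" for n
    unfolding s'_def
    by (rule primitive_on_chain[OF w smooth_step_has_derivative smooth_step_deriv_continuous])
  note P = primitive_on_mult[OF ph primitive_on_mult[OF s p]]
  have pc: "continuous_on {A..L} p" "continuous_on {A..L} w"
    using primitive_on_continuous p w by blast+
  have qm: "q \<in> borel_measurable (lebesgue_on {A..L})" using p unfolding primitive_on_def by blast
  obtain Q where Q: "\<And>x. x \<in> {A..L} \<Longrightarrow> \<bar>q x\<bar> \<le> Q" using p unfolding primitive_on_def by blast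
  have "bounded (p ` {A..L})" by (intro compact_imp_bounded compact_continuous_image pc) auto
  then obtain M where M: "\<And>x. x \<in> {A..L} \<Longrightarrow> \<bar>p x\<bar> \<le> M"
    unfolding bounded_iff ball_simps real_norm_def by blast
  define B where "B = exp (-A) * (Q + M)"
  have bnd: "\<bar>exp (-x) * (r * (q x - p x))\<bar> \<le> B" if "0 \<le> r" "r \<le> 1" "x \<in> {A..L}" for r x
  proof -
    have "\<bar>r * (q x - p x)\<bar> \<le> 1 * (Q + M)" unfolding abs_mult
      by (rule mult_mono) (use that Q[of x] M[of x] in auto)
    then show ?thesis unfolding abs_mult[of "exp (-x)"] B_def
      using that by (intro mult_mono) auto
  qed
  define f where "f = (\<lambda>n x. exp (-x) * (smooth_step n (w x) * (q x - p x)))"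
  have fm: "f n \<in> borel_measurable (lebesgue_on {A..L})" for n
    unfolding f_def
    by (intro borel_measurable_times borel_measurable_diff qm continuous_imp_measurable_on_sets_lebesgue pc
        continuous_on_compose2[OF smooth_step_continuous pc(2)] continuous_intros) auto
  have fi: "f n integrable_on {A..L}" for n
    by (rule bounded_measurable_integrable_on[OF fm, where M=B]) (auto simp: f_def smooth_step_bounds intro!: bnd)
  have fle: "integral {A..L} (f n) \<le> exp (-L) * \<bar>p L\<bar>" for n
  proof -
    \<comment> \<open>\<open>G\<close> is the density of
      \<open>exp (-x) * (smooth_step n (w x) * p x)\<close>. This primitive vanishes at
      \<open>A\<close> because \<open>w A \<le> 0\<close>, so only the flux at \<open>L\<close>
      survives; \<open>G\<close> exceeds \<open>f n\<close> by the term with \<open>s'\<close> times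
      the square of \<open>p\<close>.\<close>
    define G where "G = (\<lambda>x. - exp (- x) * (smooth_step n (w x) * p x) +
          exp (- x) * (s' n (w x) * p x * p x + smooth_step n (w x) * q x))"
    have G: "(G has_integral exp (-L) * (smooth_step n (w L) * p L)) {A..L}"
      using primitive_onD[OF P[of n], of A L] AL smooth_step_nonpos[OF wA, of n] unfolding G_def by simp
    have "integral {A..L} (f n) \<le> integral {A..L} G"
    proof (rule integral_le[OF fi])
      show "G integrable_on {A..L}" using G by blast
      fix x
      have "0 \<le> exp (-x) * (s' n (w x) * (p x * p x))"
        unfolding s'_def by (intro mult_nonneg_nonneg[OF _ mult_nonneg_nonneg[OF _ zero_le_square]] divide_nonneg_nonneg) auto
      then show "f n x \<le> G x" unfolding f_def G_def by (simp add: algebra_simps)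
    qed
    also have "\<dots> = exp (-L) * (smooth_step n (w L) * p L)" using G by (rule integral_unique)
    also have "\<dots> \<le> exp (-L) * \<bar>p L\<bar>"
    proof (rule mult_left_mono)
      have "smooth_step n (w L) * p L \<le> smooth_step n (w L) * \<bar>p L\<bar>"
        by (intro mult_left_mono smooth_step_bounds) auto
      also have "\<dots> \<le> 1 * \<bar>p L\<bar>" by (intro mult_right_mono smooth_step_bounds) auto
      finally show "smooth_step n (w L) * p L \<le> \<bar>p L\<bar>" by simp
    qed simp
    finally show ?thesis .
  qed
  have lim: "(\<lambda>n. f n x) \<longlonglongrightarrow> exp (-x) * (of_bool (w x > 0) * (q x - p x))" for x
    unfolding f_def by (intro tendsto_intros smooth_step_tendsto)
  have nb: "norm (f n x) \<le> B" if "x \<in> {A..L}" for n x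
    unfolding f_def real_norm_def by (intro bnd smooth_step_bounds that)
  have "(\<lambda>_. B) integrable_on {A..L}" by auto
  note dc = dominated_convergence[of f, OF fi this nb lim]
  show "(\<lambda>x. exp (-x) * (of_bool (w x > 0) * (q x - p x))) integrable_on {A..L}" using dc by blast
  show "integral {A..L} (\<lambda>x. exp (-x) * (of_bool (w x > 0) * (q x - p x))) \<le> exp (-L) * \<bar>p L\<bar>"
    by (rule LIMSEQ_le_const2[of "\<lambda>n. integral {A..L} (f n)"]) (use dc fle in blast)+
qed

text \<open>Integration by parts against the weight. It trades a first-order term for a boundary
  term at \<open>L\<close> and the weighted integral of the function itself.\<close>

lemma exp_weighted_primitive:
  assumes u: "primitive_on A L u g" and "A \<le> L" "u A = 0"
  shows "((\<lambda>x. exp (-x) * g x) has_integral exp (-L) * u L + integral {A..L} (\<lambda>x. exp (-x) * u x)) {A..L}"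
proof -
  have ph: "primitive_on A L (\<lambda>x. exp (-x)) (\<lambda>x. - exp (-x) :: real)"
    by (rule primitive_on_C1) (auto intro!: derivative_eq_intros continuous_intros)
  have "((\<lambda>x. - exp (- x) * u x + exp (- x) * g x) has_integral exp (-L) * u L) {A..L}"
    using primitive_onD[OF primitive_on_mult[OF ph u], of A L] assms by simp
  moreover have "(\<lambda>x. exp (-x) * u x) integrable_on {A..L}"
    by (intro integrable_continuous_real continuous_intros primitive_on_continuous[OF u])
  ultimately show ?thesis
    using has_integral_add[OF _ integrable_integral, of "\<lambda>x. - exp (- x) * u x + exp (- x) * g x" _ "{A..L}" "\<lambda>x. exp (-x) * u x"]
    by simp
qed

text \<open>With p and q the differences of the first and second derivatives, split q + p as (q - p)
  + 2 p. Kato's inequality leaves from the first summand only a flux at \<open>L\<close>, bounded by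
  \<open>2 * N\<close>; the second integrates to twice the positive part of \<open>w\<close>, which
  is at most \<open>z / bL\<close>. The term with \<delta> is \<delta> times the derivative of
  \<open>z\<close>. This explains the summands \<open>2 / bL\<close> and \<open>\<delta>\<close> in
  both constants; \<open>\<delta> * bH / bL\<close> is the zeroth-order term carried along
  unchanged.\<close>

lemma slice_inequality:
  fixes v1 v2 p1 p2 q1 q2 :: "real \<Rightarrow> real" and bH bL \<gamma> :: real
  defines "b \<equiv> bcoef bH bL \<gamma>" and "w \<equiv> \<lambda>x. v1 x - v2 x"
    and "z \<equiv> \<lambda>x. max 0 (beta bH bL \<gamma> (v1 x) - beta bH bL \<gamma> (v2 x))"
  assumes v1: "primitive_on A L v1 p1" and p1: "primitive_on A L p1 q1"
    and v2: "primitive_on A L v2 p2" and p2: "primitive_on A L p2 q2"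
    and AL: "A \<le> L" and A: "v1 A = v2 A" and c: "bL > 0" "bH > bL" "\<delta> > 0" "\<gamma> > 0"
    and pL: "\<bar>p1 L\<bar> \<le> N" "\<bar>p2 L\<bar> \<le> N" and zL: "z L \<le> K"
  shows "\<exists>I. ((\<lambda>x. exp (-x) * (of_bool (w x > 0) * (q1 x - q2 x + (p1 x - p2 x) + \<delta> * (b (v1 x) * p1 x - b (v2 x) * p2 x)))
        + \<delta> * bH / bL * (exp (-x) * z x)) has_integral I) {A..L} \<and>
      I \<le> exp (-L) * (2 * N + 2 / bL * K + \<delta> * K) + (2 / bL + \<delta> + \<delta> * bH / bL) * integral {A..L} (\<lambda>x. exp (-x) * z x)"
proof -
  have w: "primitive_on A L w (\<lambda>x. p1 x - p2 x)" unfolding w_def by (intro primitive_on_diff v1 v2)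
  have wp: "primitive_on A L (\<lambda>x. p1 x - p2 x) (\<lambda>x. q1 x - q2 x)" by (intro primitive_on_diff p1 p2)
  have z: "primitive_on A L z (\<lambda>x. of_bool (w x > 0) * (b (v1 x) * p1 x - b (v2 x) * p2 x))"
    using primitive_on_pos_part[OF primitive_on_diff[OF primitive_on_beta[OF v1, of bH bL \<gamma>]
          primitive_on_beta[OF v2, of bH bL \<gamma>]]]
    unfolding w_def z_def b_def by (simp add: beta_less_iff[OF c(1,2)])
  have wz: "max 0 (w x) \<le> 1 / bL * z x" for x
  proof (cases "w x \<ge> 0")
    case True
    then have "bL * w x \<le> z x" using beta_mono[OF c(1,2), of "v2 x" "v1 x" \<gamma>] unfolding w_def z_def by auto
    then show ?thesis using True c by (simp add: field_simps)
  next
    case False then show ?thesis using c by (simp add: z_def)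
  qed
  note k = kato_slice[OF w wp AL]
  have wA: "w A \<le> 0" and zA: "z A = 0" and w'A: "max 0 (w A) = 0" using A by (auto simp: w_def z_def)
  define J1 where "J1 = integral {A..L} (\<lambda>x. exp (-x) * (of_bool (w x > 0) * ((q1 x - q2 x) - (p1 x - p2 x))))"
  define Jw where "Jw = integral {A..L} (\<lambda>x. exp (-x) * max 0 (w x))"
  define Jz where "Jz = integral {A..L} (\<lambda>x. exp (-x) * z x)"
  have h1: "((\<lambda>x. exp (-x) * (of_bool (w x > 0) * ((q1 x - q2 x) - (p1 x - p2 x)))) has_integral J1) {A..L}"
    unfolding J1_def by (rule integrable_integral[OF k(1)[OF wA]])
  have h2: "((\<lambda>x. exp (-x) * (of_bool (w x > 0) * (p1 x - p2 x))) has_integral exp (-L) * max 0 (w L) + Jw) {A..L}"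
    unfolding Jw_def by (rule exp_weighted_primitive[OF primitive_on_pos_part[OF w] AL w'A])
  have h3: "((\<lambda>x. exp (-x) * (of_bool (w x > 0) * (b (v1 x) * p1 x - b (v2 x) * p2 x))) has_integral exp (-L) * z L + Jz) {A..L}"
    unfolding Jz_def by (rule exp_weighted_primitive[OF z AL zA])
  have zi: "(\<lambda>x. exp (-x) * z x) integrable_on {A..L}"
    by (intro integrable_continuous_real continuous_intros primitive_on_continuous[OF z])
  then have h4: "((\<lambda>x. exp (-x) * z x) has_integral Jz) {A..L}"
    unfolding Jz_def by (rule integrable_integral)
  define I where "I = J1 + 2 * (exp (-L) * max 0 (w L) + Jw) + \<delta> * (exp (-L) * z L + Jz) + \<delta> * bH / bL * Jz"
  have "((\<lambda>x. exp (-x) * (of_bool (w x > 0) * ((q1 x - q2 x) - (p1 x - p2 x)))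
     + 2 * (exp (-x) * (of_bool (w x > 0) * (p1 x - p2 x)))
     + \<delta> * (exp (-x) * (of_bool (w x > 0) * (b (v1 x) * p1 x - b (v2 x) * p2 x)))
     + \<delta> * bH / bL * (exp (-x) * z x)) has_integral I) {A..L}"
    unfolding I_def by (intro has_integral_add has_integral_mult_right h1 h2 h3 h4)
  then have hI: "((\<lambda>x. exp (-x) * (of_bool (w x > 0) * (q1 x - q2 x + (p1 x - p2 x) + \<delta> * (b (v1 x) * p1 x - b (v2 x) * p2 x)))
        + \<delta> * bH / bL * (exp (-x) * z x)) has_integral I) {A..L}"
    by (rule has_integral_eq[rotated]) (simp add: algebra_simps)
  have "Jw \<le> integral {A..L} (\<lambda>x. 1 / bL * (exp (-x) * z x))"
    unfolding Jw_def
  proof (rule integral_le)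
    show "(\<lambda>x. exp (-x) * max 0 (w x)) integrable_on {A..L}"
      by (intro integrable_continuous_real continuous_intros primitive_on_continuous[OF w])
    show "(\<lambda>x. 1 / bL * (exp (-x) * z x)) integrable_on {A..L}"
      by (intro integrable_on_mult_right zi)
    show "exp (-x) * max 0 (w x) \<le> 1 / bL * (exp (-x) * z x)" for x
      using mult_left_mono[OF wz[of x], of "exp (-x)"] by (simp add: algebra_simps)
  qed
  also have "\<dots> = 1 / bL * Jz" unfolding Jz_def by (rule integral_mult_right)
  finally have Jw: "Jw \<le> 1 / bL * Jz" .
  have J1: "J1 \<le> exp (-L) * (2 * N)"
  proof -
    have "exp (-L) * \<bar>p1 L - p2 L\<bar> \<le> exp (-L) * (2 * N)" using pL by (intro mult_left_mono) auto
    then show ?thesis using k(2)[OF wA] unfolding J1_def by linarith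
  qed
  have "exp (-L) * max 0 (w L) \<le> exp (-L) * (1 / bL * K)"
  proof (rule mult_left_mono)
    have "1 / bL * z L \<le> 1 / bL * K" using zL c by (intro mult_left_mono) auto
    then show "max 0 (w L) \<le> 1 / bL * K" using wz[of L] by linarith
  qed simp
  moreover have "\<delta> * (exp (-L) * z L) \<le> \<delta> * (exp (-L) * K)"
    using zL c by (intro mult_left_mono) auto
  ultimately have "I \<le> exp (-L) * (2 * N) + 2 * (exp (-L) * (1 / bL * K) + 1 / bL * Jz) + \<delta> * (exp (-L) * K) + \<delta> * Jz + \<delta> * bH / bL * Jz"
    unfolding I_def distrib_left using J1 Jw by linarith
  also have "\<dots> = exp (-L) * (2 * N + 2 / bL * K + \<delta> * K) + (2 / bL + \<delta> + \<delta> * bH / bL) * Jz"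
    by (simp add: algebra_simps)
  finally have fin: "I \<le> exp (-L) * (2 * N + 2 / bL * K + \<delta> * K) + (2 / bL + \<delta> + \<delta> * bH / bL) * Jz" .
  show ?thesis by (rule exI[of _ I], rule conjI[OF hI fin[unfolded Jz_def]])
qed

section \<open>Weak derivatives on rectangles and their slices\<close>

text \<open>The function vanishes outside the open interval, but its support may reach the
  endpoints. A product of two such functions is thus a test function on every set that contains the
  closed rectangle.\<close>

definition test1 :: "real \<Rightarrow> real \<Rightarrow> (real \<Rightarrow> real) \<Rightarrow> (real \<Rightarrow> real) \<Rightarrow> bool" where
  "test1 a b \<eta> \<eta>' \<longleftrightarrow> (\<forall>x. (\<eta> has_real_derivative \<eta>' x) (at x)) \<and> continuous_on UNIV \<eta>' \<and>
     (\<forall>x. x \<notin> {a<..<b} \<longrightarrow> \<eta> x = 0)"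

lemma test1_continuous: "test1 a b \<eta> \<eta>' \<Longrightarrow> continuous_on UNIV \<eta>"
  unfolding test1_def by (rule DERIV_continuous_on[OF has_field_derivative_at_within]) blast

lemma test1_measurable:
  "test1 a b \<eta> \<eta>' \<Longrightarrow> \<eta> \<in> borel_measurable borel" "test1 a b \<eta> \<eta>' \<Longrightarrow> \<eta>' \<in> borel_measurable borel"
  using test1_continuous borel_measurable_continuous_onI unfolding test1_def by blast+

lemma test1_deriv_zero:
  assumes "test1 a b \<eta> \<eta>'" "x \<notin> {a..b}" shows "\<eta>' x = 0"
proof -
  have "((\<lambda>_. 0) has_real_derivative \<eta>' x) (at x)"
    by (rule has_field_derivative_transform_within_open[of \<eta> _ _ "- {a..b}"])
      (use assms in \<open>auto simp: test1_def\<close>)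
  then show ?thesis by (rule DERIV_unique) simp
qed

lemma continuous_bounded_on_interval:
  fixes f :: "real \<Rightarrow> real" assumes "continuous_on UNIV f"
  obtains B where "\<And>x. x \<in> {a..b} \<Longrightarrow> \<bar>f x\<bar> \<le> B" "B \<ge> 0"
proof -
  have "bounded (f ` {a..b})"
    by (intro compact_imp_bounded compact_continuous_image continuous_on_subset[OF assms]) auto
  then obtain B where "\<And>x. x \<in> {a..b} \<Longrightarrow> \<bar>f x\<bar> \<le> B" 
    unfolding bounded_iff ball_simps real_norm_def by blast
  then show ?thesis using that[of "max B 0"] by (meson max.cobounded1 max.cobounded2 order_trans)
qed

lemma test1_bounded:
  assumes "test1 a b \<eta> \<eta>'"
  obtains B where "\<And>x. \<bar>\<eta> x\<bar> \<le> B" "\<And>x. \<bar>\<eta>' x\<bar> \<le> B" "B \<ge> 0"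
proof -
  obtain B where B: "\<And>x. x \<in> {a..b} \<Longrightarrow> \<bar>\<eta> x\<bar> \<le> B" "B \<ge> 0"
    using continuous_bounded_on_interval[OF test1_continuous[OF assms]] by blast
  obtain C where C: "\<And>x. x \<in> {a..b} \<Longrightarrow> \<bar>\<eta>' x\<bar> \<le> C" "C \<ge> 0"
    using continuous_bounded_on_interval[of \<eta>'] assms unfolding test1_def by blast
  have "\<bar>\<eta> x\<bar> \<le> max B C" for x
    using B(1)[of x] B(2) assms unfolding test1_def by (cases "x \<in> {a..b}") fastforce+
  moreover have "\<bar>\<eta>' x\<bar> \<le> max B C" for x
    using C(1)[of x] C(2) test1_deriv_zero[OF assms, of x] by (cases "x \<in> {a..b}") fastforce+
  ultimately show ?thesis using that[of "max B C"] B(2) by auto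
qed

text \<open>The quadratic \<open>(x - c) * (d - x)\<close> is positive exactly on the interval
  between \<open>c\<close> and \<open>d\<close>, so \<open>smooth_step n\<close> of it is a C1
  approximation of the indicator of that interval.\<close>

lemma test1_step:
  assumes "a \<le> c" "c \<le> d" "d \<le> b"
  obtains s' where "test1 a b (\<lambda>x. smooth_step n ((x - c) * (d - x))) s'"
proof
  define r where "r = (\<lambda>y. 2 * real n * max 0 y / (1 + real n * (max 0 y)\<^sup>2)\<^sup>2)"
  have rc: "continuous_on UNIV r" unfolding r_def by (rule smooth_step_deriv_continuous)
  show "test1 a b (\<lambda>x. smooth_step n ((x - c) * (d - x))) (\<lambda>x. r ((x - c) * (d - x)) * (c + d - 2 * x))"
    unfolding test1_def
  proof (intro conjI allI impI)
    fix x
    have "((\<lambda>x. (x - c) * (d - x)) has_real_derivative (c + d - 2 * x)) (at x)"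
      by (auto intro!: derivative_eq_intros simp: algebra_simps)
    from DERIV_chain2[OF smooth_step_has_derivative this]
    show "((\<lambda>x. smooth_step n ((x - c) * (d - x))) has_real_derivative r ((x - c) * (d - x)) * (c + d - 2 * x)) (at x)"
      unfolding r_def .
    show "continuous_on UNIV (\<lambda>x. r ((x - c) * (d - x)) * (c + d - 2 * x))"
      by (intro continuous_intros continuous_on_compose2[OF rc]) auto
    assume "x \<notin> {a<..<b}"
    then have "(x - c) * (d - x) \<le> 0" using assms by (auto simp: mult_le_0_iff)
    then show "smooth_step n ((x - c) * (d - x)) = 0" by (rule smooth_step_nonpos)
  qed
qed

lemma smooth_step_indicator:
  assumes "c \<le> d"
  shows "(\<lambda>n. smooth_step n ((x - c) * (d - x))) \<longlonglongrightarrow> indicator {c<..<d} x"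
proof -
  have "of_bool ((x - c) * (d - x) > 0) = (indicator {c<..<d} x :: real)"
    using assms by (auto simp: zero_less_mult_iff indicator_def)
  then show ?thesis using smooth_step_tendsto[of "(x - c) * (d - x)"] by simp
qed

section \<open>Fundamental lemma of the calculus of variations on rectangles\<close>

text \<open>\<open>ennreal\<close> cuts off negative values, so \<open>P\<close> and
  \<open>N\<close> have the positive and the negative part of \<open>h\<close> as densities. They
  agree and are finite on open boxes, which are stable under intersection and generate the Borel
  sets; hence they coincide, and so do their densities almost everywhere.\<close>

lemma AE_zero_if_box_integrals_zero:
  fixes h :: "real \<times> real \<Rightarrow> real"
  assumes h: "integrable lborel h" and z: "\<And>a b. (LINT p|lborel. h p * indicator (box a b) p) = 0"
  shows "AE p in lborel. h p = 0"
proof -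
  define P where "P = density lborel (\<lambda>p. ennreal (h p))"
  define N where "N = density lborel (\<lambda>p. ennreal (- h p))"
  have [measurable]: "h \<in> borel_measurable borel" using h by auto
  define E where "E = range (\<lambda>(a, b). box a b :: (real \<times> real) set)"
  have eqE: "emeasure P X = emeasure N X \<and> emeasure P X \<noteq> \<infinity>" if X: "X \<in> E" for X
  proof -
    obtain a b where ab: "X = box a b" using X unfolding E_def by auto
    have i: "integrable lborel (\<lambda>p. h p * indicator X p)"
      using integrable_mult_indicator[OF _ h, of X] unfolding ab by (simp add: mult.commute)
    have ind: "(\<integral>\<^sup>+p. ennreal (g p) * indicator X p \<partial>lborel) = (\<integral>\<^sup>+p. ennreal (g p * indicator X p) \<partial>lborel)" for g :: "_ \<Rightarrow> real"
      by (intro nn_integral_cong) (auto simp: indicator_def)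
    have P: "emeasure P X = (\<integral>\<^sup>+p. ennreal (h p * indicator X p) \<partial>lborel)"
      using ind[of h] unfolding P_def ab by (subst emeasure_density) auto
    have N: "emeasure N X = (\<integral>\<^sup>+p. ennreal (- (h p * indicator X p)) \<partial>lborel)"
      using ind[of "\<lambda>p. - h p"] unfolding N_def ab by (subst emeasure_density) auto
    have fin: "emeasure P X \<noteq> \<infinity>" "emeasure N X \<noteq> \<infinity>"
      using i unfolding real_integrable_def P N by auto
    have "enn2real (emeasure P X) - enn2real (emeasure N X) = 0"
      using z[of a b] unfolding real_lebesgue_integral_def[OF i[unfolded ab]] P[unfolded ab] N[unfolded ab] ab by simp
    then show ?thesis using fin by (metis ennreal_enn2real eq_iff_diff_eq_0 top.not_eq_extremum infinity_ennreal_def)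
  qed
  have "P = N"
  proof (rule measure_eqI_generator_eq[where E=E and \<Omega>=UNIV and A="\<lambda>n. box (- real n *\<^sub>R One) (real n *\<^sub>R One)"])
    show "Int_stable E"
      unfolding E_def Int_stable_def by (auto simp: box_Int_box)
    show "sets P = sigma_sets UNIV E" "sets N = sigma_sets UNIV E"
      unfolding P_def N_def E_def by (simp_all add: borel_eq_box)
    show "(\<Union>i. box (- real i *\<^sub>R One) (real i *\<^sub>R One)) = (UNIV :: (real \<times> real) set)"
      using UN_box_eq_UNIV by simp
  qed (use eqE E_def in auto)
  then have "AE p in lborel. ennreal (h p) = ennreal (- h p)"
    unfolding P_def N_def by (intro sigma_finite_measure.density_unique[OF sigma_finite_lborel]) auto
  then show ?thesis
  proof eventually_elim
    case (elim p)
    then show ?case by (cases "h p \<ge> 0"; cases "h p = 0") (auto simp: ennreal_neg)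
  qed
qed

text \<open>Products of one-dimensional bumps converge to indicators of subrectangles, and dominated
  convergence shows that \<open>h\<close> integrates to zero over each of them. A box meets the
  given rectangle in a subrectangle or not at all, so the extension of \<open>h\<close> by zero has
  vanishing integral over every box.\<close>

lemma fundamental_lemma:
  fixes h :: "real \<times> real \<Rightarrow> real"
  assumes h: "integrable lborel h" and i: "i1 \<le> i2" "j1 \<le> j2"
    and z: "\<And>\<eta> \<eta>' \<theta> \<theta>'. test1 i1 i2 \<eta> \<eta>' \<Longrightarrow> test1 j1 j2 \<theta> \<theta>' \<Longrightarrow>
       (LINT p|lborel. h p * (\<eta> (fst p) * \<theta> (snd p))) = 0"
  shows "AE p in lborel. p \<in> {i1<..<i2} \<times> {j1<..<j2} \<longrightarrow> h p = 0"
proof -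
  define h0 where "h0 = (\<lambda>p. h p * indicator ({i1<..<i2} \<times> {j1<..<j2}) p)"
  have [measurable]: "h \<in> borel_measurable borel" using h by auto
  have rect: "(LINT p|lborel. h p * indicator ({a<..<b} \<times> {c<..<d}) p) = 0"
    if ab: "i1 \<le> a" "a \<le> b" "b \<le> i2" "j1 \<le> c" "c \<le> d" "d \<le> j2" for a b c d
  proof -
    define f where "f = (\<lambda>n p. h p * (smooth_step n ((fst p - a) * (b - fst p)) * smooth_step n ((snd p - c) * (d - snd p))))"
    have "(\<lambda>n. LINT p|lborel. f n p) \<longlonglongrightarrow> (LINT p|lborel. h p * indicator ({a<..<b} \<times> {c<..<d}) p)"
    proof (rule integral_dominated_convergence[where w="\<lambda>p. \<bar>h p\<bar>"])
      show "(\<lambda>p. h p * indicator ({a<..<b} \<times> {c<..<d}) p) \<in> borel_measurable lborel"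
        by (auto intro!: borel_measurable_times borel_measurable_indicator borel_open open_Times)
      show "f n \<in> borel_measurable lborel" for n
      proof -
        have "(\<lambda>p::real\<times>real. smooth_step n ((fst p - a) * (b - fst p)) * smooth_step n ((snd p - c) * (d - snd p))) \<in> borel_measurable borel"
          by (intro borel_measurable_continuous_onI continuous_intros
              continuous_on_compose2[OF smooth_step_continuous]) auto
        then show ?thesis unfolding f_def by simp
      qed
      show "integrable lborel (\<lambda>p. \<bar>h p\<bar>)" using h by auto
      show "AE p in lborel. (\<lambda>n. f n p) \<longlonglongrightarrow> h p * indicator ({a<..<b} \<times> {c<..<d}) p"
      proof (rule AE_I2)
        fix p :: "real \<times> real"
        have "(\<lambda>n. f n p) \<longlonglongrightarrow> h p * (indicator {a<..<b} (fst p) * indicator {c<..<d} (snd p))"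
          unfolding f_def by (intro tendsto_intros smooth_step_indicator that)
        then show "(\<lambda>n. f n p) \<longlonglongrightarrow> h p * indicator ({a<..<b} \<times> {c<..<d}) p"
          by (cases p) (simp add: indicator_times)
      qed
      show "AE p in lborel. norm (f n p) \<le> \<bar>h p\<bar>" for n
      proof (rule AE_I2)
        fix p :: "real \<times> real"
        have "\<bar>smooth_step n ((fst p - a) * (b - fst p)) * smooth_step n ((snd p - c) * (d - snd p))\<bar> \<le> 1"
          using smooth_step_bounds by (simp add: abs_mult mult_le_one)
        then show "norm (f n p) \<le> \<bar>h p\<bar>" unfolding f_def by (simp add: abs_mult mult_left_le)
      qed
    qed
    moreover have "(LINT p|lborel. f n p) = 0" for n
    proof -
      obtain s1 where s1: "test1 i1 i2 (\<lambda>x. smooth_step n ((x - a) * (b - x))) s1"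
        by (rule test1_step[OF ab(1,2,3)])
      obtain s2 where s2: "test1 j1 j2 (\<lambda>x. smooth_step n ((x - c) * (d - x))) s2"
        by (rule test1_step[OF ab(4,5,6)])
      show ?thesis using z[OF s1 s2] unfolding f_def .
    qed
    ultimately show ?thesis by (simp add: LIMSEQ_const_iff)
  qed
  have "AE p in lborel. h0 p = 0"
  proof (rule AE_zero_if_box_integrals_zero)
    have "{i1<..<i2} \<times> {j1<..<j2} \<in> sets lborel" by (simp add: borel_open open_Times)
    from integrable_mult_indicator[OF this h]
    show "integrable lborel h0" unfolding h0_def by (simp add: mult.commute)
    fix a b :: "real \<times> real"
    obtain a1 a2 b1 b2 where ab: "a = (a1, a2)" "b = (b1, b2)" by fastforce
    have bx: "box a b = {a1<..<b1} \<times> {a2<..<b2}" unfolding ab by (auto simp: mem_box Basis_prod_def box_def)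
    have "h0 p * indicator (box a b) p = h p * indicator ({max i1 a1<..<min i2 b1} \<times> {max j1 a2<..<min j2 b2}) p" for p
      unfolding h0_def bx by (auto simp: indicator_def)
    then have eq: "(LINT p|lborel. h0 p * indicator (box a b) p) = 
        (LINT p|lborel. h p * indicator ({max i1 a1<..<min i2 b1} \<times> {max j1 a2<..<min j2 b2}) p)" by simp
    show "(LINT p|lborel. h0 p * indicator (box a b) p) = 0"
    proof (cases "max i1 a1 \<le> min i2 b1 \<and> max j1 a2 \<le> min j2 b2")
      case True then show ?thesis unfolding eq by (intro rect) auto
    next
      case False
      then have e: "{max i1 a1<..<min i2 b1} = {} \<or> {max j1 a2<..<min j2 b2} = {}" by (metis greaterThanLessThan_empty linear)
      then have "{max i1 a1<..<min i2 b1} \<times> {max j1 a2<..<min j2 b2} = {}" by blast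
      then have "indicator ({max i1 a1<..<min i2 b1} \<times> {max j1 a2<..<min j2 b2}) p = (0::real)" for p
        by (simp only: indicator_def empty_iff if_False of_bool_eq)
      then show ?thesis unfolding eq by (simp only: mult_zero_right Bochner_Integration.integral_zero)
    qed
  qed
  then show ?thesis unfolding h0_def by eventually_elim auto
qed


section \<open>Primitives in the first variable\<close>

lemma continuous_antiderivative:
  fixes k :: "real \<Rightarrow> real" assumes "continuous_on UNIV k"
  obtains F where "\<And>x. (F has_real_derivative k x) (at x)"
proof -
  have "isCont k x" for x using assms continuous_on_eq_continuous_at by blast
  then obtain F where "\<forall>x :: real. -\<infinity> < ereal x \<longrightarrow> ereal x < \<infinity> \<longrightarrow> (F has_vector_derivative k x) (at x)"
    using einterval_antiderivative[of "-\<infinity>" "\<infinity>" k] by auto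
  then have "(F has_real_derivative k x) (at x)" for x
    by (simp add: has_real_derivative_iff_has_vector_derivative)
  then show ?thesis by (rule that)
qed

lemma integrable_bounded_rect:
  fixes f :: "'a::euclidean_space \<Rightarrow> real"
  assumes "f \<in> borel_measurable borel" "\<And>p. \<bar>f p\<bar> \<le> B" "\<And>p. p \<notin> cbox a b \<Longrightarrow> f p = 0"
  shows "integrable lborel f"
  by (rule integrableI_bounded_set[where A="cbox a b" and B=B]) (use assms in \<open>auto simp: emeasure_lborel_cbox_eq\<close>)

lemma has_integral_lborel_interval:
  fixes f :: "real \<Rightarrow> real"
  assumes "f \<in> borel_measurable borel" "\<And>x. x \<in> {a..b} \<Longrightarrow> \<bar>f x\<bar> \<le> B"
  shows "(f has_integral (LINT x|lborel. indicator {a..b} x * f x)) {a..b}"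
proof -
  have "integrable lborel (\<lambda>x. indicator {a..b} x * f x)"
  proof (rule integrable_bounded_rect[where a=a and b=b and B="max B 0"])
    show "\<bar>indicator {a..b} x * f x\<bar> \<le> max B 0" for x
      using assms(2)[of x] by (auto simp: indicator_def)
  qed (use assms in auto)
  from has_integral_integral_lborel[OF this]
  have "((\<lambda>x. if x \<in> {a..b} then f x else 0) has_integral (LINT x|lborel. indicator {a..b} x * f x)) UNIV"
    by (rule has_integral_eq[rotated]) (auto simp: indicator_def)
  then show ?thesis unfolding has_integral_restrict_UNIV .
qed

text \<open>The indefinite integral in the first variable, written as an integral over the whole
  line with an indicator; joint measurability then follows from that of parameter integrals.\<close>

definition prim_fst :: "real \<Rightarrow> (real \<times> real \<Rightarrow> real) \<Rightarrow> real \<times> real \<Rightarrow> real" where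
  "prim_fst i1 g p = (LINT s|lborel. indicator {i1..fst p} s * g (s, snd p))"

lemma measurable_pair_lborel:
  "f \<in> borel_measurable (borel \<Otimes>\<^sub>M borel) \<Longrightarrow> f \<in> borel_measurable (borel \<Otimes>\<^sub>M lborel)"
  using measurable_cong_sets[OF sets_pair_measure_cong[OF refl sets_lborel] refl] by blast

lemma prim_fst_measurable:
  assumes [measurable]: "g \<in> borel_measurable borel"
  shows "prim_fst i1 g \<in> borel_measurable borel"
proof -
  have "(\<lambda>q. of_bool (i1 \<le> snd q \<and> snd q \<le> fst (fst q)) * g (snd q, snd (fst q)))
      \<in> borel_measurable ((borel \<Otimes>\<^sub>M borel) \<Otimes>\<^sub>M borel)"
    by measurable
  then have "(\<lambda>(p::real\<times>real, s). of_bool (i1 \<le> s \<and> s \<le> fst p) * g (s, snd p))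
      \<in> borel_measurable (borel \<Otimes>\<^sub>M lborel)"
    unfolding borel_prod by (intro measurable_pair_lborel) (simp add: case_prod_beta' borel_prod)
  then have "(\<lambda>p::real\<times>real. LINT s|lborel. of_bool (i1 \<le> s \<and> s \<le> fst p) * g (s, snd p)) \<in> borel_measurable borel"
    by (rule lborel.borel_measurable_lebesgue_integral)
  moreover have "of_bool (i1 \<le> s \<and> s \<le> fst p) = (indicator {i1..fst p} s :: real)" for s and p :: "real \<times> real"
    by (auto simp: indicator_def)
  ultimately show ?thesis unfolding prim_fst_def[abs_def] by simp
qed

lemma slice_measurable:
  assumes "g \<in> borel_measurable borel" shows "(\<lambda>x::real. g (x, y::real) :: real) \<in> borel_measurable borel"
  by (rule measurable_compose[OF _ assms]) (auto intro!: borel_measurable_continuous_onI continuous_intros)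

lemma slice_measurable':
  assumes "g \<in> borel_measurable borel" shows "(\<lambda>y::real. g (x::real, y) :: real) \<in> borel_measurable borel"
  by (rule measurable_compose[OF _ assms]) (auto intro!: borel_measurable_continuous_onI continuous_intros)

text \<open>Holds on every line, not just on almost every one, because \<open>g\<close> is Borel and
  bounded at every point. This is the reason for passing to truncated Borel representatives of the
  weak derivatives.\<close>

lemma prim_fst_primitive_on:
  assumes g: "g \<in> borel_measurable borel" and b: "\<And>p. \<bar>g p\<bar> \<le> M"
  shows "primitive_on i1 i2 (\<lambda>x. prim_fst i1 g (x, y)) (\<lambda>x. g (x, y))"
  unfolding primitive_on_def
proof (intro conjI allI impI)
  have sm: "(\<lambda>x. g (x, y)) \<in> borel_measurable borel" by (rule slice_measurable[OF g])
  then show "(\<lambda>x. g (x, y)) \<in> borel_measurable (lebesgue_on {i1..i2})"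
    by (simp add: borel_measurable_if_D measurable_completion measurable_restrict_space1)
  show "\<exists>M. \<forall>x\<in>{i1..i2}. \<bar>g (x, y)\<bar> \<le> M" using b by blast
  have hi: "((\<lambda>s. g (s, y)) has_integral prim_fst i1 g (x, y)) {i1..x}" for x
    unfolding prim_fst_def using has_integral_lborel_interval[OF sm, of i1 x M] b by simp
  fix x x' assume x: "i1 \<le> x \<and> x \<le> x' \<and> x' \<le> i2"
  have "(\<lambda>s. g (s, y)) integrable_on {x..x'}"
    by (rule integrable_on_subinterval[of _ "{i1..x'}"]) (use hi[of x'] x in auto)
  then have 2: "((\<lambda>s. g (s, y)) has_integral integral {x..x'} (\<lambda>s. g (s, y))) {x..x'}" by blast
  have "((\<lambda>s. g (s, y)) has_integral prim_fst i1 g (x, y) + integral {x..x'} (\<lambda>s. g (s, y))) {i1..x'}"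
    by (rule has_integral_combine[OF _ _ hi 2]) (use x in auto)
  then have "prim_fst i1 g (x', y) = prim_fst i1 g (x, y) + integral {x..x'} (\<lambda>s. g (s, y))"
    using hi has_integral_unique by blast
  then show "((\<lambda>s. g (s, y)) has_integral prim_fst i1 g (x', y) - prim_fst i1 g (x, y)) {x..x'}"
    using 2 by simp
qed

lemma prim_fst_bounded:
  assumes g: "g \<in> borel_measurable borel" and b: "\<And>p. \<bar>g p\<bar> \<le> M" and "i1 \<le> x" "x \<le> i2"
  shows "\<bar>prim_fst i1 g (x, y)\<bar> \<le> M * (i2 - i1)"
proof -
  have "M \<ge> 0" using b[of undefined] by linarith
  have "((\<lambda>s. g (s, y)) has_integral prim_fst i1 g (x, y)) {i1..x}"
    unfolding prim_fst_def using has_integral_lborel_interval[OF slice_measurable[OF g, of y], of i1 x M] b by simp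
  then have "norm (prim_fst i1 g (x, y)) \<le> M * measure lborel (cbox i1 x)"
    by (intro has_integral_bound[of M]) (use \<open>M \<ge> 0\<close> b in auto)
  also have "\<dots> \<le> M * (i2 - i1)" using assms \<open>M \<ge> 0\<close> by (auto intro!: mult_left_mono)
  finally show ?thesis by simp
qed

text \<open>A two-dimensional version of du Bois-Reymond's lemma: \<open>u - prim_fst i1 g\<close> has weak derivative zero
  in the first variable, and a test function \<open>\<eta>\<close> is a derivative of a test function once a multiple of
  the fixed bump \<open>s0\<close> is subtracted from it.\<close>

lemma weak_derivative_slices:
  fixes u g :: "real \<times> real \<Rightarrow> real"
  assumes um: "u \<in> borel_measurable borel" and gm: "g \<in> borel_measurable borel"
    and ub: "\<And>p. \<bar>u p\<bar> \<le> M" and gb: "\<And>p. \<bar>g p\<bar> \<le> M" and i: "i1 < i2" and j: "j1 < j2"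
    and weak: "\<And>\<eta> \<eta>' \<theta> \<theta>'. test1 i1 i2 \<eta> \<eta>' \<Longrightarrow> test1 j1 j2 \<theta> \<theta>' \<Longrightarrow>
       (LINT p|lborel. u p * (\<eta>' (fst p) * \<theta> (snd p))) = - (LINT p|lborel. g p * (\<eta> (fst p) * \<theta> (snd p)))"
  obtains c where "c \<in> borel_measurable borel"
    "AE p in lborel. p \<in> {i1<..<i2} \<times> {j1<..<j2} \<longrightarrow> u p = c (snd p) + prim_fst i1 g p"
proof -
  define R where "R = {i1..i2} \<times> {j1..j2}"
  have R: "R = cbox (i1, j1) (i2, j2)" unfolding R_def by (simp add: cbox_Pair_eq)
  have Rm: "indicator R \<in> borel_measurable (borel :: (real\<times>real) measure)" unfolding R by simp
  define h where "h = prim_fst i1 g"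
  have hm: "h \<in> borel_measurable borel" unfolding h_def by (rule prim_fst_measurable[OF gm])
  define M' where "M' = M + M * (i2 - i1)"
  define d where "d = (\<lambda>p. indicator R p * (u p - h p))"
  have dm: "d \<in> borel_measurable borel" unfolding d_def
    by (intro borel_measurable_times borel_measurable_diff Rm um hm)
  have M0: "M \<ge> 0" using ub[of undefined] by linarith
  have M'0: "M' \<ge> 0" unfolding M'_def using M0 i by simp
  have hb: "\<bar>h p\<bar> \<le> M * (i2 - i1)" if "p \<in> R" for p
    using prim_fst_bounded[OF gm gb, of i1 "fst p" i2 "snd p"] that unfolding R_def h_def by auto
  have db: "\<bar>d p\<bar> \<le> M'" for p
    unfolding d_def M'_def using hb[of p] ub[of p] M'0 M'_def
    by (cases "p \<in> R") auto
  have mf: "(\<lambda>p::real\<times>real. \<eta> (fst p)) \<in> borel_measurable borel" "(\<lambda>p::real\<times>real. \<eta> (snd p)) \<in> borel_measurable borel"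
    if "\<eta> \<in> borel_measurable borel" for \<eta> :: "real \<Rightarrow> real"
    by (rule measurable_compose[OF _ that]; auto intro!: borel_measurable_continuous_onI continuous_intros)+
  have int: "integrable lborel (\<lambda>p. f p * (\<eta> (fst p) * \<theta> (snd p)))"
    if f: "f \<in> borel_measurable borel" "\<And>p. p \<in> R \<Longrightarrow> \<bar>f p\<bar> \<le> B"
      and e: "\<eta> \<in> borel_measurable borel" "\<And>x. \<bar>\<eta> x\<bar> \<le> C" "\<And>x. x \<notin> {i1..i2} \<Longrightarrow> \<eta> x = 0"
      and t: "\<theta> \<in> borel_measurable borel" "\<And>x. \<bar>\<theta> x\<bar> \<le> D" "\<And>x. x \<notin> {j1..j2} \<Longrightarrow> \<theta> x = 0"
    for f :: "real \<times> real \<Rightarrow> real" and \<eta> \<theta> B C D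
  proof (rule integrable_bounded_rect[where a="(i1, j1)" and b="(i2, j2)" and B="\<bar>B\<bar> * (C * D)"])
    show "(\<lambda>p. f p * (\<eta> (fst p) * \<theta> (snd p))) \<in> borel_measurable borel"
      by (intro borel_measurable_times f mf e t)
    show z: "f p * (\<eta> (fst p) * \<theta> (snd p)) = 0" if "p \<notin> cbox (i1, j1) (i2, j2)" for p
      using that e(3)[of "fst p"] t(3)[of "snd p"] unfolding R[symmetric] R_def by (cases p) auto
    have CD: "C \<ge> 0" "D \<ge> 0" using e(2)[of 0] t(2)[of 0] by linarith+
    show "\<bar>f p * (\<eta> (fst p) * \<theta> (snd p))\<bar> \<le> \<bar>B\<bar> * (C * D)" for p
    proof (cases "p \<in> R")
      case True
      then show ?thesis unfolding abs_mult using f(2)[OF True] e(2) t(2) CD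
        by (intro mult_mono) auto
    next
      case False
      then have "f p * (\<eta> (fst p) * \<theta> (snd p)) = 0" using z[of p] unfolding R by blast
      then show ?thesis using CD by (simp only: abs_zero) simp
    qed
  qed
  \<comment> \<open>On each line, \<open>h * \<eta>\<close> is a primitive vanishing at both ends,
    so by Fubini \<open>h\<close> has weak derivative \<open>g\<close>. Subtracting this from the
    hypothesis on \<open>u\<close> leaves a function with weak derivative zero.\<close>
  have d0: "(LINT p|lborel. d p * (\<eta>' (fst p) * \<theta> (snd p))) = 0"
    if e: "test1 i1 i2 \<eta> \<eta>'" and t: "test1 j1 j2 \<theta> \<theta>'" for \<eta> \<eta>' \<theta> \<theta>'
  proof -
    obtain C where C: "\<And>x. \<bar>\<eta> x\<bar> \<le> C" "\<And>x. \<bar>\<eta>' x\<bar> \<le> C" using test1_bounded[OF e] by metis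
    obtain D where D: "\<And>x. \<bar>\<theta> x\<bar> \<le> D" using test1_bounded[OF t] by metis
    have m: "\<eta> \<in> borel_measurable borel" "\<eta>' \<in> borel_measurable borel" "\<theta> \<in> borel_measurable borel"
      using e t test1_measurable by blast+
    have z: "x \<notin> {i1..i2} \<Longrightarrow> \<eta> x = 0" "x \<notin> {i1..i2} \<Longrightarrow> \<eta>' x = 0" "x \<notin> {j1..j2} \<Longrightarrow> \<theta> x = 0" for x
      using e t test1_deriv_zero[OF e, of x] unfolding test1_def by auto
    have iu: "integrable lborel (\<lambda>p. u p * (\<eta>' (fst p) * \<theta> (snd p)))"
      by (rule int[OF um ub m(2) C(2) z(2) m(3) D z(3)])
    have ih: "integrable lborel (\<lambda>p. h p * (\<eta>' (fst p) * \<theta> (snd p)))"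
      by (rule int[OF hm hb m(2) C(2) z(2) m(3) D z(3)])
    have ig: "integrable lborel (\<lambda>p. g p * (\<eta> (fst p) * \<theta> (snd p)))"
      by (rule int[OF gm gb m(1) C(1) z(1) m(3) D z(3)])
    have "(LINT p|lborel. h p * (\<eta>' (fst p) * \<theta> (snd p)) + g p * (\<eta> (fst p) * \<theta> (snd p))) =
       (LINT y|lborel. LINT x|lborel. h (x, y) * (\<eta>' x * \<theta> y) + g (x, y) * (\<eta> x * \<theta> y))"
      using lborel_pair.integral_snd[of "\<lambda>x y. h (x, y) * (\<eta>' x * \<theta> y) + g (x, y) * (\<eta> x * \<theta> y)"]
        Bochner_Integration.integrable_add[OF ih ig] unfolding lborel_prod by (simp add: case_prod_beta')
    also have "\<dots> = (LINT y|(lborel :: real measure). 0)"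
    proof (rule Bochner_Integration.integral_cong, rule refl)
      fix y
      have pe: "primitive_on i1 i2 \<eta> \<eta>'"
        by (rule primitive_on_C1) (use e in \<open>auto simp: test1_def\<close>)
      have "primitive_on i1 i2 (\<lambda>x. h (x, y) * \<eta> x) (\<lambda>x. g (x, y) * \<eta> x + h (x, y) * \<eta>' x)"
        unfolding h_def by (rule primitive_on_mult[OF prim_fst_primitive_on[OF gm gb] pe])
      from primitive_onD[OF this, of i1 i2] 
      have "((\<lambda>x. g (x, y) * \<eta> x + h (x, y) * \<eta>' x) has_integral 0) {i1..i2}"
        using i e by (simp add: test1_def)
      then have "((\<lambda>x. g (x, y) * \<eta> x + h (x, y) * \<eta>' x) has_integral 0) UNIV"
        by (rule has_integral_on_superset) (use z in auto)
      moreover have il: "integrable lborel (\<lambda>x. g (x, y) * \<eta> x + h (x, y) * \<eta>' x)" if y: "y \<in> {j1..j2}"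
      proof (rule integrable_bounded_rect[where a=i1 and b=i2 and B="M * C + M * (i2 - i1) * C"])
        show "(\<lambda>x. g (x, y) * \<eta> x + h (x, y) * \<eta>' x) \<in> borel_measurable borel"
          by (intro borel_measurable_add borel_measurable_times slice_measurable gm hm m)
        show "g (x, y) * \<eta> x + h (x, y) * \<eta>' x = 0" if "x \<notin> cbox i1 i2" for x
          using z that by auto
        have "C \<ge> 0" using C(1)[of 0] by linarith
        show "\<bar>g (x, y) * \<eta> x + h (x, y) * \<eta>' x\<bar> \<le> M * C + M * (i2 - i1) * C" for x
        proof (cases "x \<in> {i1..i2}")
          case True
          have "\<bar>g (x, y) * \<eta> x\<bar> \<le> M * C" unfolding abs_mult using gb C M0 by (intro mult_mono) auto
          moreover have "\<bar>h (x, y) * \<eta>' x\<bar> \<le> M * (i2 - i1) * C"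
            unfolding abs_mult using hb[of "(x, y)"] True y C M0 i by (intro mult_mono) (auto simp: R_def)
          ultimately show ?thesis by linarith
        next
          case False
          then show ?thesis using z[of x] \<open>C \<ge> 0\<close> M0 i by simp
        qed
      qed
      ultimately have "(LINT x|lborel. g (x, y) * \<eta> x + h (x, y) * \<eta>' x) = 0" if "y \<in> {j1..j2}"
        using has_integral_integral_lborel[OF il[OF that]] has_integral_unique by blast
      moreover have "(LINT x|lborel. h (x, y) * (\<eta>' x * \<theta> y) + g (x, y) * (\<eta> x * \<theta> y)) =
         \<theta> y * (LINT x|lborel. g (x, y) * \<eta> x + h (x, y) * \<eta>' x)"
        by (subst integral_mult_right_zero[symmetric]) (simp add: algebra_simps)
      ultimately show "(LINT x|lborel. h (x, y) * (\<eta>' x * \<theta> y) + g (x, y) * (\<eta> x * \<theta> y)) = 0"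
        using z(3)[of y] by (cases "y \<in> {j1..j2}") auto
    qed
    finally have hg: "(LINT p|lborel. h p * (\<eta>' (fst p) * \<theta> (snd p))) = - (LINT p|lborel. g p * (\<eta> (fst p) * \<theta> (snd p)))"
      using ih ig by simp
    have "d p * (\<eta>' (fst p) * \<theta> (snd p)) = u p * (\<eta>' (fst p) * \<theta> (snd p)) - h p * (\<eta>' (fst p) * \<theta> (snd p))" for p
      unfolding d_def R_def using z by (cases p) (auto simp: indicator_def algebra_simps)
    then show ?thesis using weak[OF e t] hg iu ih by simp
  qed
  \<comment> \<open>The positive part of a parabola, normalised to mass 1. Continuity of
    \<open>s0\<close> is enough, since its antiderivative is what must be C1.\<close>
  obtain s0 :: "real \<Rightarrow> real" where s0: "continuous_on UNIV s0" "\<And>x. x \<notin> {i1<..<i2} \<Longrightarrow> s0 x = 0" "integral {i1..i2} s0 = 1"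
  proof -
    define f where "f = (\<lambda>x. max 0 ((x - i1) * (i2 - x)))"
    have fc: "continuous_on S f" for S unfolding f_def by (intro continuous_intros)
    have "integral {i1..i2} f \<noteq> 0"
    proof
      assume z: "integral {i1..i2} f = 0"
      have "(f has_integral 0) (cbox i1 i2)"
        using integrable_integral[OF integrable_continuous_real[OF fc, of i1 i2]] z by simp
      moreover have "box i1 i2 \<noteq> {}" "(i1 + i2) / 2 \<in> cbox i1 i2" "\<And>x. 0 \<le> f x" using i by (auto simp: f_def)
      ultimately have "f ((i1 + i2) / 2) = 0" using has_integral_0_cbox_imp_0[OF fc] by blast
      moreover have "((i1 + i2) / 2 - i1) * (i2 - (i1 + i2) / 2) > 0" using i by (intro mult_pos_pos) auto
      ultimately show False by (simp add: f_def)
    qed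
    moreover have "f x = 0" if "x \<notin> {i1<..<i2}" for x
      using that i unfolding f_def by (auto simp: max_def zero_le_mult_iff)
    ultimately show thesis
      by (intro that[of "\<lambda>x. 1 / integral {i1..i2} f * f x"] continuous_intros fc) auto
  qed
  have sm: "s0 \<in> borel_measurable borel" by (rule borel_measurable_continuous_onI[OF s0(1)])
  obtain S where S: "\<And>x. x \<in> {i1..i2} \<Longrightarrow> \<bar>s0 x\<bar> \<le> S" "S \<ge> 0"
    using continuous_bounded_on_interval[OF s0(1)] by blast
  have Sb: "\<bar>s0 x\<bar> \<le> S" for x using S s0(2)[of x] by (cases "x \<in> {i1..i2}") auto
  have s0z: "x \<notin> {i1..i2} \<Longrightarrow> s0 x = 0" for x using s0(2) by auto
  \<comment> \<open>The average of \<open>d\<close> along a line with weight \<open>s0\<close>. A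
    function constant along the line is reproduced by it because \<open>s0\<close> has mass
    1.\<close>
  define c where "c = (\<lambda>y. LINT x|lborel. d (x, y) * s0 x)"
  have cm: "c \<in> borel_measurable borel"
  proof -
    have "(\<lambda>q. d (snd q, fst q) * s0 (snd q)) \<in> borel_measurable (borel \<Otimes>\<^sub>M borel)"
      unfolding borel_prod
      by (intro borel_measurable_times measurable_compose[OF _ dm] mf sm)
        (intro borel_measurable_continuous_onI continuous_intros)
    then have "(\<lambda>(y, x). d (x, y) * s0 x) \<in> borel_measurable (borel \<Otimes>\<^sub>M lborel)"
      by (intro measurable_pair_lborel) (simp add: case_prod_beta')
    then show ?thesis unfolding c_def by (rule lborel.borel_measurable_lebesgue_integral)
  qed
  have cb: "\<bar>c y\<bar> \<le> M' * S * (i2 - i1)" for y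
  proof -
    have bb: "\<bar>d (x, y) * s0 x\<bar> \<le> M' * S" for x
      unfolding abs_mult using db Sb M'0 by (intro mult_mono) auto
    have m: "(\<lambda>x. d (x, y) * s0 x) \<in> borel_measurable borel"
      by (intro borel_measurable_times slice_measurable dm sm)
    have eq: "(LINT x|lborel. indicator {i1..i2} x * (d (x, y) * s0 x)) = c y"
      unfolding c_def by (rule Bochner_Integration.integral_cong[OF refl]) (use s0z in \<open>auto simp: indicator_def\<close>)
    have "((\<lambda>x. d (x, y) * s0 x) has_integral c y) {i1..i2}"
      using has_integral_lborel_interval[OF m bb, of i1 i2] unfolding eq .
    then have "norm (c y) \<le> M' * S * measure lborel (cbox i1 i2)"
      by (intro has_integral_bound[of "M' * S"]) (use M'0 S bb in auto)
    then show ?thesis using i by simp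
  qed
  define H where "H = (\<lambda>p. indicator R p * (d p - c (snd p)))"
  have Hm: "H \<in> borel_measurable borel" unfolding H_def
    by (intro borel_measurable_times borel_measurable_diff Rm dm mf cm)
  have Hb: "\<bar>H p\<bar> \<le> M' + M' * S * (i2 - i1)" for p
  proof -
    have "\<bar>d p - c (snd p)\<bar> \<le> M' + M' * S * (i2 - i1)" using db[of p] cb[of "snd p"] by linarith
    then show ?thesis unfolding H_def by (auto simp: indicator_def)
  qed
  have Hi: "integrable lborel H"
    by (rule integrable_bounded_rect[OF Hm Hb, of "(i1, j1)" "(i2, j2)"]) (simp add: H_def R)
  have "AE p in lborel. p \<in> {i1<..<i2} \<times> {j1<..<j2} \<longrightarrow> H p = 0"
  proof (rule fundamental_lemma[OF Hi])
    fix \<eta> \<eta>' \<theta> \<theta>' assume e: "test1 i1 i2 \<eta> \<eta>'" and t: "test1 j1 j2 \<theta> \<theta>'"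
    obtain C where C: "\<And>x. \<bar>\<eta> x\<bar> \<le> C" using test1_bounded[OF e] by metis
    obtain D where D: "\<And>x. \<bar>\<theta> x\<bar> \<le> D" using test1_bounded[OF t] by metis
    have em: "\<eta> \<in> borel_measurable borel" and tm: "\<theta> \<in> borel_measurable borel"
      using e t test1_measurable by blast+
    have ez: "x \<notin> {i1..i2} \<Longrightarrow> \<eta> x = 0" and tz: "x \<notin> {j1..j2} \<Longrightarrow> \<theta> x = 0" for x
      using e t unfolding test1_def by auto
    define m where "m = integral {i1..i2} \<eta>"
    \<comment> \<open>Subtracting \<open>m * s0\<close> removes the mean of \<open>\<eta>\<close>.
      The antiderivative of \<open>k\<close> then takes equal values at both ends and, shifted by
      \<open>F i1\<close>, is an admissible one-dimensional test function with derivative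
      \<open>k\<close>.\<close>
    define k where "k = (\<lambda>x. \<eta> x - m * s0 x)"
    have kc: "continuous_on UNIV k" unfolding k_def
      by (intro continuous_intros s0 test1_continuous[OF e])
    obtain F where F: "\<And>x. (F has_real_derivative k x) (at x)" using continuous_antiderivative[OF kc] by metis
    have ftc: "(k has_integral F y - F x) {x..y}" if "x \<le> y" for x y
      using fundamental_theorem_of_calculus[OF that, of F k] F
      by (simp add: has_real_derivative_iff_has_vector_derivative has_vector_derivative_at_within)
    have kz: "k x = 0" if "x \<notin> {i1<..<i2}" for x using that s0(2) e unfolding k_def test1_def by simp
    have zero: "F x = F y" if "x \<le> y" "y \<le> i1 \<or> i2 \<le> x" for x y
    proof -
      have "(k has_integral 0) {x..y}" by (rule has_integral_is_0) (use kz that in auto)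
      from has_integral_unique[OF this ftc[OF that(1)]] show ?thesis by simp
    qed
    have Fi: "F i1 = F i2"
    proof -
      have "(s0 has_integral 1) {i1..i2}"
        using integrable_integral[OF integrable_continuous_real[OF continuous_on_subset[OF s0(1)], of i1 i2]] s0(3) by simp
      moreover have "(\<eta> has_integral m) {i1..i2}"
        unfolding m_def using integrable_integral[OF integrable_continuous_real[OF continuous_on_subset[OF test1_continuous[OF e]], of i1 i2]] by simp
      ultimately have "(k has_integral m - m * 1) {i1..i2}"
        unfolding k_def by (intro has_integral_diff has_integral_mult_right)
      from has_integral_unique[OF this ftc] show ?thesis using i by simp
    qed
    have Ft: "test1 i1 i2 (\<lambda>x. F x - F i1) k"
      unfolding test1_def
    proof (intro conjI allI impI)
      show "((\<lambda>x. F x - F i1) has_real_derivative k x) (at x)" for x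
        using DERIV_diff[OF F DERIV_const] by simp
      show "F x - F i1 = 0" if "x \<notin> {i1<..<i2}" for x
        using zero[of x i1] zero[of i2 x] Fi that by (cases "x \<le> i1") auto
    qed (rule kc)
    have I1: "integrable lborel (\<lambda>p. d p * (\<eta> (fst p) * \<theta> (snd p)))"
      by (rule int[OF dm db em C ez tm D tz])
    have I2: "integrable lborel (\<lambda>p. d p * (s0 (fst p) * \<theta> (snd p)))"
      by (rule int[OF dm db sm Sb s0z tm D tz])
    have I3: "integrable lborel (\<lambda>p. c (snd p) * (\<eta> (fst p) * \<theta> (snd p)))"
      by (rule int[OF mf(2)[OF cm] cb em C ez tm D tz])
    have "(LINT p|lborel. d p * (\<eta> (fst p) * \<theta> (snd p)) - m * (d p * (s0 (fst p) * \<theta> (snd p)))) = 0"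
      using d0[OF Ft t] by (simp add: k_def algebra_simps)
    then have A1: "(LINT p|lborel. d p * (\<eta> (fst p) * \<theta> (snd p))) = m * (LINT p|lborel. d p * (s0 (fst p) * \<theta> (snd p)))"
      using I1 I2 by simp
    have A2: "(LINT p|lborel. d p * (s0 (fst p) * \<theta> (snd p))) = (LINT y|lborel. c y * \<theta> y)"
    proof -
      have "(LINT p|lborel. d p * (s0 (fst p) * \<theta> (snd p))) = (LINT y|lborel. LINT x|lborel. d (x, y) * (s0 x * \<theta> y))"
        using lborel_pair.integral_snd[of "\<lambda>x y. d (x, y) * (s0 x * \<theta> y)"] I2
        unfolding lborel_prod by (simp add: case_prod_beta')
      also have "\<dots> = (LINT y|lborel. c y * \<theta> y)"
        unfolding c_def by (simp add: integral_mult_left_zero[symmetric] mult.assoc del: integral_mult_left_zero)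
      finally show ?thesis .
    qed
    have mm: "(LINT x|lborel. \<eta> x) = m"
    proof -
      have il: "integrable lborel \<eta>" by (rule integrable_bounded_rect[OF em C, of i1 i2]) (use ez in auto)
      have "(\<eta> has_integral m) {i1..i2}"
        unfolding m_def using integrable_integral[OF integrable_continuous_real[OF continuous_on_subset[OF test1_continuous[OF e]], of i1 i2]] by simp
      then have "(\<eta> has_integral m) UNIV"
        by (rule has_integral_on_superset) (use ez in auto)
      then show ?thesis using has_integral_integral_lborel[OF il] has_integral_unique by blast
    qed
    have A3: "(LINT p|lborel. c (snd p) * (\<eta> (fst p) * \<theta> (snd p))) = m * (LINT y|lborel. c y * \<theta> y)"
    proof -
      have "(LINT p|lborel. c (snd p) * (\<eta> (fst p) * \<theta> (snd p))) = (LINT y|lborel. LINT x|lborel. c y * (\<eta> x * \<theta> y))"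
        using lborel_pair.integral_snd[of "\<lambda>x y. c y * (\<eta> x * \<theta> y)"] I3
        unfolding lborel_prod by (simp add: case_prod_beta')
      also have "\<dots> = (LINT y|lborel. m * (c y * \<theta> y))" by (simp add: mm mult_ac)
      finally show ?thesis by simp
    qed
    have "H p * (\<eta> (fst p) * \<theta> (snd p)) = d p * (\<eta> (fst p) * \<theta> (snd p)) - c (snd p) * (\<eta> (fst p) * \<theta> (snd p))" for p
      unfolding H_def R_def using ez tz by (cases p) (auto simp: indicator_def algebra_simps)
    then show "(LINT p|lborel. H p * (\<eta> (fst p) * \<theta> (snd p))) = 0"
      using A1 A2 A3 I1 I3 by simp
  qed (use i j in auto)
  then have "AE p in lborel. p \<in> {i1<..<i2} \<times> {j1<..<j2} \<longrightarrow> u p = c (snd p) + prim_fst i1 g p"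
  proof eventually_elim
    case (elim p)
    show ?case
    proof
      assume p: "p \<in> {i1<..<i2} \<times> {j1<..<j2}"
      then have "p \<in> R" unfolding R_def by auto
      then show "u p = c (snd p) + prim_fst i1 g p" using elim p unfolding H_def d_def h_def by simp
    qed
  qed
  then show thesis using that[OF cm] by blast
qed

section \<open>Weak derivatives on open sets\<close>

lemma AE_lebesgue_negligible:
  assumes "AE p in lebesgue. P p"
  obtains N where "negligible N" "\<And>p. p \<notin> N \<Longrightarrow> P p"
proof -
  obtain N where "N \<in> null_sets lebesgue" "{p. \<not> P p} \<subseteq> N"
    using assms by (auto simp: eventually_ae_filter)
  then show ?thesis using that[of N] by (auto simp: negligible_iff_null_sets)
qed

lemma set_integrable_cong_AE_lebesgue:
  fixes f g :: "real \<times> real \<Rightarrow> real"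
  assumes f: "set_integrable lebesgue S f" and ae: "AE p in lebesgue. p \<in> S \<longrightarrow> f p = g p"
  shows "set_integrable lebesgue S g"
proof -
  obtain N where N: "negligible N" "\<And>p. p \<notin> N \<Longrightarrow> p \<in> S \<longrightarrow> f p = g p"
    using AE_lebesgue_negligible[OF ae] by blast
  show ?thesis by (rule absolutely_integrable_spike[OF f N(1)]) (use N(2) in auto)
qed

lemma test_function_deriv_zero:
  assumes "test_function U \<phi> \<phi>'" and K: "compact K" "\<And>p. p \<notin> K \<Longrightarrow> \<phi> p = 0" and p: "p \<notin> K"
  shows "\<phi>' p e = 0"
proof -
  have "(\<phi> has_derivative \<phi>' p) (at p)" using assms(1) unfolding test_function_def by blast
  then have "((\<lambda>_. 0) has_derivative \<phi>' p) (at p)"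
    by (rule has_derivative_transform_within_open[of _ _ _ _ "- K"])
      (use K p in \<open>auto simp: compact_imp_closed open_Compl\<close>)
  then have "\<phi>' p = (\<lambda>_. 0)" using has_derivative_unique[OF _ has_derivative_const] by blast
  then show ?thesis by simp
qed

lemma test_functionE:
  assumes "test_function U \<phi> \<phi>'"
  obtains K where "compact K" "K \<subseteq> U" "\<And>p. p \<notin> K \<Longrightarrow> \<phi> p = 0" "\<And>p e. p \<notin> K \<Longrightarrow> \<phi>' p e = 0"
proof -
  obtain K where K: "compact K" "K \<subseteq> U" "\<And>p. p \<notin> K \<Longrightarrow> \<phi> p = 0"
    using assms unfolding test_function_def by blast
  then show ?thesis using that[of K] test_function_deriv_zero[OF assms K(1,3)] by blast
qed

lemma test_function_subset: "test_function V \<phi> \<phi>' \<Longrightarrow> V \<subseteq> U \<Longrightarrow> test_function U \<phi> \<phi>'"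
  unfolding test_function_def by (meson order_trans)

lemma test_function_supported:
  assumes "test_function U \<phi> \<phi>'" "compact K" "K \<subseteq> V" "\<And>p. p \<notin> K \<Longrightarrow> \<phi> p = 0"
  shows "test_function V \<phi> \<phi>'"
  using assms unfolding test_function_def by blast

lemma set_integral_supported:
  fixes f :: "real \<times> real \<Rightarrow> real"
  assumes "K \<subseteq> U" "K \<subseteq> V" "\<And>p. p \<notin> K \<Longrightarrow> f p = 0"
  shows "(LINT p:U|lebesgue. f p) = (LINT p:V|lebesgue. f p)"
  unfolding set_lebesgue_integral_def
  by (rule Bochner_Integration.integral_cong, rule refl) (use assms in \<open>auto simp: indicator_def\<close>)

lemma has_weak_deriv_subset:
  assumes w: "has_weak_deriv e U v g" and VU: "V \<subseteq> U"
  shows "has_weak_deriv e V v g"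
  unfolding has_weak_deriv_def
proof (intro conjI allI impI)
  show "locally_integrable V v" "locally_integrable V g"
    using w VU unfolding has_weak_deriv_def locally_integrable_def by (meson order_trans)+
  fix \<phi> \<phi>' assume t: "test_function V \<phi> \<phi>'"
  obtain K where K: "compact K" "K \<subseteq> V" "\<And>p. p \<notin> K \<Longrightarrow> \<phi> p = 0" "\<And>p e. p \<notin> K \<Longrightarrow> \<phi>' p e = 0"
    using test_functionE[OF t] by metis
  have "(LINT p:U|lebesgue. v p * \<phi>' p e) = - (LINT p:U|lebesgue. g p * \<phi> p)"
    using w test_function_subset[OF t VU] unfolding has_weak_deriv_def by blast
  moreover have "(LINT p:U|lebesgue. v p * \<phi>' p e) = (LINT p:V|lebesgue. v p * \<phi>' p e)"
    "(LINT p:U|lebesgue. g p * \<phi> p) = (LINT p:V|lebesgue. g p * \<phi> p)"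
    by (rule set_integral_supported[of K]; use K VU in auto)+
  ultimately show "(LINT p:V|lebesgue. v p * \<phi>' p e) = - (LINT p:V|lebesgue. g p * \<phi> p)" by simp
qed

text \<open>Weak differentiability is tested on compact sets, and each compact subset of
  \<open>U\<close> already lies in one \<open>S n\<close>.\<close>

lemma has_weak_deriv_exhaust:
  assumes w: "\<And>n. has_weak_deriv e (S n) v g" and ex: "\<And>K. compact K \<Longrightarrow> K \<subseteq> U \<Longrightarrow> \<exists>n. K \<subseteq> S n"
  shows "has_weak_deriv e U v g"
  unfolding has_weak_deriv_def
proof (intro conjI allI impI)
  show "locally_integrable U v" "locally_integrable U g"
    using w ex unfolding has_weak_deriv_def locally_integrable_def by meson+
  fix \<phi> \<phi>' assume t: "test_function U \<phi> \<phi>'"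
  obtain K where K: "compact K" "K \<subseteq> U" "\<And>p. p \<notin> K \<Longrightarrow> \<phi> p = 0" "\<And>p e. p \<notin> K \<Longrightarrow> \<phi>' p e = 0"
    using test_functionE[OF t] by metis
  obtain n where n: "K \<subseteq> S n" using ex[OF K(1,2)] by blast
  have "test_function (S n) \<phi> \<phi>'" by (rule test_function_supported[OF t K(1) n K(3)])
  then have "(LINT p:S n|lebesgue. v p * \<phi>' p e) = - (LINT p:S n|lebesgue. g p * \<phi> p)"
    using w[of n] unfolding has_weak_deriv_def by blast
  moreover have "(LINT p:S n|lebesgue. v p * \<phi>' p e) = (LINT p:U|lebesgue. v p * \<phi>' p e)"
    "(LINT p:S n|lebesgue. g p * \<phi> p) = (LINT p:U|lebesgue. g p * \<phi> p)"
    by (rule set_integral_supported[of K]; use K n in auto)+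
  ultimately show "(LINT p:U|lebesgue. v p * \<phi>' p e) = - (LINT p:U|lebesgue. g p * \<phi> p)" by simp
qed

text \<open>Weak derivatives are Lebesgue measurable functions, whereas Fubini's theorem and
  restriction to lines are applied to Borel functions; this is the passage between the two.\<close>

lemma borel_representative:
  fixes u :: "real \<times> real \<Rightarrow> real"
  assumes u: "set_integrable lebesgue K u"
  obtains u' where "u' \<in> borel_measurable borel" "AE p in lebesgue. p \<in> K \<longrightarrow> u' p = u p"
proof -
  have "(\<lambda>p. indicator K p *\<^sub>R u p) \<in> borel_measurable lebesgue"
    using u unfolding set_integrable_def by (rule borel_measurable_integrable)
  from completion_ex_borel_measurable_real[OF this]
  obtain u' where u': "u' \<in> borel_measurable lborel" "AE p in lborel. indicator K p *\<^sub>R u p = u' p" by blast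
  have "AE p in lebesgue. indicator K p *\<^sub>R u p = u' p" by (rule AE_completion[OF u'(2)])
  then have "AE p in lebesgue. p \<in> K \<longrightarrow> u' p = u p" by eventually_elim auto
  then show ?thesis using that u' by simp
qed

lemma set_integral_borel_representative:
  fixes u u' \<psi> :: "real \<times> real \<Rightarrow> real"
  assumes u: "set_integrable lebesgue K u" and K: "compact K" "K \<subseteq> U"
    and u': "u' \<in> borel_measurable borel" "AE p in lebesgue. p \<in> K \<longrightarrow> u' p = u p"
    and \<psi>: "\<psi> \<in> borel_measurable borel" "\<And>p. p \<notin> K \<Longrightarrow> \<psi> p = 0"
  shows "(LINT p:U|lebesgue. u p * \<psi> p) = (LINT p|lborel. u' p * \<psi> p)"
proof -
  have "(LINT p:U|lebesgue. u p * \<psi> p) = (LINT p|lebesgue. u' p * \<psi> p)"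
    unfolding set_lebesgue_integral_def
  proof (rule integral_cong_AE)
    have "(\<lambda>p. indicator K p *\<^sub>R u p) \<in> borel_measurable lebesgue"
      using u unfolding set_integrable_def by (rule borel_measurable_integrable)
    moreover have "\<psi> \<in> borel_measurable lebesgue" using \<psi>(1) by (simp add: measurable_completion)
    ultimately have "(\<lambda>p. (indicator K p *\<^sub>R u p) * \<psi> p) \<in> borel_measurable lebesgue" by simp
    moreover have "(indicator K p *\<^sub>R u p) * \<psi> p = indicator U p *\<^sub>R (u p * \<psi> p)" for p
      using K \<psi>(2)[of p] by (auto simp: indicator_def)
    ultimately show "(\<lambda>p. indicator U p *\<^sub>R (u p * \<psi> p)) \<in> borel_measurable lebesgue" by (simp only:)
    show "(\<lambda>p. u' p * \<psi> p) \<in> borel_measurable lebesgue"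
      by (rule measurable_completion) (use u' \<psi> in simp)
    show "AE p in lebesgue. indicator U p *\<^sub>R (u p * \<psi> p) = u' p * \<psi> p"
      using u'(2)
    proof eventually_elim
      case (elim p) then show ?case using K \<psi>(2)[of p] by (cases "p \<in> K") (auto simp: indicator_def)
    qed
  qed
  also have "\<dots> = (LINT p|lborel. u' p * \<psi> p)"
    by (rule integral_completion) (use u' \<psi> in simp)
  finally show ?thesis .
qed

lemma test_function_measurable:
  assumes "test_function U \<phi> \<phi>'"
  shows "\<phi> \<in> borel_measurable borel" "(\<lambda>p. \<phi>' p e) \<in> borel_measurable borel"
proof -
  have "continuous_on UNIV \<phi>"
    using assms unfolding test_function_def by (meson continuous_at_imp_continuous_on has_derivative_continuous)
  then show "\<phi> \<in> borel_measurable borel" by (rule borel_measurable_continuous_onI)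
  show "(\<lambda>p. \<phi>' p e) \<in> borel_measurable borel"
    by (rule borel_measurable_continuous_onI) (use assms in \<open>unfold test_function_def, blast\<close>)
qed

text \<open>Both functions have the same Borel representative on \<open>K\<close>, and the integrals
  against \<open>\<psi>\<close> depend only on that representative.\<close>

lemma set_integral_test_cong_AE:
  fixes u u' \<psi> :: "real \<times> real \<Rightarrow> real"
  assumes u: "locally_integrable U u" and K: "compact K" "K \<subseteq> U"
    and ae: "AE p in lebesgue. p \<in> U \<longrightarrow> u p = u' p"
    and \<psi>: "\<psi> \<in> borel_measurable borel" "\<And>p. p \<notin> K \<Longrightarrow> \<psi> p = 0"
  shows "(LINT p:U|lebesgue. u p * \<psi> p) = (LINT p:U|lebesgue. u' p * \<psi> p)"
proof -
  have uK: "set_integrable lebesgue K u" using u K unfolding locally_integrable_def by blast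
  have ae': "AE p in lebesgue. p \<in> K \<longrightarrow> u p = u' p" using ae by eventually_elim (use K in auto)
  have u'K: "set_integrable lebesgue K u'" by (rule set_integrable_cong_AE_lebesgue[OF uK ae'])
  obtain w where w: "w \<in> borel_measurable borel" "AE p in lebesgue. p \<in> K \<longrightarrow> w p = u p"
    by (rule borel_representative[OF uK])
  have "AE p in lebesgue. p \<in> K \<longrightarrow> w p = u' p" using w(2) ae' by eventually_elim auto
  then show ?thesis
    using set_integral_borel_representative[OF uK K w \<psi>]
      set_integral_borel_representative[OF u'K K w(1) _ \<psi>] by simp
qed

lemma has_weak_deriv_cong_AE:
  assumes w: "has_weak_deriv e U u g"
    and u: "AE p in lebesgue. p \<in> U \<longrightarrow> u p = u' p" and g: "AE p in lebesgue. p \<in> U \<longrightarrow> g p = g' p"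
  shows "has_weak_deriv e U u' g'"
  unfolding has_weak_deriv_def
proof (intro conjI allI impI)
  have li: "locally_integrable U u" "locally_integrable U g"
    using w unfolding has_weak_deriv_def by blast+
  have *: "locally_integrable U f'" if "locally_integrable U f" "AE p in lebesgue. p \<in> U \<longrightarrow> f p = f' p" for f f'
    unfolding locally_integrable_def
  proof (intro allI impI)
    fix K assume K: "compact K \<and> K \<subseteq> U"
    have "AE p in lebesgue. p \<in> K \<longrightarrow> f p = f' p" using that(2) by eventually_elim (use K in auto)
    with K show "set_integrable lebesgue K f'"
      using set_integrable_cong_AE_lebesgue that(1) unfolding locally_integrable_def by blast
  qed
  show "locally_integrable U u'" "locally_integrable U g'" using * li u g by blast+
  fix \<phi> \<phi>' assume t: "test_function U \<phi> \<phi>'"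
  obtain K where K: "compact K" "K \<subseteq> U" "\<And>p. p \<notin> K \<Longrightarrow> \<phi> p = 0" "\<And>p e. p \<notin> K \<Longrightarrow> \<phi>' p e = 0"
    using test_functionE[OF t] by metis
  have "(LINT p:U|lebesgue. u p * \<phi>' p e) = (LINT p:U|lebesgue. u' p * \<phi>' p e)"
    by (rule set_integral_test_cong_AE[OF li(1) K(1,2) u test_function_measurable(2)[OF t] K(4)])
  moreover have "(LINT p:U|lebesgue. g p * \<phi> p) = (LINT p:U|lebesgue. g' p * \<phi> p)"
    by (rule set_integral_test_cong_AE[OF li(2) K(1,2) g test_function_measurable(1)[OF t] K(3)])
  moreover have "(LINT p:U|lebesgue. u p * \<phi>' p e) = - (LINT p:U|lebesgue. g p * \<phi> p)"
    using w t unfolding has_weak_deriv_def by blast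
  ultimately show "(LINT p:U|lebesgue. u' p * \<phi>' p e) = - (LINT p:U|lebesgue. g' p * \<phi> p)" by simp
qed

lemma test_function_product:
  assumes e: "test1 i1 i2 \<eta> \<eta>'" and t: "test1 j1 j2 \<theta> \<theta>'" and U: "{i1..i2} \<times> {j1..j2} \<subseteq> U"
  shows "test_function U (\<lambda>p. \<eta> (fst p) * \<theta> (snd p))
     (\<lambda>p h. \<eta>' (fst p) * fst h * \<theta> (snd p) + \<eta> (fst p) * (\<theta>' (snd p) * snd h))"
  unfolding test_function_def
proof (intro conjI allI)
  fix p :: "real \<times> real"
  have 1: "((\<lambda>p. \<eta> (fst p)) has_derivative (\<lambda>h. \<eta>' (fst p) * fst h)) (at p)"
    by (rule has_derivative_compose[where f=fst and g=\<eta> and f'=fst and g'="(*) (\<eta>' (fst p))"])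
      (use e in \<open>auto simp: test1_def has_field_derivative_def intro: has_derivative_fst has_derivative_ident\<close>)
  have 2: "((\<lambda>p. \<theta> (snd p)) has_derivative (\<lambda>h. \<theta>' (snd p) * snd h)) (at p)"
    by (rule has_derivative_compose[where f=snd and g=\<theta> and f'=snd and g'="(*) (\<theta>' (snd p))"])
      (use t in \<open>auto simp: test1_def has_field_derivative_def intro: has_derivative_snd has_derivative_ident\<close>)
  show "((\<lambda>p. \<eta> (fst p) * \<theta> (snd p)) has_derivative
     (\<lambda>h. \<eta>' (fst p) * fst h * \<theta> (snd p) + \<eta> (fst p) * (\<theta>' (snd p) * snd h))) (at p)"
    using has_derivative_mult[OF 1 2] by (simp add: algebra_simps)
next
  have c: "continuous_on UNIV \<eta>" "continuous_on UNIV \<eta>'" "continuous_on UNIV \<theta>" "continuous_on UNIV \<theta>'"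
    using e t test1_continuous unfolding test1_def by blast+
  have c': "continuous_on UNIV (\<lambda>p::real\<times>real. f (fst p))" "continuous_on UNIV (\<lambda>p::real\<times>real. f (snd p))"
    if "continuous_on UNIV f" for f :: "real \<Rightarrow> real"
    by (rule continuous_on_compose2[OF that]; auto intro!: continuous_intros)+
  show "continuous_on UNIV (\<lambda>p::real\<times>real. \<eta>' (fst p) * fst h * \<theta> (snd p) + \<eta> (fst p) * (\<theta>' (snd p) * snd h))" for h :: "real \<times> real"
    by (intro continuous_intros c' c)
next
  have "compact ({i1..i2} \<times> {j1..j2})" by (intro compact_Times compact_Icc)
  moreover have "\<eta> (fst p) * \<theta> (snd p) = 0" if "p \<notin> {i1..i2} \<times> {j1..j2}" for p
  proof -
    have "fst p \<notin> {i1<..<i2} \<or> snd p \<notin> {j1<..<j2}" using that by (cases p) auto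
    then show ?thesis using e t unfolding test1_def by auto
  qed
  ultimately show "\<exists>K. compact K \<and> K \<subseteq> U \<and> (\<forall>p. p \<notin> K \<longrightarrow> \<eta> (fst p) * \<theta> (snd p) = 0)" using U by blast
qed

text \<open>Brings the defining identity to the form in which the slice lemma consumes it. The
  direction \<open>(1, 0)\<close> keeps the term with \<open>\<eta>'\<close>, the direction
  \<open>(0, 1)\<close> the term with \<open>\<theta>'\<close>.\<close>

lemma weak_deriv_borel_rectangle:
  assumes w: "has_weak_deriv e U u g" and R: "{i1..i2} \<times> {j1..j2} \<subseteq> U"
    and u': "u' \<in> borel_measurable borel" "AE p in lebesgue. p \<in> {i1..i2} \<times> {j1..j2} \<longrightarrow> u' p = u p"
    and g': "g' \<in> borel_measurable borel" "AE p in lebesgue. p \<in> {i1..i2} \<times> {j1..j2} \<longrightarrow> g' p = g p"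
    and e: "test1 i1 i2 \<eta> \<eta>'" and t: "test1 j1 j2 \<theta> \<theta>'"
  shows "(LINT p|lborel. u' p * (\<eta>' (fst p) * fst e * \<theta> (snd p) + \<eta> (fst p) * (\<theta>' (snd p) * snd e)))
     = - (LINT p|lborel. g' p * (\<eta> (fst p) * \<theta> (snd p)))"
proof -
  let ?K = "{i1..i2} \<times> {j1..j2}"
  define \<phi> where "\<phi> = (\<lambda>p::real\<times>real. \<eta> (fst p) * \<theta> (snd p))"
  define \<phi>' where "\<phi>' = (\<lambda>(p::real\<times>real) (h::real\<times>real). \<eta>' (fst p) * fst h * \<theta> (snd p) + \<eta> (fst p) * (\<theta>' (snd p) * snd h))"
  have tf: "test_function U \<phi> \<phi>'" unfolding \<phi>_def \<phi>'_def by (rule test_function_product[OF e t R])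
  have cK: "compact ?K" by (intro compact_Times compact_Icc)
  have z1: "\<phi> p = 0" if "p \<notin> ?K" for p
  proof -
    have "fst p \<notin> {i1<..<i2} \<or> snd p \<notin> {j1<..<j2}" using that by (cases p) auto
    then show ?thesis using e t unfolding test1_def \<phi>_def by auto
  qed
  have z2: "\<phi>' p e = 0" if "p \<notin> ?K" for p by (rule test_function_deriv_zero[OF tf cK z1 that])
  have ui: "set_integrable lebesgue ?K u" and gi: "set_integrable lebesgue ?K g"
    using w R cK unfolding has_weak_deriv_def locally_integrable_def by blast+
  have "(LINT p:U|lebesgue. u p * \<phi>' p e) = - (LINT p:U|lebesgue. g p * \<phi> p)"
    using w tf unfolding has_weak_deriv_def by blast
  moreover have "(LINT p:U|lebesgue. u p * \<phi>' p e) = (LINT p|lborel. u' p * \<phi>' p e)"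
    by (rule set_integral_borel_representative[OF ui cK R u' test_function_measurable(2)[OF tf] z2])
  moreover have "(LINT p:U|lebesgue. g p * \<phi> p) = (LINT p|lborel. g' p * \<phi> p)"
    by (rule set_integral_borel_representative[OF gi cK R g' test_function_measurable(1)[OF tf] z1])
  ultimately show ?thesis unfolding \<phi>_def \<phi>'_def by simp
qed

text \<open>On a closed rectangle inside \<open>U\<close> the difference of Borel representatives is
  orthogonal to all products of bumps, hence zero almost everywhere; the boundary is negligible, and
  an open set is a countable union of closed boxes. This identifies the derivative selected by
  \<open>weak_deriv\<close> with those supplied by the function spaces.\<close>

lemma has_weak_deriv_unique:
  assumes w: "has_weak_deriv e U v g" "has_weak_deriv e U v g'" and U: "open U"
  shows "AE p in lebesgue. p \<in> U \<longrightarrow> g p = g' p"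
proof -
  have rect: "AE p in lebesgue. p \<in> {i1..i2} \<times> {j1..j2} \<longrightarrow> g p = g' p"
    if R: "{i1..i2} \<times> {j1..j2} \<subseteq> U" and ij: "i1 \<le> i2" "j1 \<le> j2" for i1 i2 j1 j2
  proof -
    let ?K = "{i1..i2} \<times> {j1..j2}"
    have cK: "compact ?K" by (intro compact_Times compact_Icc)
    have i: "set_integrable lebesgue ?K v" "set_integrable lebesgue ?K g" "set_integrable lebesgue ?K g'"
      using w R cK unfolding has_weak_deriv_def locally_integrable_def by blast+
    obtain v0 where v0: "v0 \<in> borel_measurable borel" "AE p in lebesgue. p \<in> ?K \<longrightarrow> v0 p = v p"
      by (rule borel_representative[OF i(1)])
    obtain a where a: "a \<in> borel_measurable borel" "AE p in lebesgue. p \<in> ?K \<longrightarrow> a p = g p"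
      by (rule borel_representative[OF i(2)])
    obtain b where b: "b \<in> borel_measurable borel" "AE p in lebesgue. p \<in> ?K \<longrightarrow> b p = g' p"
      by (rule borel_representative[OF i(3)])
    have Km: "?K \<in> sets borel" using cK by (simp add: borel_compact)
    have int: "integrable lborel (\<lambda>p. indicator ?K p * f' p)"
      if "set_integrable lebesgue ?K f" "f' \<in> borel_measurable borel" "AE p in lebesgue. p \<in> ?K \<longrightarrow> f' p = f p"
      for f f' :: "real \<times> real \<Rightarrow> real"
    proof -
      have "AE p in lebesgue. p \<in> ?K \<longrightarrow> f p = f' p" using that(3) by eventually_elim auto
      from set_integrable_cong_AE_lebesgue[OF that(1) this]
      have "integrable lebesgue (\<lambda>p. indicator ?K p * f' p)" unfolding set_integrable_def by simp
      then show ?thesis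
        by (subst (asm) integrable_completion) (use that Km in \<open>auto intro!: borel_measurable_times borel_measurable_indicator\<close>)
    qed
    have ia: "integrable lborel (\<lambda>p. indicator ?K p * a p)" by (rule int[OF i(2) a])
    have ib: "integrable lborel (\<lambda>p. indicator ?K p * b p)" by (rule int[OF i(3) b])
    define h where "h = (\<lambda>p. indicator ?K p * a p - indicator ?K p * b p)"
    have "AE p in lborel. p \<in> {i1<..<i2} \<times> {j1<..<j2} \<longrightarrow> h p = 0"
    proof (rule fundamental_lemma[OF _ ij])
      show "integrable lborel h" unfolding h_def using ia ib by simp
      fix \<eta> \<eta>' \<theta> \<theta>' assume e: "test1 i1 i2 \<eta> \<eta>'" and t: "test1 j1 j2 \<theta> \<theta>'"
      obtain C where C: "\<And>x. \<bar>\<eta> x\<bar> \<le> C" using test1_bounded[OF e] by metis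
      obtain D where D: "\<And>x. \<bar>\<theta> x\<bar> \<le> D" using test1_bounded[OF t] by metis
      have em: "\<eta> \<in> borel_measurable borel" and tm: "\<theta> \<in> borel_measurable borel"
        using e t test1_measurable by blast+
      define \<phi> where "\<phi> = (\<lambda>p::real\<times>real. \<eta> (fst p) * \<theta> (snd p))"
      have pm: "\<phi> \<in> borel_measurable borel" unfolding \<phi>_def
        by (rule test_function_measurable(1)[OF test_function_product[OF e t subset_refl]])
      have pb: "\<bar>\<phi> p\<bar> \<le> C * D" for p
      proof -
        have "C \<ge> 0" using C[of 0] by linarith
        then show ?thesis unfolding \<phi>_def abs_mult using C D by (intro mult_mono) auto
      qed
      have pz: "\<phi> p = 0" if "p \<notin> ?K" for p
      proof -
        have "fst p \<notin> {i1<..<i2} \<or> snd p \<notin> {j1<..<j2}" using that by (cases p) auto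
        then show ?thesis using e t unfolding test1_def \<phi>_def by auto
      qed
      have ip: "integrable lborel (\<lambda>p. f p * \<phi> p)" 
        if "integrable lborel (\<lambda>p. indicator ?K p * f p)" "f \<in> borel_measurable borel" for f
      proof (rule Bochner_Integration.integrable_bound)
        show "integrable lborel (\<lambda>p. (C * D) * (indicator ?K p * f p))" using that(1) by simp
        show "(\<lambda>p. f p * \<phi> p) \<in> borel_measurable lborel" using that(2) pm by simp
        show "AE p in lborel. norm (f p * \<phi> p) \<le> norm ((C * D) * (indicator ?K p * f p))"
        proof (rule AE_I2)
          fix p
          have "\<bar>f p\<bar> * \<bar>\<phi> p\<bar> \<le> \<bar>f p\<bar> * \<bar>C * D\<bar>" using pb[of p] by (intro mult_left_mono) auto
          then show "norm (f p * \<phi> p) \<le> norm ((C * D) * (indicator ?K p * f p))"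
            using pz[of p] by (cases "p \<in> ?K") (auto simp: abs_mult mult_ac)
        qed
      qed
      have "(LINT p|lborel. a p * \<phi> p) = (LINT p|lborel. b p * \<phi> p)"
        using weak_deriv_borel_rectangle[OF w(1) R v0 a e t] weak_deriv_borel_rectangle[OF w(2) R v0 b e t]
        unfolding \<phi>_def by simp
      moreover have "h p * (\<eta> (fst p) * \<theta> (snd p)) = a p * \<phi> p - b p * \<phi> p" for p
      proof -
        have "h p * \<phi> p = a p * \<phi> p - b p * \<phi> p"
          unfolding h_def using pz[of p] by (cases "p \<in> ?K") (auto simp: algebra_simps)
        then show ?thesis unfolding \<phi>_def .
      qed
      ultimately show "(LINT p|lborel. h p * (\<eta> (fst p) * \<theta> (snd p))) = 0"
        using ip[OF ia a(1)] ip[OF ib b(1)] by simp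
    qed
    then have 1: "AE p in lebesgue. p \<in> {i1<..<i2} \<times> {j1<..<j2} \<longrightarrow> h p = 0" by (rule AE_completion)
    have bx: "box (i1, j1) (i2, j2) = {i1<..<i2} \<times> {j1<..<j2}" by (auto simp: mem_box Basis_prod_def box_def)
    have "negligible (?K - {i1<..<i2} \<times> {j1<..<j2})"
      using negligible_frontier_interval[of "(i1, j1)" "(i2, j2)"] unfolding bx by (simp add: cbox_Pair_eq)
    then have 2: "AE p in lebesgue. p \<notin> ?K - {i1<..<i2} \<times> {j1<..<j2}"
      by (intro AE_not_in) (simp add: negligible_iff_null_sets)
    show ?thesis using 1 2 a(2) b(2)
    proof eventually_elim
      case (elim p) then show ?case unfolding h_def by auto
    qed
  qed
  obtain D where D: "countable D" "D \<subseteq> Pow U" "\<And>X. X \<in> D \<Longrightarrow> \<exists>a b. X = cbox a b" "\<Union>D = U"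
    using open_countable_Union_open_cbox[OF U] by metis
  have "AE p in lebesgue. \<forall>X\<in>D. p \<in> X \<longrightarrow> g p = g' p"
  proof (subst AE_ball_countable[OF D(1)], intro ballI)
    fix X assume X: "X \<in> D"
    then obtain a b where "X = cbox a b" using D(3) by blast
    then have X': "X = {fst a..fst b} \<times> {snd a..snd b}" using cbox_Pair_eq[of "fst a" "snd a" "fst b" "snd b"] by simp
    show "AE p in lebesgue. p \<in> X \<longrightarrow> g p = g' p"
    proof (cases "X = {}")
      case False
      then have "fst a \<le> fst b" "snd a \<le> snd b" unfolding X' by auto
      then show ?thesis unfolding X' by (intro rect) (use X D(2) X' in auto)
    qed auto
  qed
  then show ?thesis by eventually_elim (use D(4) in blast)
qed

text \<open>By uniqueness the derivatives on the sets \<open>S n\<close> agree almost everywhere on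
  overlaps, so the value may be taken from the first set containing the point. The Sobolev condition
  provides derivatives only off each \<open>closure (Q \<rho>)\<close>, whereas
  \<open>D_xi_xi\<close> and \<open>D_t\<close> are choices over the whole open strip: existence
  there must be shown before the choice has any meaning.\<close>

lemma has_weak_deriv_glue:
  fixes S :: "nat \<Rightarrow> (real \<times> real) set"
  assumes w: "\<And>n. has_weak_deriv e (S n) v (g n)" and S: "\<And>n. open (S n)" "\<And>m n. m \<le> n \<Longrightarrow> S m \<subseteq> S n"
    and ex: "\<And>K. compact K \<Longrightarrow> K \<subseteq> U \<Longrightarrow> \<exists>n. K \<subseteq> S n"
  shows "\<exists>G. has_weak_deriv e U v G"
proof -
  define G where "G = (\<lambda>p. g (LEAST n. p \<in> S n) p)"
  have "AE p in lebesgue. \<forall>n m. m \<le> n \<longrightarrow> p \<in> S m \<longrightarrow> g n p = g m p"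
  proof (unfold AE_all_countable, intro allI)
    fix n m
    show "AE p in lebesgue. m \<le> n \<longrightarrow> p \<in> S m \<longrightarrow> g n p = g m p"
    proof (cases "m \<le> n")
      case True
      then show ?thesis
        using has_weak_deriv_unique[OF has_weak_deriv_subset[OF w[of n] S(2)[OF True]] w[of m] S(1)] by auto
    qed auto
  qed
  then have ae: "AE p in lebesgue. p \<in> S n \<longrightarrow> g n p = G p" for n
  proof eventually_elim
    case (elim p)
    show ?case
    proof
      assume p: "p \<in> S n"
      have "(LEAST n. p \<in> S n) \<le> n" "p \<in> S (LEAST n. p \<in> S n)"
        using p by (auto intro: Least_le LeastI)
      then show "g n p = G p" unfolding G_def using elim by blast
    qed
  qed
  have "has_weak_deriv e (S n) v G" for n
    by (rule has_weak_deriv_cong_AE[OF w[of n] _ ae]) auto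
  then show ?thesis using has_weak_deriv_exhaust[of e S v G U] ex by blast
qed

section \<open>Regularity of solutions away from the initial line\<close>

lemma interior_strip: "interior (strip T) = UNIV \<times> {0<..<T}"
  unfolding strip_def by (simp add: interior_Times)

text \<open>The closure of \<open>Q \<rho>\<close> reaches up to height
  \<open>\<rho>\<^sup>2\<close>. The half-strips above these heights increase to the open strip as
  \<open>\<rho>\<close> decreases.\<close>

lemma strip_above_subset: "UNIV \<times> {\<rho>\<^sup>2<..<T} \<subseteq> interior (strip T - closure (Q \<rho>))"
proof (rule interior_maximal)
  have "closure (Q \<rho>) \<subseteq> UNIV \<times> {..\<rho>\<^sup>2}"
    by (rule closure_minimal) (auto simp: Q_def intro!: closed_Times)
  moreover have "0 \<le> y" if "\<rho>\<^sup>2 < y" for y using zero_le_power2[of \<rho>] that by linarith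
  ultimately show "UNIV \<times> {\<rho>\<^sup>2<..<T} \<subseteq> strip T - closure (Q \<rho>)"
    unfolding strip_def by fastforce
  show "open (UNIV \<times> {\<rho>\<^sup>2<..<T} :: (real \<times> real) set)" by (simp add: open_Times)
qed

lemma compact_subset_strip_above:
  assumes "compact K" "K \<subseteq> UNIV \<times> {0<..<T}"
  shows "\<exists>n. K \<subseteq> (UNIV :: real set) \<times> {(1 / real (Suc n))\<^sup>2<..<T}"
proof (cases "K = {}")
  case False
  have "compact (snd ` K)" by (intro compact_continuous_image continuous_intros assms)
  then obtain m where m: "m \<in> snd ` K" "\<And>y. y \<in> snd ` K \<Longrightarrow> m \<le> y"
    using compact_attains_inf[of "snd ` K"] False by auto
  have "m > 0" using m(1) assms(2) by auto
  then obtain n where n: "1 / real (Suc n) < min m 1" using nat_approx_posE[of "min m 1"] by auto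
  have "(1 / real (Suc n))\<^sup>2 \<le> 1 / real (Suc n)"
    using power_decreasing[of 1 2 "1 / real (Suc n)"] by simp
  then have "K \<subseteq> UNIV \<times> {(1 / real (Suc n))\<^sup>2<..<T}"
    using m(2) assms(2) n by fastforce
  then show ?thesis by blast
qed auto

lemma ess_bounded_on_cong_AE:
  assumes "ess_bounded_on U f" "AE p in lebesgue. p \<in> U \<longrightarrow> f p = g p"
  shows "ess_bounded_on U g"
proof -
  obtain C where "AE p in lebesgue. p \<in> U \<longrightarrow> \<bar>f p\<bar> \<le> C" using assms(1) unfolding ess_bounded_on_def by blast
  then have "AE p in lebesgue. p \<in> U \<longrightarrow> \<bar>g p\<bar> \<le> C" using assms(2) by eventually_elim auto
  then show ?thesis unfolding ess_bounded_on_def by blast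
qed

lemma ess_bounded_on_subset:
  assumes "ess_bounded_on U f" "V \<subseteq> U" shows "ess_bounded_on V f"
proof -
  obtain C where "AE p in lebesgue. p \<in> U \<longrightarrow> \<bar>f p\<bar> \<le> C" using assms(1) unfolding ess_bounded_on_def by blast
  then have "AE p in lebesgue. p \<in> V \<longrightarrow> \<bar>f p\<bar> \<le> C" by eventually_elim (use assms(2) in auto)
  then show ?thesis unfolding ess_bounded_on_def by blast
qed

context
  fixes T :: real and v :: "real \<times> real \<Rightarrow> real"
  assumes W21: "v \<in> (\<Inter>\<rho>\<in>{0<..}. W21_inf (strip T - closure (Q \<rho>)))"
    and W10: "v \<in> W10_inf (strip T)"
begin

text \<open>Membership in \<open>W10_inf\<close> gives existence on the whole open strip, so the
  choice is legitimate, and uniqueness transfers the bound to it. The bound is uniform down to t =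
  0, which later makes the flux constant independent of the starting time.\<close>

lemma D_xi_weak:
  shows "has_weak_deriv (1, 0) (UNIV \<times> {0<..<T}) v (D_xi T v)"
    and "ess_bounded_on (UNIV \<times> {0<..<T}) (D_xi T v)"
proof -
  obtain g where g: "has_weak_deriv (1, 0) (UNIV \<times> {0<..<T}) v g" "ess_bounded_on (UNIV \<times> {0<..<T}) g"
    using W10 unfolding W10_inf_def interior_strip by blast
  show 1: "has_weak_deriv (1, 0) (UNIV \<times> {0<..<T}) v (D_xi T v)"
    unfolding D_xi_def weak_deriv_def interior_strip by (rule someI[of _ g]) (rule g)
  show "ess_bounded_on (UNIV \<times> {0<..<T}) (D_xi T v)"
    by (rule ess_bounded_on_cong_AE[OF g(2) has_weak_deriv_unique[OF g(1) 1]]) (simp add: open_Times)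
qed

text \<open>The first derivative supplied by \<open>W21_inf\<close> agrees almost everywhere with
  \<open>D_xi T v\<close> by uniqueness, so the second one may be read as a derivative of
  \<open>D_xi T v\<close>.\<close>

lemma W21_above:
  fixes n :: nat
  defines "S \<equiv> UNIV \<times> {(1 / real (Suc n))\<^sup>2<..<T}"
  obtains a b where "has_weak_deriv (1, 0) S (D_xi T v) a" "has_weak_deriv (0, 1) S v b"
    "ess_bounded_on S a" "ess_bounded_on S b"
proof -
  define \<rho> where "\<rho> = 1 / real (Suc n)"
  have "\<rho> > 0" unfolding \<rho>_def by simp
  then have "v \<in> W21_inf (strip T - closure (Q \<rho>))" using W21 by auto
  then obtain x a b where w: "has_weak_deriv (1, 0) (interior (strip T - closure (Q \<rho>))) v x"
    "has_weak_deriv (1, 0) (interior (strip T - closure (Q \<rho>))) x a"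
    "has_weak_deriv (0, 1) (interior (strip T - closure (Q \<rho>))) v b"
    "ess_bounded_on (interior (strip T - closure (Q \<rho>))) a"
    "ess_bounded_on (interior (strip T - closure (Q \<rho>))) b"
    unfolding W21_inf_def by blast
  have S: "S \<subseteq> interior (strip T - closure (Q \<rho>))" unfolding S_def \<rho>_def by (rule strip_above_subset)
  have oS: "open S" unfolding S_def by (simp add: open_Times)
  have SU: "S \<subseteq> UNIV \<times> {0<..<T}" unfolding S_def by (auto intro: le_less_trans[OF zero_le_power2])
  note w' = w(1-3)[THEN has_weak_deriv_subset[OF _ S]] w(4,5)[THEN ess_bounded_on_subset[OF _ S]]
  have ae: "AE p in lebesgue. p \<in> S \<longrightarrow> x p = D_xi T v p"
    by (rule has_weak_deriv_unique[OF w'(1) has_weak_deriv_subset[OF D_xi_weak(1) SU] oS])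
  have "has_weak_deriv (1, 0) S (D_xi T v) a"
    by (rule has_weak_deriv_cong_AE[OF w'(2) ae]) auto
  then show ?thesis using w' that by blast
qed

text \<open>Gluing produces a derivative on the open strip; on a half-strip above
  \<open>\<tau>\<close> it agrees with one of the \<open>g n\<close> and inherits its bound, which
  may depend on \<open>\<tau>\<close>.\<close>

lemma weak_above:
  assumes w: "\<And>n. has_weak_deriv e (UNIV \<times> {(1 / real (Suc n))\<^sup>2<..<T}) u (g n)"
    and b: "\<And>n. ess_bounded_on (UNIV \<times> {(1 / real (Suc n))\<^sup>2<..<T}) (g n)"
  shows "has_weak_deriv e (UNIV \<times> {0<..<T}) u (weak_deriv e (interior (strip T)) u)"
    and "\<tau> > 0 \<Longrightarrow> ess_bounded_on (UNIV \<times> {\<tau><..<T}) (weak_deriv e (interior (strip T)) u)"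
proof -
  define S where "S = (\<lambda>n. (UNIV :: real set) \<times> {(1 / real (Suc n))\<^sup>2<..<T})"
  have oS: "open (S n)" for n unfolding S_def by (simp add: open_Times)
  have mono: "S m \<subseteq> S n" if "m \<le> n" for m n
  proof -
    have "(1 / real (Suc n))\<^sup>2 \<le> (1 / real (Suc m))\<^sup>2"
      using that by (intro power_mono divide_left_mono) auto
    then have "{(1 / real (Suc m))\<^sup>2<..<T} \<subseteq> {(1 / real (Suc n))\<^sup>2<..<T}"
      by (meson greaterThanLessThan_iff le_less_trans subsetI)
    then show ?thesis unfolding S_def by blast
  qed
  have SU: "S n \<subseteq> UNIV \<times> {0<..<T}" for n unfolding S_def by (auto intro: le_less_trans[OF zero_le_power2])
  have "\<exists>G. has_weak_deriv e (UNIV \<times> {0<..<T}) u G"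
    by (rule has_weak_deriv_glue[of e S u g]) (use w oS mono compact_subset_strip_above in \<open>auto simp: S_def\<close>)
  then show 1: "has_weak_deriv e (UNIV \<times> {0<..<T}) u (weak_deriv e (interior (strip T)) u)"
    unfolding weak_deriv_def interior_strip by (rule someI_ex)
  assume "\<tau> > 0"
  then have "min \<tau> 1 > 0" by simp
  then obtain n where n: "1 / real (Suc n) < min \<tau> 1" using nat_approx_posE by metis
  have "(1 / real (Suc n))\<^sup>2 \<le> 1 / real (Suc n)"
    using power_decreasing[of 1 2 "1 / real (Suc n)"] by simp
  then have sub: "UNIV \<times> {\<tau><..<T} \<subseteq> S n" using n unfolding S_def by auto
  have "ess_bounded_on (S n) (weak_deriv e (interior (strip T)) u)"
  proof (rule ess_bounded_on_cong_AE)
    show "ess_bounded_on (S n) (g n)" unfolding S_def by (rule b)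
    have "has_weak_deriv e (S n) u (g n)" unfolding S_def by (rule w)
    then show "AE p in lebesgue. p \<in> S n \<longrightarrow> g n p = weak_deriv e (interior (strip T)) u p"
      by (rule has_weak_deriv_unique[OF _ has_weak_deriv_subset[OF 1 SU] oS])
  qed
  then show "ess_bounded_on (UNIV \<times> {\<tau><..<T}) (weak_deriv e (interior (strip T)) u)"
    using sub by (rule ess_bounded_on_subset)
qed

lemma D_xi_xi_weak:
  shows "has_weak_deriv (1, 0) (UNIV \<times> {0<..<T}) (D_xi T v) (D_xi_xi T v)"
    and "\<tau> > 0 \<Longrightarrow> ess_bounded_on (UNIV \<times> {\<tau><..<T}) (D_xi_xi T v)"
proof -
  have "\<exists>a. has_weak_deriv (1, 0) (UNIV \<times> {(1 / real (Suc n))\<^sup>2<..<T}) (D_xi T v) a \<and>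
     ess_bounded_on (UNIV \<times> {(1 / real (Suc n))\<^sup>2<..<T}) a" for n
    using W21_above[of n] by metis
  then obtain g where g: "\<And>n. has_weak_deriv (1, 0) (UNIV \<times> {(1 / real (Suc n))\<^sup>2<..<T}) (D_xi T v) (g n)"
    "\<And>n. ess_bounded_on (UNIV \<times> {(1 / real (Suc n))\<^sup>2<..<T}) (g n)" by metis
  show "has_weak_deriv (1, 0) (UNIV \<times> {0<..<T}) (D_xi T v) (D_xi_xi T v)"
    "\<tau> > 0 \<Longrightarrow> ess_bounded_on (UNIV \<times> {\<tau><..<T}) (D_xi_xi T v)"
    using weak_above[OF g] unfolding D_xi_xi_def D_xi_def[of T "D_xi T v"] by blast+
qed

lemma D_t_weak:
  shows "has_weak_deriv (0, 1) (UNIV \<times> {0<..<T}) v (D_t T v)"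
    and "\<tau> > 0 \<Longrightarrow> ess_bounded_on (UNIV \<times> {\<tau><..<T}) (D_t T v)"
proof -
  have "\<exists>a. has_weak_deriv (0, 1) (UNIV \<times> {(1 / real (Suc n))\<^sup>2<..<T}) v a \<and>
     ess_bounded_on (UNIV \<times> {(1 / real (Suc n))\<^sup>2<..<T}) a" for n
    using W21_above[of n] by metis
  then obtain g where g: "\<And>n. has_weak_deriv (0, 1) (UNIV \<times> {(1 / real (Suc n))\<^sup>2<..<T}) v (g n)"
    "\<And>n. ess_bounded_on (UNIV \<times> {(1 / real (Suc n))\<^sup>2<..<T}) (g n)" by metis
  show "has_weak_deriv (0, 1) (UNIV \<times> {0<..<T}) v (D_t T v)"
    "\<tau> > 0 \<Longrightarrow> ess_bounded_on (UNIV \<times> {\<tau><..<T}) (D_t T v)"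
    using weak_above[OF g] unfolding D_t_def by blast+
qed

end

section \<open>Restriction to lines in a rectangle\<close>

text \<open>Exchanging the two quantifiers requires a measurable set, so the exceptional set of
  \<open>P\<close> is first enlarged to a measurable null set \<open>N\<close>.\<close>

lemma AE_slice_swap:
  fixes P :: "real \<times> real \<Rightarrow> bool"
  assumes "AE p in lborel. P p"
  shows "AE y in lborel. AE x in lborel. P (x, y)"
proof -
  obtain N where N: "N \<in> null_sets lborel" "{p. \<not> P p} \<subseteq> N"
    using assms by (auto simp: eventually_ae_filter)
  have "AE p in lborel \<Otimes>\<^sub>M lborel. p \<notin> N" unfolding lborel_prod by (rule AE_not_in[OF N(1)])
  from lborel_pair.AE_pair[OF this] have "AE x in lborel. AE y in lborel. (x, y) \<notin> N" .
  moreover have "{x \<in> space (lborel \<Otimes>\<^sub>M lborel). (fst x, snd x) \<notin> N} \<in> sets (lborel \<Otimes>\<^sub>M (lborel :: real measure))"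
  proof -
    have "{x \<in> space (lborel \<Otimes>\<^sub>M lborel). (fst x, snd x) \<notin> N} = - N" by (auto simp: space_pair_measure)
    moreover have "- N \<in> sets (lborel :: (real \<times> real) measure)" using N(1) by (auto simp: null_sets_def)
    ultimately show ?thesis unfolding lborel_prod by simp
  qed
  ultimately have "AE y in lborel. AE x in lborel. (x, y) \<notin> N"
    using lborel_pair.AE_commute[of "\<lambda>x y. (x, y) \<notin> N"] by blast
  then show ?thesis
    by (rule eventually_mono) (erule eventually_mono, use N(2) in blast)
qed

lemma continuous_AE_eq:
  fixes f g :: "real \<Rightarrow> real"
  assumes f: "continuous_on {a..b} f" and g: "continuous_on {a..b} g" and ab: "a < b"
    and ae: "AE x in lborel. x \<in> {a<..<b} \<longrightarrow> f x = g x" and x: "x \<in> {a..b}"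
  shows "f x = g x"
proof -
  obtain N where N: "N \<in> null_sets lborel" "{x. \<not> (x \<in> {a<..<b} \<longrightarrow> f x = g x)} \<subseteq> N"
    using ae by (auto simp: eventually_ae_filter)
  have "negligible N" using N(1) by (simp add: negligible_iff_null_sets null_sets_completionI)
  then have neg: "negligible (N \<union> {a, b})" by simp
  have "((\<lambda>x. \<bar>f x - g x\<bar>) has_integral 0) (cbox a b)"
  proof (rule has_integral_negligible[OF neg])
    fix x assume "x \<in> cbox a b - (N \<union> {a, b})"
    then have "x \<in> {a<..<b}" "x \<notin> N" by auto
    then show "\<bar>f x - g x\<bar> = 0" using N(2) by auto
  qed
  moreover have "continuous_on (cbox a b) (\<lambda>x. \<bar>f x - g x\<bar>)" using f g by (auto intro!: continuous_intros)
  moreover have "box a b \<noteq> {}" "x \<in> cbox a b" using ab x by auto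
  ultimately have "\<bar>f x - g x\<bar> = 0"
    using has_integral_0_cbox_imp_0[of a b "\<lambda>x. \<bar>f x - g x\<bar>" x] by auto
  then show ?thesis by simp
qed

lemma primitive_on_cong:
  assumes "primitive_on c d u g" "\<And>x. x \<in> {c..d} \<Longrightarrow> u x = u' x"
  shows "primitive_on c d u' g"
  using assms unfolding primitive_on_def by auto

text \<open>Allows a merely measurable density to be replaced by its continuous version, whose value
  at an endpoint is meaningful.\<close>

lemma primitive_on_cong_AE:
  assumes u: "primitive_on c d u g" and g': "continuous_on {c..d} g'"
    and ae: "AE x in lborel. x \<in> {c<..<d} \<longrightarrow> g x = g' x"
  shows "primitive_on c d u g'"
  unfolding primitive_on_def
proof (intro conjI allI impI)
  obtain N where N: "N \<in> null_sets lborel" "{x. \<not> (x \<in> {c<..<d} \<longrightarrow> g x = g' x)} \<subseteq> N"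
    using ae by (auto simp: eventually_ae_filter)
  have "negligible N" using N(1) by (simp add: negligible_iff_null_sets null_sets_completionI)
  then have neg: "negligible (N \<union> {c, d})" by simp
  show "g' \<in> borel_measurable (lebesgue_on {c..d})"
    by (rule continuous_imp_measurable_on_sets_lebesgue[OF g']) auto
  have "bounded (g' ` {c..d})" by (intro compact_imp_bounded compact_continuous_image g') auto
  then show "\<exists>M. \<forall>x\<in>{c..d}. \<bar>g' x\<bar> \<le> M" unfolding bounded_iff ball_simps real_norm_def .
  fix x y assume xy: "c \<le> x \<and> x \<le> y \<and> y \<le> d"
  then have "(g has_integral u y - u x) {x..y}" using primitive_onD[OF u] by blast
  then show "(g' has_integral u y - u x) {x..y}"
  proof (rule has_integral_spike[OF neg, rotated])
    fix z assume "z \<in> {x..y} - (N \<union> {c, d})"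
    then have "z \<in> {c<..<d}" "z \<notin> N" using xy by auto
    then show "g' z = g z" using N(2) by auto
  qed
qed

text \<open>Truncation at \<open>M\<close> turns the essential bound into a bound at every
  point.\<close>

lemma bounded_borel_representative:
  fixes u :: "real \<times> real \<Rightarrow> real"
  assumes u: "set_integrable lebesgue K u" and b: "AE p in lebesgue. p \<in> K \<longrightarrow> \<bar>u p\<bar> \<le> M" and "M \<ge> 0"
  obtains u' where "u' \<in> borel_measurable borel" "\<And>p. \<bar>u' p\<bar> \<le> M" "AE p in lebesgue. p \<in> K \<longrightarrow> u' p = u p"
proof -
  obtain w where w: "w \<in> borel_measurable borel" "AE p in lebesgue. p \<in> K \<longrightarrow> w p = u p"
    by (rule borel_representative[OF u])
  show ?thesis
  proof (rule that)
    show "(\<lambda>p. max (- M) (min M (w p))) \<in> borel_measurable borel" using w(1) by measurable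
    show "\<bar>max (- M) (min M (w p))\<bar> \<le> M" for p using \<open>M \<ge> 0\<close> by auto
    show "AE p in lebesgue. p \<in> K \<longrightarrow> max (- M) (min M (w p)) = u p"
      using w(2) b by eventually_elim auto
  qed
qed

lemma AE_lebesgue_lborel: "(AE p in lebesgue. P p) \<Longrightarrow> AE p in lborel. P p"
  by (simp add: AE_completion_iff)

lemma has_weak_deriv_set_integrable:
  assumes "has_weak_deriv e U u g" "compact K" "K \<subseteq> U"
  shows "set_integrable lebesgue K u" "set_integrable lebesgue K g"
  using assms unfolding has_weak_deriv_def locally_integrable_def by blast+

text \<open>Three applications of the slice lemma: to v and its first \<xi>-derivative, to the first
  and second \<xi>-derivatives, and, with coordinates exchanged, to v and its time derivative.
  Continuity of v turns equality almost everywhere on a line into equality everywhere. On almost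
  every time slice the first derivative has a continuous version \<open>p'\<close>, which can be
  evaluated at \<open>L\<close> and obeys the bound \<open>N\<close>; the auxiliary bound
  \<open>M\<close> may depend on the rectangle.\<close>

lemma rectangle_regularity:
  fixes v :: "real \<times> real \<Rightarrow> real"
  assumes W: "v \<in> (\<Inter>\<rho>\<in>{0<..}. W21_inf (strip T - closure (Q \<rho>))) \<inter> W10_inf (strip T)"
    and cont: "continuous_on (strip T - {(0, 0)}) v"
    and N: "AE p in lebesgue. p \<in> UNIV \<times> {0<..<T} \<longrightarrow> \<bar>D_xi T v p\<bar> \<le> N" "N \<ge> 0"
    and st: "0 < s" "s < t" "t < T" and AL: "A < L"
  obtains p q r M where "p \<in> borel_measurable borel" "q \<in> borel_measurable borel" "r \<in> borel_measurable borel"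
    "\<And>z. \<bar>p z\<bar> \<le> M" "\<And>z. \<bar>q z\<bar> \<le> M" "\<And>z. \<bar>r z\<bar> \<le> M"
    "AE z in lborel. z \<in> {A..L} \<times> {s..t} \<longrightarrow> p z = D_xi T v z \<and> q z = D_xi_xi T v z \<and> r z = D_t T v z"
    "AE x in lborel. x \<in> {A<..<L} \<longrightarrow> primitive_on s t (\<lambda>\<tau>. v (x, \<tau>)) (\<lambda>\<tau>. r (x, \<tau>))"
    "AE \<tau> in lborel. \<tau> \<in> {s<..<t} \<longrightarrow> (\<exists>p'. (AE x in lborel. x \<in> {A<..<L} \<longrightarrow> p (x, \<tau>) = p' x) \<and>
        (\<forall>x\<in>{A..L}. \<bar>p' x\<bar> \<le> N) \<and> primitive_on A L (\<lambda>x. v (x, \<tau>)) p' \<and> primitive_on A L p' (\<lambda>x. q (x, \<tau>)))"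
proof -
  let ?R = "{A..L} \<times> {s..t}"
  have W21: "v \<in> (\<Inter>\<rho>\<in>{0<..}. W21_inf (strip T - closure (Q \<rho>)))" and W10: "v \<in> W10_inf (strip T)"
    using W by blast+
  note D = D_xi_weak[OF W21 W10] D_xi_xi_weak[OF W21 W10] D_t_weak[OF W21 W10]
  have RU: "?R \<subseteq> UNIV \<times> {0<..<T}" using st by auto
  have RS: "?R \<subseteq> UNIV \<times> {s/2<..<T}" using st by auto
  have cR: "compact ?R" by (intro compact_Times compact_Icc)
  have si: "set_integrable lebesgue ?R (D_xi T v)" "set_integrable lebesgue ?R (D_xi_xi T v)"
    "set_integrable lebesgue ?R (D_t T v)"
    by (rule has_weak_deriv_set_integrable(2)[OF D(1) cR RU] has_weak_deriv_set_integrable(2)[OF D(3) cR RU]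
        has_weak_deriv_set_integrable(2)[OF D(5) cR RU])+
  \<comment> \<open>Essential bounds are available on open half-strips above a positive height; the
    height \<open>s / 2\<close> leaves the closed rectangle inside.\<close>
  have "s / 2 > 0" using st by simp
  then obtain M1 M2 where M1: "AE p in lebesgue. p \<in> UNIV \<times> {s/2<..<T} \<longrightarrow> \<bar>D_xi_xi T v p\<bar> \<le> M1"
    and M2: "AE p in lebesgue. p \<in> UNIV \<times> {s/2<..<T} \<longrightarrow> \<bar>D_t T v p\<bar> \<le> M2"
    using D(4)[of "s / 2"] D(6)[of "s / 2"] unfolding ess_bounded_on_def by blast
  have vR: "continuous_on ?R v" by (rule continuous_on_subset[OF cont]) (use st in \<open>auto simp: strip_def\<close>)
  have "bounded (v ` ?R)" by (intro compact_imp_bounded compact_continuous_image vR cR)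
  then obtain M3 where M3: "\<And>z. z \<in> ?R \<Longrightarrow> \<bar>v z\<bar> \<le> M3"
    unfolding bounded_iff ball_simps real_norm_def by blast
  define M where "M = Max {N, M1, M2, M3}"
  have M: "N \<le> M" "M1 \<le> M" "M2 \<le> M" "M3 \<le> M" "M \<ge> 0" unfolding M_def using N(2) by auto
  have ap: "AE z in lebesgue. z \<in> ?R \<longrightarrow> \<bar>D_xi T v z\<bar> \<le> N" using N(1) by eventually_elim (use RU in auto)
  obtain p where p: "p \<in> borel_measurable borel" "\<And>z. \<bar>p z\<bar> \<le> N" "AE z in lebesgue. z \<in> ?R \<longrightarrow> p z = D_xi T v z"
    using bounded_borel_representative[OF si(1) ap N(2)] by blast
  have aq: "AE z in lebesgue. z \<in> ?R \<longrightarrow> \<bar>D_xi_xi T v z\<bar> \<le> M" using M1 by eventually_elim (use RS M in force)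
  obtain q where q: "q \<in> borel_measurable borel" "\<And>z. \<bar>q z\<bar> \<le> M" "AE z in lebesgue. z \<in> ?R \<longrightarrow> q z = D_xi_xi T v z"
    using bounded_borel_representative[OF si(2) aq M(5)] by blast
  have ar: "AE z in lebesgue. z \<in> ?R \<longrightarrow> \<bar>D_t T v z\<bar> \<le> M" using M2 by eventually_elim (use RS M in force)
  obtain r where r: "r \<in> borel_measurable borel" "\<And>z. \<bar>r z\<bar> \<le> M" "AE z in lebesgue. z \<in> ?R \<longrightarrow> r z = D_t T v z"
    using bounded_borel_representative[OF si(3) ar M(5)] by blast
  have pM: "\<bar>p z\<bar> \<le> M" for z using p(2)[of z] M(1) by linarith
  \<comment> \<open>The hypotheses control \<open>v\<close> only on the strip; the cut-off yields a
    bounded Borel function on the whole plane.\<close>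
  define v' where "v' = (\<lambda>z. indicator ?R z *\<^sub>R v z)"
  have v'm: "v' \<in> borel_measurable borel" unfolding v'_def
    by (rule borel_measurable_continuous_on_indicator[OF borel_compact[OF cR] vR])
  have v'b: "\<bar>v' z\<bar> \<le> M" for z using M3[of z] M unfolding v'_def by (auto simp: indicator_def)
  have v'v: "AE z in lebesgue. z \<in> ?R \<longrightarrow> v' z = v z" unfolding v'_def by simp
  have cs1: "continuous_on {A..L} (\<lambda>x. v (x, \<tau>))" if "\<tau> \<in> {s..t}" for \<tau>
    by (rule continuous_on_compose2[OF vR]) (use that in \<open>auto intro!: continuous_intros\<close>)
  have cs2: "continuous_on {s..t} (\<lambda>\<tau>. v (x, \<tau>))" if "x \<in> {A..L}" for x
    by (rule continuous_on_compose2[OF vR]) (use that in \<open>auto intro!: continuous_intros\<close>)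
  obtain c1 where c1: "AE z in lborel. z \<in> {A<..<L} \<times> {s<..<t} \<longrightarrow> v' z = c1 (snd z) + prim_fst A p z"
  proof (rule weak_derivative_slices[OF v'm p(1) v'b pM AL st(2)])
    fix \<eta> \<eta>' \<theta> \<theta>' assume "test1 A L \<eta> \<eta>'" "test1 s t \<theta> \<theta>'"
    from weak_deriv_borel_rectangle[OF D(1) RU v'm v'v p(1,3) this]
    show "(LINT z|lborel. v' z * (\<eta>' (fst z) * \<theta> (snd z))) = - (LINT z|lborel. p z * (\<eta> (fst z) * \<theta> (snd z)))" by simp
  qed
  obtain c2 where c2: "AE z in lborel. z \<in> {A<..<L} \<times> {s<..<t} \<longrightarrow> p z = c2 (snd z) + prim_fst A q z"
  proof (rule weak_derivative_slices[OF p(1) q(1) pM q(2) AL st(2)])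
    fix \<eta> \<eta>' \<theta> \<theta>' assume "test1 A L \<eta> \<eta>'" "test1 s t \<theta> \<theta>'"
    from weak_deriv_borel_rectangle[OF D(3) RU p(1,3) q(1,3) this]
    show "(LINT z|lborel. p z * (\<eta>' (fst z) * \<theta> (snd z))) = - (LINT z|lborel. q z * (\<eta> (fst z) * \<theta> (snd z)))" by simp
  qed
  have sw: "(LINT z|lborel. f (snd z, fst z)) = (LINT z|lborel. f z)" if "f \<in> borel_measurable borel" for f :: "real \<times> real \<Rightarrow> real"
    using lborel_pair.integral_product_swap[of f] that unfolding lborel_prod by (simp add: case_prod_beta')
  have swm: "(\<lambda>z. f (snd z, fst z)) \<in> borel_measurable borel" if "f \<in> borel_measurable borel" for f :: "real \<times> real \<Rightarrow> real"
    by (rule measurable_compose[OF _ that]) (intro borel_measurable_continuous_onI continuous_intros)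
  \<comment> \<open>The slice lemma differentiates in the first variable, so time and space are
    exchanged here.\<close>
  obtain c3 where c3: "AE z in lborel. z \<in> {s<..<t} \<times> {A<..<L} \<longrightarrow>
      v' (snd z, fst z) = c3 (snd z) + prim_fst s (\<lambda>z. r (snd z, fst z)) z"
  proof (rule weak_derivative_slices[OF swm[OF v'm] swm[OF r(1)] v'b r(2) st(2) AL])
    fix \<eta> \<eta>' \<theta> \<theta>' assume e: "test1 s t \<eta> \<eta>'" and t: "test1 A L \<theta> \<theta>'"
    have m: "\<eta> \<in> borel_measurable borel" "\<eta>' \<in> borel_measurable borel" "\<theta> \<in> borel_measurable borel"
      using e t test1_measurable by blast+
    have mf: "(\<lambda>p::real\<times>real. \<eta> (fst p)) \<in> borel_measurable borel" "(\<lambda>p::real\<times>real. \<eta> (snd p)) \<in> borel_measurable borel"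
      if "\<eta> \<in> borel_measurable borel" for \<eta> :: "real \<Rightarrow> real"
      by (rule measurable_compose[OF _ that]; auto intro!: borel_measurable_continuous_onI continuous_intros)+
    have "(LINT z|lborel. v' (snd z, fst z) * (\<eta>' (fst z) * \<theta> (snd z))) = (LINT z|lborel. v' z * (\<theta> (fst z) * \<eta>' (snd z)))"
      using sw[of "\<lambda>z. v' z * (\<theta> (fst z) * \<eta>' (snd z))"] v'm mf m by (simp add: mult_ac)
    moreover have "(LINT z|lborel. r (snd z, fst z) * (\<eta> (fst z) * \<theta> (snd z))) = (LINT z|lborel. r z * (\<theta> (fst z) * \<eta> (snd z)))"
      using sw[of "\<lambda>z. r z * (\<theta> (fst z) * \<eta> (snd z))"] r(1) mf m by (simp add: mult_ac)
    ultimately show "(LINT z|lborel. v' (snd z, fst z) * (\<eta>' (fst z) * \<theta> (snd z)))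
        = - (LINT z|lborel. r (snd z, fst z) * (\<eta> (fst z) * \<theta> (snd z)))"
      using weak_deriv_borel_rectangle[OF D(5) RU v'm v'v r(1,3) t e] by simp
  qed
  show thesis
  proof (rule that[OF p(1) q(1) r(1) pM q(2) r(2)])
    show "AE z in lborel. z \<in> ?R \<longrightarrow> p z = D_xi T v z \<and> q z = D_xi_xi T v z \<and> r z = D_t T v z"
      using p(3)[THEN AE_lebesgue_lborel] q(3)[THEN AE_lebesgue_lborel] r(3)[THEN AE_lebesgue_lborel]
      by eventually_elim auto
    have "AE x in lborel. AE \<tau> in lborel. (\<tau>, x) \<in> {s<..<t} \<times> {A<..<L} \<longrightarrow>
      v' (x, \<tau>) = c3 x + prim_fst s (\<lambda>z. r (snd z, fst z)) (\<tau>, x)"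
      using AE_slice_swap[OF c3] by simp
    then show "AE x in lborel. x \<in> {A<..<L} \<longrightarrow> primitive_on s t (\<lambda>\<tau>. v (x, \<tau>)) (\<lambda>\<tau>. r (x, \<tau>))"
    proof (rule eventually_mono, intro impI)
      fix x assume ae: "AE \<tau> in lborel. (\<tau>, x) \<in> {s<..<t} \<times> {A<..<L} \<longrightarrow>
          v' (x, \<tau>) = c3 x + prim_fst s (\<lambda>z. r (snd z, fst z)) (\<tau>, x)" and x: "x \<in> {A<..<L}"
      have pr: "primitive_on s t (\<lambda>\<tau>. prim_fst s (\<lambda>z. r (snd z, fst z)) (\<tau>, x)) (\<lambda>\<tau>. r (x, \<tau>))"
        using prim_fst_primitive_on[OF swm[OF r(1)] r(2), of s t x] by simp
      have "primitive_on s t (\<lambda>\<tau>. c3 x) (\<lambda>\<tau>. 0)" by (rule primitive_on_C1) auto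
      from primitive_on_add[OF this pr]
      have pr': "primitive_on s t (\<lambda>\<tau>. c3 x + prim_fst s (\<lambda>z. r (snd z, fst z)) (\<tau>, x)) (\<lambda>\<tau>. r (x, \<tau>))" by simp
      have "AE \<tau> in lborel. \<tau> \<in> {s<..<t} \<longrightarrow> c3 x + prim_fst s (\<lambda>z. r (snd z, fst z)) (\<tau>, x) = v (x, \<tau>)"
        using ae by eventually_elim (use x in \<open>auto simp: v'_def\<close>)
      from continuous_AE_eq[OF primitive_on_continuous[OF pr'] cs2 st(2) this]
      show "primitive_on s t (\<lambda>\<tau>. v (x, \<tau>)) (\<lambda>\<tau>. r (x, \<tau>))"
        by (intro primitive_on_cong[OF pr']) (use x in auto)
    qed
    show "AE \<tau> in lborel. \<tau> \<in> {s<..<t} \<longrightarrow> (\<exists>p'. (AE x in lborel. x \<in> {A<..<L} \<longrightarrow> p (x, \<tau>) = p' x) \<and>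
        (\<forall>x\<in>{A..L}. \<bar>p' x\<bar> \<le> N) \<and> primitive_on A L (\<lambda>x. v (x, \<tau>)) p' \<and> primitive_on A L p' (\<lambda>x. q (x, \<tau>)))"
      using AE_slice_swap[OF c1] AE_slice_swap[OF c2]
    proof (eventually_elim, intro impI)
      fix \<tau> assume ae1: "AE x in lborel. (x, \<tau>) \<in> {A<..<L} \<times> {s<..<t} \<longrightarrow> v' (x, \<tau>) = c1 (snd (x, \<tau>)) + prim_fst A p (x, \<tau>)"
        and ae2: "AE x in lborel. (x, \<tau>) \<in> {A<..<L} \<times> {s<..<t} \<longrightarrow> p (x, \<tau>) = c2 (snd (x, \<tau>)) + prim_fst A q (x, \<tau>)"
        and \<tau>: "\<tau> \<in> {s<..<t}"
      define p' where "p' = (\<lambda>x. c2 \<tau> + prim_fst A q (x, \<tau>))"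
      have k: "primitive_on A L (\<lambda>x. k) (\<lambda>x. 0)" for k by (rule primitive_on_C1) auto
      have p'q: "primitive_on A L p' (\<lambda>x. q (x, \<tau>))"
        unfolding p'_def using primitive_on_add[OF k prim_fst_primitive_on[OF q(1,2)]] by simp
      have p'c: "continuous_on {A..L} p'" by (rule primitive_on_continuous[OF p'q])
      have vp0: "primitive_on A L (\<lambda>x. c1 \<tau> + prim_fst A p (x, \<tau>)) (\<lambda>x. p (x, \<tau>))"
        using primitive_on_add[OF k prim_fst_primitive_on[OF p(1,2)]] by simp
      have "AE x in lborel. x \<in> {A<..<L} \<longrightarrow> c1 \<tau> + prim_fst A p (x, \<tau>) = v (x, \<tau>)"
        using ae1 by eventually_elim (use \<tau> in \<open>auto simp: v'_def\<close>)
      from continuous_AE_eq[OF primitive_on_continuous[OF vp0] cs1 AL this]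
      have vp: "primitive_on A L (\<lambda>x. v (x, \<tau>)) (\<lambda>x. p (x, \<tau>))"
        by (intro primitive_on_cong[OF vp0]) (use \<tau> in auto)
      have pp': "AE x in lborel. x \<in> {A<..<L} \<longrightarrow> p (x, \<tau>) = p' x"
        using ae2 by eventually_elim (use \<tau> in \<open>auto simp: p'_def\<close>)
      \<comment> \<open>The inequality is encoded as the vanishing of a continuous function, which
        extends from almost every interior point to all of \<open>{A..L}\<close>, in particular to
        \<open>L\<close>.\<close>
      have "AE x in lborel. x \<in> {A<..<L} \<longrightarrow> max 0 (\<bar>p' x\<bar> - N) = 0"
        using pp'
      proof eventually_elim
        case (elim x) then show ?case using p(2)[of "(x, \<tau>)"] by auto
      qed
      then have "max 0 (\<bar>p' x\<bar> - N) = 0" if "x \<in> {A..L}" for x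
        by (intro continuous_AE_eq[OF _ _ AL _ that]) (auto intro!: continuous_intros p'c)
      then have p'N: "\<forall>x\<in>{A..L}. \<bar>p' x\<bar> \<le> N" by (metis diff_le_0_iff_le max.absorb_iff1)
      show "\<exists>p'. (AE x in lborel. x \<in> {A<..<L} \<longrightarrow> p (x, \<tau>) = p' x) \<and>
        (\<forall>x\<in>{A..L}. \<bar>p' x\<bar> \<le> N) \<and> primitive_on A L (\<lambda>x. v (x, \<tau>)) p' \<and> primitive_on A L p' (\<lambda>x. q (x, \<tau>))"
        using pp' p'N primitive_on_cong_AE[OF vp p'c pp'] p'q by blast
    qed
  qed
qed

section \<open>The energy inequality\<close>

text \<open>The right-hand side of the assumption, multiplied by
  \<open>exp (- C * (\<tau> - s))\<close>, is nonincreasing. In this integral form \<open>f\<close>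
  only has to be continuous.\<close>

lemma gronwall:
  fixes f :: "real \<Rightarrow> real"
  assumes f: "continuous_on {s..t} f" and st: "s \<le> t" and C: "C \<ge> 0"
    and le: "\<And>\<tau>. \<tau> \<in> {s..t} \<Longrightarrow> f \<tau> \<le> a + C * integral {s..\<tau>} f"
  shows "f t \<le> a * exp (C * (t - s))"
proof (cases "s = t")
  case True
  then show ?thesis using le[of t] by simp
next
  case False
  define G where "G = (\<lambda>\<tau>. (a + C * integral {s..\<tau>} f) * exp (- C * (\<tau> - s)))"
  have "G t \<le> G s"
  proof (rule DERIV_nonpos_imp_decreasing_open[where f=G and a=s and b=t])
    show "s \<le> t" by (rule st)
    show "continuous_on {s..t} G" unfolding G_def
      by (intro continuous_intros indefinite_integral_continuous_1 integrable_continuous_real f)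
    fix x assume x: "s < x" "x < t"
    have "((\<lambda>\<tau>. integral {s..\<tau>} f) has_real_derivative f x) (at x within {s..t})"
      by (rule integral_has_real_derivative[OF f]) (use x in auto)
    then have d: "((\<lambda>\<tau>. integral {s..\<tau>} f) has_real_derivative f x) (at x)"
      by (subst (asm) at_within_interior) (use x in auto)
    have "(G has_real_derivative (C * f x * exp (- C * (x - s)) + (a + C * integral {s..x} f) * (- C * exp (- C * (x - s))))) (at x)"
      unfolding G_def by (auto intro!: derivative_eq_intros d)
    moreover have "C * f x * exp (- C * (x - s)) + (a + C * integral {s..x} f) * (- C * exp (- C * (x - s)))
        = C * exp (- C * (x - s)) * (f x - (a + C * integral {s..x} f))" by (simp add: algebra_simps)
    moreover have "\<dots> \<le> 0" using le[of x] x C by (intro mult_nonneg_nonpos) auto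
    ultimately show "\<exists>y. (G has_real_derivative y) (at x) \<and> y \<le> 0" by (intro exI conjI) simp_all
  qed
  then have "(a + C * integral {s..t} f) * exp (- C * (t - s)) \<le> a" unfolding G_def by simp
  then have "(a + C * integral {s..t} f) * exp (- C * (t - s)) * exp (C * (t - s)) \<le> a * exp (C * (t - s))"
    by (rule mult_right_mono) simp
  moreover have "exp (- C * (t - s)) * exp (C * (t - s)) = 1" by (simp flip: exp_add)
  ultimately have "a + C * integral {s..t} f \<le> a * exp (C * (t - s))"
    by (simp only: mult.assoc mult_1_right)
  then show ?thesis using le[of t] st by auto
qed

lemma has_integral_le_AE:
  fixes f g :: "real \<Rightarrow> real"
  assumes f: "(f has_integral i) {a..b}" and g: "(g has_integral j) {a..b}"
    and ae: "AE x in lborel. x \<in> {a<..<b} \<longrightarrow> f x \<le> g x"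
  shows "i \<le> j"
proof -
  obtain N where N: "N \<in> null_sets lborel" "{x. \<not> (x \<in> {a<..<b} \<longrightarrow> f x \<le> g x)} \<subseteq> N"
    using ae by (auto simp: eventually_ae_filter)
  have "negligible N" using N(1) by (simp add: negligible_iff_null_sets null_sets_completionI)
  then have neg: "negligible (N \<union> {a, b})" by simp
  define f' where "f' = (\<lambda>x. if x \<in> N \<union> {a, b} then g x else f x)"
  have "(f' has_integral i) {a..b}"
    by (rule has_integral_spike[OF neg _ f]) (auto simp: f'_def)
  then show ?thesis
  proof (rule has_integral_le[OF _ g])
    fix x assume x: "x \<in> {a..b}"
    show "f' x \<le> g x"
    proof (cases "x \<in> N \<union> {a, b}")
      case False
      then have "x \<in> {a<..<b}" "x \<notin> N" using x by auto
      then show ?thesis using N(2) False unfolding f'_def by auto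
    qed (simp add: f'_def)
  qed
qed

text \<open>Fubini in both orders, expressed by integrals over the sides of the rectangle: the order
  with time inside yields the energy difference, the order with space inside meets the slice
  inequality.\<close>

lemma has_integral_iterated:
  fixes f :: "real \<times> real \<Rightarrow> real"
  assumes f: "f \<in> borel_measurable borel" "\<And>p. \<bar>f p\<bar> \<le> B" "\<And>p. p \<notin> {A..L} \<times> {s..t} \<Longrightarrow> f p = 0"
  shows "((\<lambda>x. LINT y|lborel. f (x, y)) has_integral (LINT p|lborel. f p)) {A..L}"
    and "((\<lambda>y. LINT x|lborel. f (x, y)) has_integral (LINT p|lborel. f p)) {s..t}"
    and "((\<lambda>x. f (x, y)) has_integral (LINT x|lborel. f (x, y))) {A..L}"
    and "((\<lambda>y. f (x, y)) has_integral (LINT y|lborel. f (x, y))) {s..t}"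
proof -
  have i: "integrable lborel f"
    by (rule integrable_bounded_rect[OF f(1,2), of "(A, s)" "(L, t)"]) (use f(3) in \<open>simp add: cbox_Pair_eq\<close>)
  have ip: "integrable (lborel \<Otimes>\<^sub>M lborel) (\<lambda>(x, y). f (x, y))" using i unfolding lborel_prod by simp
  have restr: "(g has_integral k) S" if "(g has_integral k) UNIV" "\<And>x. x \<notin> S \<Longrightarrow> g x = 0" for g :: "real \<Rightarrow> real" and k S
  proof -
    have "((\<lambda>x. if x \<in> S then g x else 0) has_integral k) UNIV"
      by (rule has_integral_eq[OF _ that(1)]) (use that(2) in auto)
    then show ?thesis unfolding has_integral_restrict_UNIV .
  qed
  have z: "x \<notin> {A..L} \<Longrightarrow> f (x, y) = 0" "y \<notin> {s..t} \<Longrightarrow> f (x, y) = 0" for x y using f(3) by auto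
  show "((\<lambda>x. LINT y|lborel. f (x, y)) has_integral (LINT p|lborel. f p)) {A..L}"
  proof (rule restr)
    show "((\<lambda>x. LINT y|lborel. f (x, y)) has_integral (LINT p|lborel. f p)) UNIV"
      using has_integral_integral_lborel[OF lborel_pair.integrable_fst[OF ip]] lborel_pair.integral_fst[OF ip]
      unfolding lborel_prod by simp
  qed (use z in simp)
  show "((\<lambda>y. LINT x|lborel. f (x, y)) has_integral (LINT p|lborel. f p)) {s..t}"
  proof (rule restr)
    show "((\<lambda>y. LINT x|lborel. f (x, y)) has_integral (LINT p|lborel. f p)) UNIV"
      using has_integral_integral_lborel[OF lborel_pair.integrable_snd[OF ip]] lborel_pair.integral_snd[OF ip]
      unfolding lborel_prod by simp
  qed (use z in simp)
  have "integrable lborel (\<lambda>x. f (x, y))"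
    by (rule integrable_bounded_rect[OF slice_measurable[OF f(1)] f(2), of A L]) (use z in auto)
  from has_integral_integral_lborel[OF this]
  show "((\<lambda>x. f (x, y)) has_integral (LINT x|lborel. f (x, y))) {A..L}" by (rule restr) (use z in auto)
  have "integrable lborel (\<lambda>y. f (x, y))"
    by (rule integrable_bounded_rect[OF slice_measurable'[OF f(1)] f(2), of s t]) (use z in auto)
  from has_integral_integral_lborel[OF this]
  show "((\<lambda>y. f (x, y)) has_integral (LINT y|lborel. f (x, y))) {s..t}" by (rule restr) (use z in auto)
qed

lemma beta_bounded:
  assumes "bL > 0" "bH > bL" "\<bar>y\<bar> \<le> V"
  shows "\<bar>beta bH bL \<gamma> y\<bar> \<le> bL * V + (bH - bL) * (\<bar>\<gamma>\<bar> + V)"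
proof -
  have "\<bar>bL * y\<bar> \<le> bL * V" using assms by (simp add: abs_mult)
  moreover have "\<bar>(bH - bL) * max 0 (\<gamma> - y)\<bar> \<le> (bH - bL) * (\<bar>\<gamma>\<bar> + V)"
    unfolding abs_mult using assms by (intro mult_mono) auto
  ultimately show ?thesis unfolding beta_def by linarith
qed

section \<open>The energy of two solutions\<close>

locale credit_rating =
  fixes \<delta> \<sigma>\<^sub>H \<sigma>\<^sub>L \<gamma> T :: real
  assumes delta: "\<delta> > 0" and sigma_H: "0 < \<sigma>\<^sub>H" and sigma_HL: "\<sigma>\<^sub>H < \<sigma>\<^sub>L"
    and gamma: "0 < \<gamma>" and T: "T > 0"
begin

text \<open>The letters follow the volatilities, so the smaller volatility has the larger
  coefficient: \<open>bH > bL\<close>.\<close>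

definition "bH = 2 / \<sigma>\<^sub>H\<^sup>2"
definition "bL = 2 / \<sigma>\<^sub>L\<^sup>2"

abbreviation "\<beta> \<equiv> beta bH bL \<gamma>"
abbreviation "b \<equiv> bcoef bH bL \<gamma>"

lemma bL_pos: "bL > 0" unfolding bL_def using sigma_H sigma_HL by simp

lemma bH_gt: "bH > bL"
  unfolding bL_def bH_def using sigma_H sigma_HL by (intro divide_strict_left_mono power_strict_mono) auto

lemma b_sigma: "b y * (1 / 2 * (sigma \<sigma>\<^sub>H \<sigma>\<^sub>L \<gamma> y)\<^sup>2) = 1"
  unfolding bcoef_def sigma_def bL_def bH_def using sigma_H sigma_HL by auto

lemma b_pos: "b y > 0" "\<bar>b y\<bar> \<le> bH"
  unfolding bcoef_def using bL_pos bH_gt by auto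

definition admissible :: "(real \<times> real \<Rightarrow> real) \<Rightarrow> bool" where
  "admissible v \<longleftrightarrow> v \<in> (\<Inter>\<rho>\<in>{0<..}. W21_inf (strip T - closure (Q \<rho>))) \<inter> W10_inf (strip T)
     \<and> is_solution \<delta> \<sigma>\<^sub>H \<sigma>\<^sub>L \<gamma> T v"

lemma admissible_bounds:
  assumes "admissible v"
  obtains N where "N \<ge> 0" "AE p in lebesgue. p \<in> UNIV \<times> {0<..<T} \<longrightarrow> \<bar>D_xi T v p\<bar> \<le> N"
    "\<And>p. p \<in> strip T \<Longrightarrow> \<bar>v p\<bar> \<le> N"
proof -
  have W21: "v \<in> (\<Inter>\<rho>\<in>{0<..}. W21_inf (strip T - closure (Q \<rho>)))" and W10: "v \<in> W10_inf (strip T)"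
    using assms unfolding admissible_def by blast+
  obtain C1 where C1: "AE p in lebesgue. p \<in> UNIV \<times> {0<..<T} \<longrightarrow> \<bar>D_xi T v p\<bar> \<le> C1"
    using D_xi_weak(2)[OF W21 W10] unfolding ess_bounded_on_def by blast
  have "bounded (v ` strip T)" using W10 unfolding W10_inf_def by blast
  then obtain C2 where C2: "\<And>p. p \<in> strip T \<Longrightarrow> \<bar>v p\<bar> \<le> C2"
    unfolding bounded_iff ball_simps real_norm_def by blast
  define N where "N = Max {C1, C2, 0}"
  have N: "C1 \<le> N" "C2 \<le> N" "0 \<le> N" unfolding N_def by auto
  show ?thesis
  proof (rule that[OF N(3)])
    show "AE p in lebesgue. p \<in> UNIV \<times> {0<..<T} \<longrightarrow> \<bar>D_xi T v p\<bar> \<le> N"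
      using C1 by eventually_elim (use N in auto)
    show "\<bar>v p\<bar> \<le> N" if "p \<in> strip T" for p using C2[OF that] N by linarith
  qed
qed

lemma differential_inequality:
  assumes v1: "admissible v1" and v2: "admissible v2"
  shows "AE p in lebesgue. p \<in> UNIV \<times> {0<..T} \<longrightarrow> v2 p < v1 p \<longrightarrow>
    b (v1 p) * D_t T v1 p - b (v2 p) * D_t T v2 p \<le>
      D_xi_xi T v1 p - D_xi_xi T v2 p + (D_xi T v1 p - D_xi T v2 p)
      + \<delta> * (b (v1 p) * D_xi T v1 p - b (v2 p) * D_xi T v2 p) + \<delta> * (b (v1 p) * v1 p - b (v2 p) * v2 p)"
proof -
  have L: "b (v p) * L_op \<delta> \<sigma>\<^sub>H \<sigma>\<^sub>L \<gamma> T v p = - (b (v p) * D_t T v p) + (D_xi_xi T v p + D_xi T v p)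
     + \<delta> * (b (v p) * D_xi T v p) + \<delta> * (b (v p) * v p)" for v p
  proof -
    have "b (v p) * L_op \<delta> \<sigma>\<^sub>H \<sigma>\<^sub>L \<gamma> T v p = - (b (v p) * D_t T v p)
      + (b (v p) * (1 / 2 * (sigma \<sigma>\<^sub>H \<sigma>\<^sub>L \<gamma> (v p))\<^sup>2)) * (D_xi_xi T v p + D_xi T v p)
      + \<delta> * (b (v p) * D_xi T v p) + \<delta> * (b (v p) * v p)"
      unfolding L_op_def by (simp add: algebra_simps)
    then show ?thesis unfolding b_sigma by simp
  qed
  have "AE p in lebesgue. p \<in> UNIV \<times> {0<..T} \<longrightarrow> min (L_op \<delta> \<sigma>\<^sub>H \<sigma>\<^sub>L \<gamma> T v1 p) (1 - v1 p) = 0"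
    "AE p in lebesgue. p \<in> UNIV \<times> {0<..T} \<longrightarrow> min (L_op \<delta> \<sigma>\<^sub>H \<sigma>\<^sub>L \<gamma> T v2 p) (1 - v2 p) = 0"
    using v1 v2 unfolding admissible_def is_solution_def by blast+
  then show ?thesis
  proof (eventually_elim, intro impI)
    fix p assume 1: "p \<in> UNIV \<times> {0<..T} \<longrightarrow> min (L_op \<delta> \<sigma>\<^sub>H \<sigma>\<^sub>L \<gamma> T v1 p) (1 - v1 p) = 0"
      and 2: "p \<in> UNIV \<times> {0<..T} \<longrightarrow> min (L_op \<delta> \<sigma>\<^sub>H \<sigma>\<^sub>L \<gamma> T v2 p) (1 - v2 p) = 0"
      and p: "p \<in> UNIV \<times> {0<..T}" and lt: "v2 p < v1 p"
    have "L_op \<delta> \<sigma>\<^sub>H \<sigma>\<^sub>L \<gamma> T v1 p \<ge> 0" "v1 p \<le> 1" using 1 p by (auto simp: min_def split: if_splits)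
    then have 3: "b (v1 p) * L_op \<delta> \<sigma>\<^sub>H \<sigma>\<^sub>L \<gamma> T v1 p \<ge> 0" using b_pos(1)[of "v1 p"] by simp
    have "L_op \<delta> \<sigma>\<^sub>H \<sigma>\<^sub>L \<gamma> T v2 p = 0" using 2 p lt \<open>v1 p \<le> 1\<close> by (auto simp: min_def split: if_splits)
    then have 4: "b (v2 p) * L_op \<delta> \<sigma>\<^sub>H \<sigma>\<^sub>L \<gamma> T v2 p = 0" by simp
    show "b (v1 p) * D_t T v1 p - b (v2 p) * D_t T v2 p \<le>
      D_xi_xi T v1 p - D_xi_xi T v2 p + (D_xi T v1 p - D_xi T v2 p)
      + \<delta> * (b (v1 p) * D_xi T v1 p - b (v2 p) * D_xi T v2 p) + \<delta> * (b (v1 p) * v1 p - b (v2 p) * v2 p)"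
      using 3 4 unfolding L right_diff_distrib[of \<delta>] by linarith
  qed
qed

definition excess :: "(real \<times> real \<Rightarrow> real) \<Rightarrow> (real \<times> real \<Rightarrow> real) \<Rightarrow> real \<times> real \<Rightarrow> real" where
  "excess v1 v2 p = max 0 (\<beta> (v1 p) - \<beta> (v2 p))"

definition energy :: "real \<Rightarrow> real \<Rightarrow> (real \<times> real \<Rightarrow> real) \<Rightarrow> (real \<times> real \<Rightarrow> real) \<Rightarrow> real \<Rightarrow> real" where
  "energy A L v1 v2 t = integral {A..L} (\<lambda>x. exp (-x) * excess v1 v2 (x, t))"

lemma continuous_on_excess:
  assumes "continuous_on S v1" "continuous_on S v2"
  shows "continuous_on S (excess v1 v2)"
  unfolding excess_def[abs_def]
  by (intro continuous_intros continuous_on_compose2[OF continuous_on_beta[of UNIV]] assms) auto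

lemma admissible_continuous:
  assumes "admissible v" shows "continuous_on (UNIV \<times> {0<..T}) v"
proof -
  have "continuous_on (strip T - {(0, 0)}) v" using assms unfolding admissible_def is_solution_def by blast
  then show ?thesis by (rule continuous_on_subset) (auto simp: strip_def)
qed

lemma energy_continuous:
  assumes v1: "admissible v1" and v2: "admissible v2" and s: "0 < s" "t \<le> T"
  shows "continuous_on {s..t} (energy A L v1 v2)"
proof -
  have e: "continuous_on (UNIV \<times> {0<..T}) (excess v1 v2)"
    by (intro continuous_on_excess admissible_continuous v1 v2)
  have "continuous_on ({s..t} \<times> cbox A L) (\<lambda>(\<tau>, x). exp (-x) * excess v1 v2 (x, \<tau>))"
    unfolding case_prod_beta
    by (intro continuous_intros continuous_on_compose2[OF e]) (use s in auto)
  from integral_continuous_on_param[OF this] show ?thesis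
    unfolding energy_def[abs_def] by simp
qed

text \<open>Both sides are compared with the double integral of \<open>\<Phi>\<close>. Integrating
  in time first gives the energy difference exactly; integrating in space first and applying the
  differential inequality and the slice inequality gives the upper bound. The bounds
  \<open>M1\<close> and \<open>M2\<close> on the time derivatives justify Fubini and do not enter
  the result.\<close>

lemma energy_inequality:
  assumes v1: "admissible v1" and v2: "admissible v2"
    and N: "N \<ge> 0" "AE p in lebesgue. p \<in> UNIV \<times> {0<..<T} \<longrightarrow> \<bar>D_xi T v1 p\<bar> \<le> N"
       "AE p in lebesgue. p \<in> UNIV \<times> {0<..<T} \<longrightarrow> \<bar>D_xi T v2 p\<bar> \<le> N"
    and K: "\<And>p. p \<in> strip T \<Longrightarrow> excess v1 v2 p \<le> K"
    and st: "0 < s" "s < t" "t < T" and AL: "A < L" and A: "\<And>t. t \<in> {0..T} \<Longrightarrow> v1 (A, t) = v2 (A, t)"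
  shows "energy A L v1 v2 t - energy A L v1 v2 s \<le>
    integral {s..t} (\<lambda>\<tau>. exp (-L) * (2 * N + 2 / bL * K + \<delta> * K) + (2 / bL + \<delta> + \<delta> * bH / bL) * energy A L v1 v2 \<tau>)"
proof -
  let ?R = "{A..L} \<times> {s..t}"
  have W: "v1 \<in> (\<Inter>\<rho>\<in>{0<..}. W21_inf (strip T - closure (Q \<rho>))) \<inter> W10_inf (strip T)"
    "v2 \<in> (\<Inter>\<rho>\<in>{0<..}. W21_inf (strip T - closure (Q \<rho>))) \<inter> W10_inf (strip T)"
    "continuous_on (strip T - {(0, 0)}) v1" "continuous_on (strip T - {(0, 0)}) v2"
    using v1 v2 unfolding admissible_def is_solution_def by blast+
  obtain p1 q1 r1 M1 where 1: "r1 \<in> borel_measurable borel" "\<And>z. \<bar>r1 z\<bar> \<le> M1"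
    "AE z in lborel. z \<in> ?R \<longrightarrow> p1 z = D_xi T v1 z \<and> q1 z = D_xi_xi T v1 z \<and> r1 z = D_t T v1 z"
    "AE x in lborel. x \<in> {A<..<L} \<longrightarrow> primitive_on s t (\<lambda>\<tau>. v1 (x, \<tau>)) (\<lambda>\<tau>. r1 (x, \<tau>))"
    "AE \<tau> in lborel. \<tau> \<in> {s<..<t} \<longrightarrow> (\<exists>p'. (AE x in lborel. x \<in> {A<..<L} \<longrightarrow> p1 (x, \<tau>) = p' x) \<and>
        (\<forall>x\<in>{A..L}. \<bar>p' x\<bar> \<le> N) \<and> primitive_on A L (\<lambda>x. v1 (x, \<tau>)) p' \<and> primitive_on A L p' (\<lambda>x. q1 (x, \<tau>)))"
  proof (rule rectangle_regularity[OF W(1,3) N(2,1) st AL], goal_cases)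
    case (1 p q r M)
    show ?case by (rule that[OF 1(4,7,8,9,10)])
  qed
  obtain p2 q2 r2 M2 where 2: "r2 \<in> borel_measurable borel" "\<And>z. \<bar>r2 z\<bar> \<le> M2"
    "AE z in lborel. z \<in> ?R \<longrightarrow> p2 z = D_xi T v2 z \<and> q2 z = D_xi_xi T v2 z \<and> r2 z = D_t T v2 z"
    "AE x in lborel. x \<in> {A<..<L} \<longrightarrow> primitive_on s t (\<lambda>\<tau>. v2 (x, \<tau>)) (\<lambda>\<tau>. r2 (x, \<tau>))"
    "AE \<tau> in lborel. \<tau> \<in> {s<..<t} \<longrightarrow> (\<exists>p'. (AE x in lborel. x \<in> {A<..<L} \<longrightarrow> p2 (x, \<tau>) = p' x) \<and>
        (\<forall>x\<in>{A..L}. \<bar>p' x\<bar> \<le> N) \<and> primitive_on A L (\<lambda>x. v2 (x, \<tau>)) p' \<and> primitive_on A L p' (\<lambda>x. q2 (x, \<tau>)))"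
  proof (rule rectangle_regularity[OF W(2,4) N(3,1) st AL], goal_cases)
    case (1 p q r M)
    show ?case by (rule that[OF 1(4,7,8,9,10)])
  qed
  define w where "w = (\<lambda>z. v1 z - v2 z)"
  have cR: "compact ?R" by (intro compact_Times compact_Icc)
  have RS: "?R \<subseteq> UNIV \<times> {0<..T}" using st by auto
  have vR: "continuous_on ?R v1" "continuous_on ?R v2"
    by (rule continuous_on_subset[OF admissible_continuous RS], fact)+
  \<comment> \<open>The weighted time derivative of the excess, cut off to the rectangle.\<close>
  define \<Phi> where "\<Phi> = (\<lambda>z. indicator ?R z * (exp (- fst z) * (of_bool (w z > 0) * (b (v1 z) * r1 z - b (v2 z) * r2 z))))"
  have \<Phi>m: "\<Phi> \<in> borel_measurable borel"
  proof -
    \<comment> \<open>Measurability is proved with cut-off copies of the solutions, which are Borel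
      on the plane; inside the rectangle nothing changes, and outside both expressions
      vanish.\<close>
    define i1 where "i1 = (\<lambda>z. indicator ?R z *\<^sub>R v1 z)"
    define i2 where "i2 = (\<lambda>z. indicator ?R z *\<^sub>R v2 z)"
    have [measurable]: "i1 \<in> borel_measurable borel" "i2 \<in> borel_measurable borel"
      unfolding i1_def i2_def by (rule borel_measurable_continuous_on_indicator[OF borel_compact[OF cR]], fact)+
    have [measurable]: "r1 \<in> borel_measurable borel" "r2 \<in> borel_measurable borel" by fact+
    have [measurable]: "?R \<in> sets borel" by (rule borel_compact[OF cR])
    have [measurable]: "b \<in> borel_measurable borel" unfolding bcoef_def[abs_def] by measurable
    have [measurable]: "(\<lambda>z::real\<times>real. exp (- fst z)) \<in> borel_measurable borel"
      by (intro borel_measurable_continuous_onI continuous_intros)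
    have "(\<lambda>z. indicator ?R z * (exp (- fst z) * (of_bool (i2 z < i1 z) * (b (i1 z) * r1 z - b (i2 z) * r2 z)))) \<in> borel_measurable borel"
      by measurable
    moreover have "indicator ?R z * (exp (- fst z) * (of_bool (i2 z < i1 z) * (b (i1 z) * r1 z - b (i2 z) * r2 z))) = \<Phi> z" for z
      unfolding \<Phi>_def i1_def i2_def w_def by (cases "z \<in> ?R") auto
    ultimately show ?thesis by (simp only: fun_eq_iff cong: measurable_cong)
  qed
  define B where "B = exp (- A) * (bH * M1 + bH * M2)"
  have M0: "M1 \<ge> 0" "M2 \<ge> 0" "bH \<ge> 0" using 1(2)[of undefined] 2(2)[of undefined] bL_pos bH_gt by linarith+
  have \<Phi>b: "\<bar>\<Phi> z\<bar> \<le> B" for z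
  proof (cases "z \<in> ?R")
    case True
    have "\<bar>b (v1 z) * r1 z\<bar> \<le> bH * M1" "\<bar>b (v2 z) * r2 z\<bar> \<le> bH * M2"
      unfolding abs_mult by (intro mult_mono b_pos(2) 1(2) 2(2) M0 abs_ge_zero)+
    then have "\<bar>b (v1 z) * r1 z - b (v2 z) * r2 z\<bar> \<le> bH * M1 + bH * M2" by linarith
    then have "\<bar>of_bool (w z > 0) * (b (v1 z) * r1 z - b (v2 z) * r2 z)\<bar> \<le> bH * M1 + bH * M2" by auto
    moreover have "\<bar>exp (- fst z)\<bar> \<le> exp (- A)" using True by auto
    ultimately have "\<bar>exp (- fst z)\<bar> * \<bar>of_bool (w z > 0) * (b (v1 z) * r1 z - b (v2 z) * r2 z)\<bar> \<le> B"
      unfolding B_def by (intro mult_mono) auto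
    then show ?thesis unfolding \<Phi>_def using True by (simp add: abs_mult)
  next
    case False
    then show ?thesis unfolding \<Phi>_def B_def using M0 by simp
  qed
  have \<Phi>z: "\<Phi> z = 0" if "z \<notin> ?R" for z using that unfolding \<Phi>_def by simp
  note it = has_integral_iterated[OF \<Phi>m \<Phi>b \<Phi>z]
  have ec: "continuous_on {A..L} (\<lambda>x. exp (-x) * excess v1 v2 (x, \<tau>))" if "\<tau> \<in> {s..t}" for \<tau>
    by (intro continuous_intros continuous_on_compose2[OF continuous_on_excess[OF vR]]) (use that in auto)
  have eI: "((\<lambda>x. exp (-x) * excess v1 v2 (x, \<tau>)) has_integral energy A L v1 v2 \<tau>) {A..L}" if "\<tau> \<in> {s..t}" for \<tau>
    unfolding energy_def by (intro integrable_integral integrable_continuous_real ec that)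
  have "energy A L v1 v2 t - energy A L v1 v2 s \<le> (LINT z|lborel. \<Phi> z)"
  proof (rule has_integral_le_AE[OF has_integral_diff[OF eI eI] it(1)])
    show "AE x in lborel. x \<in> {A<..<L} \<longrightarrow>
        exp (- x) * excess v1 v2 (x, t) - exp (- x) * excess v1 v2 (x, s) \<le> (LINT y|lborel. \<Phi> (x, y))"
      using 1(4) 2(4)
    proof eventually_elim
      case (elim x)
      show ?case
      proof
        assume x: "x \<in> {A<..<L}"
        \<comment> \<open>For almost every \<open>x\<close> the chain rule in time applies to
          \<open>\<beta>\<close> and to the positive part. After multiplication by the weight, the
          density is the restriction of \<open>\<Phi>\<close> to this line.\<close>
        have pr: "primitive_on s t (\<lambda>\<tau>. excess v1 v2 (x, \<tau>))
           (\<lambda>\<tau>. of_bool (\<beta> (v1 (x, \<tau>)) - \<beta> (v2 (x, \<tau>)) > 0) * (b (v1 (x, \<tau>)) * r1 (x, \<tau>) - b (v2 (x, \<tau>)) * r2 (x, \<tau>)))"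
          unfolding excess_def using elim x
          by (intro primitive_on_pos_part primitive_on_diff primitive_on_beta) auto
        have "((\<lambda>\<tau>. exp (-x) * (of_bool (\<beta> (v1 (x, \<tau>)) - \<beta> (v2 (x, \<tau>)) > 0) * (b (v1 (x, \<tau>)) * r1 (x, \<tau>) - b (v2 (x, \<tau>)) * r2 (x, \<tau>))))
           has_integral exp (-x) * excess v1 v2 (x, t) - exp (-x) * excess v1 v2 (x, s)) {s..t}"
          by (rule primitive_onD[OF primitive_on_cmult[OF pr]]) (use st in auto)
        then have "((\<lambda>\<tau>. \<Phi> (x, \<tau>)) has_integral exp (-x) * excess v1 v2 (x, t) - exp (-x) * excess v1 v2 (x, s)) {s..t}"
          by (rule has_integral_eq[rotated])
            (use x in \<open>auto simp: \<Phi>_def w_def beta_less_iff[OF bL_pos bH_gt]\<close>)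
        from has_integral_unique[OF this it(4)]
        show "exp (- x) * excess v1 v2 (x, t) - exp (- x) * excess v1 v2 (x, s) \<le> (LINT y|lborel. \<Phi> (x, y))" by simp
      qed
    qed
  qed (use st in auto)
  also have "\<dots> \<le> integral {s..t} (\<lambda>\<tau>. exp (-L) * (2 * N + 2 / bL * K + \<delta> * K) + (2 / bL + \<delta> + \<delta> * bH / bL) * energy A L v1 v2 \<tau>)"
  proof (rule has_integral_le_AE[OF it(2) integrable_integral])
    show "(\<lambda>\<tau>. exp (-L) * (2 * N + 2 / bL * K + \<delta> * K) + (2 / bL + \<delta> + \<delta> * bH / bL) * energy A L v1 v2 \<tau>) integrable_on {s..t}"
      by (intro integrable_continuous_real continuous_intros energy_continuous v1 v2) (use st in auto)
    \<comment> \<open>Where the difference is positive this is the differential inequality with its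
      zeroth-order term bounded by the one-sided Lipschitz estimate; elsewhere the left side is zero
      and the right side nonnegative.\<close>
    have "AE z in lborel. z \<in> ?R \<longrightarrow> \<Phi> z \<le> exp (- fst z) * (of_bool (w z > 0) * (q1 z - q2 z + (p1 z - p2 z)
       + \<delta> * (b (v1 z) * p1 z - b (v2 z) * p2 z))) + \<delta> * bH / bL * (exp (- fst z) * excess v1 v2 z)"
      using differential_inequality[OF v1 v2, THEN AE_lebesgue_lborel] 1(3) 2(3)
    proof (eventually_elim, intro impI)
      fix z assume di: "z \<in> UNIV \<times> {0<..T} \<longrightarrow> v2 z < v1 z \<longrightarrow>
          b (v1 z) * D_t T v1 z - b (v2 z) * D_t T v2 z \<le>
          D_xi_xi T v1 z - D_xi_xi T v2 z + (D_xi T v1 z - D_xi T v2 z)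
          + \<delta> * (b (v1 z) * D_xi T v1 z - b (v2 z) * D_xi T v2 z) + \<delta> * (b (v1 z) * v1 z - b (v2 z) * v2 z)"
        and e1: "z \<in> ?R \<longrightarrow> p1 z = D_xi T v1 z \<and> q1 z = D_xi_xi T v1 z \<and> r1 z = D_t T v1 z"
        and e2: "z \<in> ?R \<longrightarrow> p2 z = D_xi T v2 z \<and> q2 z = D_xi_xi T v2 z \<and> r2 z = D_t T v2 z"
        and z: "z \<in> ?R"
      define X where "X = q1 z - q2 z + (p1 z - p2 z) + \<delta> * (b (v1 z) * p1 z - b (v2 z) * p2 z)"
      show "\<Phi> z \<le> exp (- fst z) * (of_bool (w z > 0) * (q1 z - q2 z + (p1 z - p2 z)
       + \<delta> * (b (v1 z) * p1 z - b (v2 z) * p2 z))) + \<delta> * bH / bL * (exp (- fst z) * excess v1 v2 z)"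
      proof (cases "v2 z < v1 z")
        case True
        have d: "b (v1 z) * r1 z - b (v2 z) * r2 z \<le> X + \<delta> * (b (v1 z) * v1 z - b (v2 z) * v2 z)"
          using di e1 e2 z True RS unfolding X_def by auto
        have "b (v1 z) * v1 z - b (v2 z) * v2 z \<le> bH / bL * excess v1 v2 z"
        proof -
          have "b (v1 z) * v1 z - b (v2 z) * v2 z \<le> bH / bL * (\<beta> (v1 z) - \<beta> (v2 z))"
            by (rule bcoef_mult_one_sided_Lipschitz[OF bL_pos bH_gt gamma True])
          also have "\<dots> \<le> bH / bL * excess v1 v2 z"
            unfolding excess_def using bL_pos bH_gt by (intro mult_left_mono) auto
          finally show ?thesis .
        qed
        then have "\<delta> * (b (v1 z) * v1 z - b (v2 z) * v2 z) \<le> \<delta> * (bH / bL * excess v1 v2 z)"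
          using delta by (intro mult_left_mono) auto
        with d have "b (v1 z) * r1 z - b (v2 z) * r2 z \<le> X + \<delta> * (bH / bL * excess v1 v2 z)" by linarith
        then have "exp (- fst z) * (b (v1 z) * r1 z - b (v2 z) * r2 z) \<le> exp (- fst z) * (X + \<delta> * (bH / bL * excess v1 v2 z))"
          by (intro mult_left_mono) auto
        also have "\<dots> = exp (- fst z) * X + \<delta> * bH / bL * (exp (- fst z) * excess v1 v2 z)" by (simp add: algebra_simps)
        finally show ?thesis unfolding \<Phi>_def X_def[symmetric] using True z by (simp add: w_def)
      next
        case False
        have "\<delta> * bH / bL * (exp (- fst z) * excess v1 v2 z) \<ge> 0"
          unfolding excess_def using delta bL_pos bH_gt by (intro mult_nonneg_nonneg divide_nonneg_nonneg) auto
        then show ?thesis unfolding \<Phi>_def using False by (simp add: w_def)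
      qed
    qed
    from AE_slice_swap[OF this] 1(5) 2(5)
    show "AE \<tau> in lborel. \<tau> \<in> {s<..<t} \<longrightarrow> (LINT x|lborel. \<Phi> (x, \<tau>)) \<le>
        exp (-L) * (2 * N + 2 / bL * K + \<delta> * K) + (2 / bL + \<delta> + \<delta> * bH / bL) * energy A L v1 v2 \<tau>"
    proof (eventually_elim, intro impI)
      fix \<tau> assume ae: "AE x in lborel. (x, \<tau>) \<in> ?R \<longrightarrow> \<Phi> (x, \<tau>) \<le> exp (- fst (x, \<tau>)) * (of_bool (w (x, \<tau>) > 0) * (q1 (x, \<tau>) - q2 (x, \<tau>) + (p1 (x, \<tau>) - p2 (x, \<tau>))
           + \<delta> * (b (v1 (x, \<tau>)) * p1 (x, \<tau>) - b (v2 (x, \<tau>)) * p2 (x, \<tau>)))) + \<delta> * bH / bL * (exp (- fst (x, \<tau>)) * excess v1 v2 (x, \<tau>))"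
        and e1: "\<tau> \<in> {s<..<t} \<longrightarrow> (\<exists>p'. (AE x in lborel. x \<in> {A<..<L} \<longrightarrow> p1 (x, \<tau>) = p' x) \<and>
            (\<forall>x\<in>{A..L}. \<bar>p' x\<bar> \<le> N) \<and> primitive_on A L (\<lambda>x. v1 (x, \<tau>)) p' \<and> primitive_on A L p' (\<lambda>x. q1 (x, \<tau>)))"
        and e2: "\<tau> \<in> {s<..<t} \<longrightarrow> (\<exists>p'. (AE x in lborel. x \<in> {A<..<L} \<longrightarrow> p2 (x, \<tau>) = p' x) \<and>
            (\<forall>x\<in>{A..L}. \<bar>p' x\<bar> \<le> N) \<and> primitive_on A L (\<lambda>x. v2 (x, \<tau>)) p' \<and> primitive_on A L p' (\<lambda>x. q2 (x, \<tau>)))"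
        and \<tau>: "\<tau> \<in> {s<..<t}"
      \<comment> \<open>The continuous versions \<open>P1\<close> and \<open>P2\<close> take the
        place of \<open>p1\<close> and \<open>p2\<close> on this slice, so that the flux at
        \<open>L\<close> is defined and bounded by \<open>N\<close>.\<close>
      obtain P1 where P1: "AE x in lborel. x \<in> {A<..<L} \<longrightarrow> p1 (x, \<tau>) = P1 x" "\<forall>x\<in>{A..L}. \<bar>P1 x\<bar> \<le> N"
        "primitive_on A L (\<lambda>x. v1 (x, \<tau>)) P1" "primitive_on A L P1 (\<lambda>x. q1 (x, \<tau>))" using e1 \<tau> by blast
      obtain P2 where P2: "AE x in lborel. x \<in> {A<..<L} \<longrightarrow> p2 (x, \<tau>) = P2 x" "\<forall>x\<in>{A..L}. \<bar>P2 x\<bar> \<le> N"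
        "primitive_on A L (\<lambda>x. v2 (x, \<tau>)) P2" "primitive_on A L P2 (\<lambda>x. q2 (x, \<tau>))" using e2 \<tau> by blast
      have "excess v1 v2 (L, \<tau>) \<le> K" by (rule K) (use \<tau> st in \<open>auto simp: strip_def\<close>)
      then have zL: "max 0 (\<beta> (v1 (L, \<tau>)) - \<beta> (v2 (L, \<tau>))) \<le> K" unfolding excess_def .
      have vA: "v1 (A, \<tau>) = v2 (A, \<tau>)" by (rule A) (use \<tau> st in auto)
      have PL: "\<bar>P1 L\<bar> \<le> N" "\<bar>P2 L\<bar> \<le> N" using P1(2) P2(2) AL by auto
      obtain I where I: "((\<lambda>x. exp (-x) * (of_bool (v1 (x, \<tau>) - v2 (x, \<tau>) > 0) * (q1 (x, \<tau>) - q2 (x, \<tau>) + (P1 x - P2 x)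
           + \<delta> * (b (v1 (x, \<tau>)) * P1 x - b (v2 (x, \<tau>)) * P2 x)))
         + \<delta> * bH / bL * (exp (-x) * max 0 (\<beta> (v1 (x, \<tau>)) - \<beta> (v2 (x, \<tau>))))) has_integral I) {A..L}"
        "I \<le> exp (-L) * (2 * N + 2 / bL * K + \<delta> * K) + (2 / bL + \<delta> + \<delta> * bH / bL)
           * integral {A..L} (\<lambda>x. exp (-x) * max 0 (\<beta> (v1 (x, \<tau>)) - \<beta> (v2 (x, \<tau>))))"
        using slice_inequality[OF P1(3,4) P2(3,4) less_imp_le[OF AL] vA bL_pos bH_gt delta gamma PL zL] by blast
      have "(LINT x|lborel. \<Phi> (x, \<tau>)) \<le> I"
      proof (rule has_integral_le_AE[OF it(3) I(1)])
        show "AE x in lborel. x \<in> {A<..<L} \<longrightarrow> \<Phi> (x, \<tau>) \<le>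
           exp (-x) * (of_bool (v1 (x, \<tau>) - v2 (x, \<tau>) > 0) * (q1 (x, \<tau>) - q2 (x, \<tau>) + (P1 x - P2 x)
           + \<delta> * (b (v1 (x, \<tau>)) * P1 x - b (v2 (x, \<tau>)) * P2 x)))
         + \<delta> * bH / bL * (exp (-x) * max 0 (\<beta> (v1 (x, \<tau>)) - \<beta> (v2 (x, \<tau>))))"
          using ae P1(1) P2(1)
        proof eventually_elim
          case (elim x)
          then show ?case using \<tau> unfolding w_def excess_def by auto
        qed
      qed
      also note I(2)
      finally show "(LINT x|lborel. \<Phi> (x, \<tau>)) \<le>
        exp (-L) * (2 * N + 2 / bL * K + \<delta> * K) + (2 / bL + \<delta> + \<delta> * bH / bL) * energy A L v1 v2 \<tau>"
        unfolding energy_def excess_def .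
    qed
  qed
  finally show ?thesis .
qed

end

section \<open>Uniqueness\<close>

context credit_rating
begin

lemma excess_nonneg: "excess v1 v2 p \<ge> 0"
  unfolding excess_def by simp

lemma energy_nonneg: "energy A L v1 v2 t \<ge> 0"
proof (cases "(\<lambda>x. exp (-x) * excess v1 v2 (x, t)) integrable_on {A..L}")
  case True
  then show ?thesis unfolding energy_def
    by (rule integral_nonneg) (intro mult_nonneg_nonneg excess_nonneg exp_ge_zero)
qed (simp add: energy_def not_integrable_integral)

text \<open>Equal initial values and continuity make the excess tend to zero on every line with
  \<open>x \<noteq> 0\<close>; the origin, where continuity is not assumed, affects a single point
  of the interval. The bound \<open>exp (-A) * K\<close> permits dominated convergence.\<close>

lemma energy_initial:
  assumes v1: "admissible v1" and v2: "admissible v2" and t: "0 < t" "t < T"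
    and K: "\<And>p. p \<in> strip T \<Longrightarrow> excess v1 v2 p \<le> K"
  shows "(\<lambda>n. energy A L v1 v2 (t / real (n + 2))) \<longlonglongrightarrow> 0"
proof -
  define s where "s = (\<lambda>n. t / real (n + 2))"
  have s: "0 < s n" "s n < T" for n
  proof -
    show "0 < s n" unfolding s_def using t by simp
    have "t * 1 \<le> t * real (n + 2)" using t by (intro mult_left_mono) auto
    then have "s n \<le> t" unfolding s_def by (simp add: divide_le_eq)
    then show "s n < T" using t by simp
  qed
  have sl: "s \<longlonglongrightarrow> 0"
    unfolding s_def using LIMSEQ_ignore_initial_segment[OF lim_const_over_n[of t], of 2] by simp
  have ex: "continuous_on (strip T - {(0, 0)}) (excess v1 v2)"
    by (rule continuous_on_excess) (use v1 v2 in \<open>auto simp: admissible_def is_solution_def\<close>)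
  \<comment> \<open>Redefining the value at \<open>x = 0\<close> leaves the integrals unchanged and
    gives convergence at every point.\<close>
  define f where "f = (\<lambda>n x. if x = 0 then 0 else exp (-x) * excess v1 v2 (x, s n))"
  have ec: "continuous_on (UNIV \<times> {0<..T}) (excess v1 v2)"
    by (intro continuous_on_excess admissible_continuous v1 v2)
  have int: "(\<lambda>x. exp (-x) * excess v1 v2 (x, s n)) integrable_on {A..L}" for n
    by (intro integrable_continuous_real continuous_intros continuous_on_compose2[OF ec])
      (use s[of n] in auto)
  have fi: "f n integrable_on {A..L}" for n
    by (rule integrable_spike[OF int[of n], of "{0}"]) (auto simp: f_def)
  have fe: "integral {A..L} (f n) = energy A L v1 v2 (s n)" for n
    unfolding energy_def by (rule integral_spike[of "{0}"]) (auto simp: f_def)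
  have nb: "norm (f n x) \<le> exp (-A) * K" if "x \<in> {A..L}" for n x
  proof -
    have "excess v1 v2 (x, s n) \<le> K" by (rule K) (use s[of n] in \<open>auto simp: strip_def less_imp_le\<close>)
    then have "exp (-x) * excess v1 v2 (x, s n) \<le> exp (-A) * K"
      using that by (intro mult_mono excess_nonneg) auto
    moreover have "0 \<le> exp (-x) * excess v1 v2 (x, s n)" by (intro mult_nonneg_nonneg excess_nonneg) auto
    ultimately show ?thesis unfolding f_def by auto
  qed
  have lim: "(\<lambda>n. f n x) \<longlonglongrightarrow> 0" for x
  proof (cases "x = 0")
    case False
    have "(\<lambda>n. excess v1 v2 (x, s n)) \<longlonglongrightarrow> excess v1 v2 (x, 0)"
      by (rule continuous_on_tendsto_compose[OF ex])
        (use False T s in \<open>auto intro!: tendsto_intros sl simp: strip_def less_imp_le\<close>)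
    moreover have "excess v1 v2 (x, 0) = 0"
      using v1 v2 unfolding admissible_def is_solution_def excess_def by simp
    ultimately have "(\<lambda>n. exp (-x) * excess v1 v2 (x, s n)) \<longlonglongrightarrow> exp (-x) * 0"
      by (intro tendsto_mult tendsto_const) simp
    then show ?thesis using False unfolding f_def by simp
  qed (simp add: f_def)
  have "(\<lambda>_. exp (-A) * K) integrable_on {A..L}" by auto
  note dc = dominated_convergence[of f "{A..L}" "\<lambda>_. exp (-A) * K" "\<lambda>_. 0", OF fi this nb lim]
  have "(\<lambda>n. integral {A..L} (f n)) \<longlonglongrightarrow> integral {A..L} (\<lambda>_. 0)" by (rule dc(2))
  then show ?thesis unfolding fe s_def by simp
qed

text \<open>Gronwall is applied from a positive time \<open>s\<close>, and \<open>s\<close> tends to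
  0 with constants that do not depend on it. The energy on a fixed interval is at most that on a
  longer one, whose bound carries the factor \<open>exp (-L)\<close>; hence it vanishes. A
  continuous nonnegative integrand with zero integral is zero at every point.\<close>

lemma comparison_right:
  assumes v1: "admissible v1" and v2: "admissible v2" and t: "0 < t" "t < T"
    and A: "\<And>t. t \<in> {0..T} \<Longrightarrow> v1 (A, t) = v2 (A, t)" and x: "A \<le> x"
  shows "v1 (x, t) \<le> v2 (x, t)"
proof -
  obtain N1 where N1: "N1 \<ge> 0" "AE p in lebesgue. p \<in> UNIV \<times> {0<..<T} \<longrightarrow> \<bar>D_xi T v1 p\<bar> \<le> N1"
    "\<And>p. p \<in> strip T \<Longrightarrow> \<bar>v1 p\<bar> \<le> N1" using admissible_bounds[OF v1] by blast
  obtain N2 where N2: "N2 \<ge> 0" "AE p in lebesgue. p \<in> UNIV \<times> {0<..<T} \<longrightarrow> \<bar>D_xi T v2 p\<bar> \<le> N2"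
    "\<And>p. p \<in> strip T \<Longrightarrow> \<bar>v2 p\<bar> \<le> N2" using admissible_bounds[OF v2] by blast
  define N where "N = max N1 N2"
  have N: "N \<ge> 0" unfolding N_def using N1(1) by simp
  have NA: "AE p in lebesgue. p \<in> UNIV \<times> {0<..<T} \<longrightarrow> \<bar>D_xi T v1 p\<bar> \<le> N"
    "AE p in lebesgue. p \<in> UNIV \<times> {0<..<T} \<longrightarrow> \<bar>D_xi T v2 p\<bar> \<le> N"
    using N1(2) N2(2) unfolding N_def by (eventually_elim, force)+
  \<comment> \<open>Twice the bound of \<open>\<beta>\<close> on values of modulus at most
    \<open>N\<close>.\<close>
  define K where "K = 2 * (bL * N + (bH - bL) * (\<bar>\<gamma>\<bar> + N))"
  have K0: "K \<ge> 0" unfolding K_def using bL_pos bH_gt N by simp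
  have K: "excess v1 v2 p \<le> K" if "p \<in> strip T" for p
  proof -
    have "\<bar>v1 p\<bar> \<le> N" "\<bar>v2 p\<bar> \<le> N" using N1(3)[OF that] N2(3)[OF that] unfolding N_def by auto
    from this[THEN beta_bounded[OF bL_pos bH_gt, of _ _ \<gamma>]]
    show ?thesis using K0 unfolding excess_def K_def by auto
  qed
  define c where "c = 2 * N + 2 / bL * K + \<delta> * K"
  define C where "C = 2 / bL + \<delta> + \<delta> * bH / bL"
  have c0: "c \<ge> 0" unfolding c_def using N K0 bL_pos delta by simp
  have C0: "C > 0" unfolding C_def using bL_pos bH_gt delta by (intro add_pos_nonneg) auto
  have step: "energy A L v1 v2 t \<le> exp (-L) * c / C * exp (C * T)" if L: "A < L" for L
  proof -
    define k where "k = exp (-L) * c"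
    have k0: "k \<ge> 0" unfolding k_def using c0 by simp
    have s: "energy A L v1 v2 t \<le> (energy A L v1 v2 s + k / C) * exp (C * T)" if s: "0 < s" "s < t" for s
    proof -
      \<comment> \<open>The shift by \<open>k / C\<close> absorbs the constant source:
        \<open>k + C * energy\<close> equals \<open>C * f\<close>.\<close>
      define f where "f = (\<lambda>\<tau>. energy A L v1 v2 \<tau> + k / C)"
      have fc: "continuous_on {s..t} f" unfolding f_def
        by (intro continuous_intros energy_continuous v1 v2) (use s t in auto)
      have "f t \<le> f s * exp (C * (t - s))"
      proof (rule gronwall[OF fc])
        show "s \<le> t" "0 \<le> C" using s C0 by auto
        fix \<tau> assume \<tau>: "\<tau> \<in> {s..t}"
        show "f \<tau> \<le> f s + C * integral {s..\<tau>} f"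
        proof (cases "s = \<tau>")
          case False
          then have "s < \<tau>" "\<tau> < T" using \<tau> t by auto
          from energy_inequality[OF v1 v2 N NA K s(1) this L A]
          have "energy A L v1 v2 \<tau> - energy A L v1 v2 s \<le> integral {s..\<tau>} (\<lambda>\<tau>. k + C * energy A L v1 v2 \<tau>)"
            unfolding k_def c_def C_def .
          also have "(\<lambda>\<tau>. k + C * energy A L v1 v2 \<tau>) = (\<lambda>\<tau>. C * f \<tau>)"
            unfolding f_def using C0 by (auto simp: distrib_left)
          finally show ?thesis unfolding integral_mult_right f_def by simp
        qed simp
      qed
      also have "\<dots> \<le> f s * exp (C * T)"
        using s t C0 k0 energy_nonneg[of A L v1 v2 s] unfolding f_def by (intro mult_left_mono) auto
      finally have "f t \<le> f s * exp (C * T)" .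
      moreover have "k / C \<ge> 0" using k0 C0 by simp
      ultimately show ?thesis unfolding f_def by linarith
    qed
    have "(\<lambda>n. (energy A L v1 v2 (t / real (n + 2)) + k / C) * exp (C * T)) \<longlonglongrightarrow> (0 + k / C) * exp (C * T)"
      by (intro tendsto_intros energy_initial[OF v1 v2 t K])
    then have "energy A L v1 v2 t \<le> (0 + k / C) * exp (C * T)"
    proof (rule LIMSEQ_le_const, intro exI allI impI)
      fix n :: nat
      show "energy A L v1 v2 t \<le> (energy A L v1 v2 (t / real (n + 2)) + k / C) * exp (C * T)"
        by (rule s) (use t in \<open>auto simp: divide_less_eq\<close>)
    qed
    then show ?thesis unfolding k_def by simp
  qed
  \<comment> \<open>Any nondegenerate interval starting at \<open>A\<close> and containing
    \<open>x\<close> would do; it stays fixed while the longer intervals grow.\<close>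
  define L where "L = x + 1"
  have AL: "A < L" and xL: "x \<in> {A..L}" using x unfolding L_def by auto
  have ec: "continuous_on S (\<lambda>x. exp (-x) * excess v1 v2 (x, t))" for S
    by (intro continuous_intros continuous_on_compose2[OF continuous_on_excess[OF admissible_continuous[OF v1] admissible_continuous[OF v2]]])
      (use t in auto)
  have "energy A L v1 v2 t \<le> 0"
  proof (rule LIMSEQ_le_const)
    have "(\<lambda>n. exp (-1 :: real) ^ n) \<longlonglongrightarrow> 0" by (rule LIMSEQ_realpow_zero) auto
    then have "(\<lambda>n. exp (-1) ^ n * (exp (-L) * c / C * exp (C * T))) \<longlonglongrightarrow> 0 * (exp (-L) * c / C * exp (C * T))"
      by (rule tendsto_mult[OF _ tendsto_const])
    moreover have "exp (-1) ^ n * (exp (-L) * c / C * exp (C * T)) = exp (- (L + real n)) * c / C * exp (C * T)" for n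
    proof -
      have "exp (- (L + real n)) = exp (-1) ^ n * exp (-L)"
        by (simp flip: exp_of_nat_mult exp_add)
      then show ?thesis by simp
    qed
    ultimately show "(\<lambda>n. exp (- (L + real n)) * c / C * exp (C * T)) \<longlonglongrightarrow> 0"
      by (simp only: mult_zero_left)
    show "\<exists>N. \<forall>n\<ge>N. energy A L v1 v2 t \<le> exp (- (L + real n)) * c / C * exp (C * T)"
    proof (intro exI allI impI)
      fix n :: nat
      \<comment> \<open>The integrand is nonnegative, so enlarging the interval can only increase
        the integral.\<close>
      have "energy A L v1 v2 t \<le> energy A (L + real n) v1 v2 t"
        unfolding energy_def
        by (rule integral_subset_le) (auto intro!: integrable_continuous_real ec mult_nonneg_nonneg excess_nonneg)
      also have "\<dots> \<le> exp (- (L + real n)) * c / C * exp (C * T)" by (rule step) (use AL in auto)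
      finally show "energy A L v1 v2 t \<le> exp (- (L + real n)) * c / C * exp (C * T)" .
    qed
  qed
  then have "energy A L v1 v2 t = 0" using energy_nonneg[of A L v1 v2 t] by linarith
  then have "((\<lambda>x. exp (-x) * excess v1 v2 (x, t)) has_integral 0) (cbox A L)"
    using integrable_integral[OF integrable_continuous_real[OF ec, of A L]] unfolding energy_def by simp
  moreover have "box A L \<noteq> {}" "x \<in> cbox A L" using AL xL by auto
  ultimately have "exp (-x) * excess v1 v2 (x, t) = 0"
    using has_integral_0_cbox_imp_0[OF ec, of A L x] excess_nonneg[of v1 v2] by auto
  then have "excess v1 v2 (x, t) = 0" by simp
  then have "\<not> \<beta> (v2 (x, t)) < \<beta> (v1 (x, t))" unfolding excess_def by linarith
  then show ?thesis unfolding beta_less_iff[OF bL_pos bH_gt] by simp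
qed

text \<open>Comparison in both directions covers the times strictly between 0 and \<open>T\<close>,
  where the weak derivatives live. The initial time is covered by the initial condition, the final
  time by continuity.\<close>

lemma uniqueness:
  assumes v1: "admissible v1" and v2: "admissible v2"
    and B: "\<And>x t. t \<in> {0..T} \<Longrightarrow> x \<le> A \<Longrightarrow> v1 (x, t) = v2 (x, t)" and p: "p \<in> strip T"
  shows "v1 p = v2 p"
proof -
  obtain x t where pt: "p = (x, t)" by fastforce
  have t: "0 \<le> t" "t \<le> T" using p unfolding pt strip_def by auto
  have mid: "v1 (x, t) = v2 (x, t)" if "0 < t" "t < T" for t
  proof (cases "x \<le> A")
    case True then show ?thesis using B that by auto
  next
    case False
    have "v1 (x, t) \<le> v2 (x, t)" by (rule comparison_right[OF v1 v2 that, of A]) (use B False in auto)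
    moreover have "v2 (x, t) \<le> v1 (x, t)" by (rule comparison_right[OF v2 v1 that, of A]) (use B False in auto)
    ultimately show ?thesis by simp
  qed
  consider "t = 0" | "0 < t" "t < T" | "t = T" using t by linarith
  then show ?thesis unfolding pt
  proof cases
    case 1
    then show "v1 (x, t) = v2 (x, t)" using v1 v2 unfolding admissible_def is_solution_def by simp
  next
    case 2
    then show "v1 (x, t) = v2 (x, t)" by (rule mid)
  next
    case 3
    \<comment> \<open>With \<open>n + 2\<close> in the denominator every \<open>s n\<close> lies
      strictly between 0 and \<open>T\<close>.\<close>
    define s where "s = (\<lambda>n. T - T / real (n + 2))"
    have s: "0 < s n" "s n < T" for n
    proof -
      have "T * 1 < T * real (n + 2)" using T by (intro mult_strict_left_mono) auto
      then have "T / real (n + 2) < T" by (simp add: divide_less_eq)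
      then show "0 < s n" "s n < T" unfolding s_def using T by simp_all
    qed
    have "(\<lambda>n. T - T / real (n + 2)) \<longlonglongrightarrow> T - 0"
      by (intro tendsto_intros LIMSEQ_ignore_initial_segment[OF lim_const_over_n])
    then have sl: "s \<longlonglongrightarrow> T" unfolding s_def by simp
    have lim: "(\<lambda>n. v (x, s n)) \<longlonglongrightarrow> v (x, T)" if "admissible v" for v
      by (rule continuous_on_tendsto_compose[OF admissible_continuous[OF that]])
        (use T s in \<open>auto intro!: tendsto_intros sl simp: less_imp_le\<close>)
    have "(\<lambda>n. v1 (x, s n)) = (\<lambda>n. v2 (x, s n))" using mid s by blast
    then show "v1 (x, t) = v2 (x, t)" using lim[OF v1] lim[OF v2] LIMSEQ_unique 3 by metis
  qed
qed

end

theorem theorem5p2: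
  fixes \<delta> \<sigma>\<^sub>H \<sigma>\<^sub>L \<gamma> T :: real
    and v :: "nat \<Rightarrow> real \<times> real \<Rightarrow> real"
  assumes "\<delta> > 0"
    and "0 < \<sigma>\<^sub>H" and "\<sigma>\<^sub>H < \<sigma>\<^sub>L"
    and "1 / 2 * \<sigma>\<^sub>H\<^sup>2 < \<delta>" and "\<delta> < 1 / 2 * \<sigma>\<^sub>L\<^sup>2"
    and "0 < \<gamma>" and "\<gamma> < 1"
    and "T > 0"
    and "\<And>i. i \<in> {1, 2} \<Longrightarrow>
           v i \<in> (\<Inter>\<rho>\<in>{0<..}. W21_inf (strip T - closure (Q \<rho>))) \<inter> W10_inf (strip T)"
    and "\<And>i. i \<in> {1, 2} \<Longrightarrow> is_solution \<delta> \<sigma>\<^sub>H \<sigma>\<^sub>L \<gamma> T (v i)"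
    and "\<And>i. i \<in> {1, 2} \<Longrightarrow>
           AE p in lebesgue. p \<in> UNIV \<times> {0<..T} \<longrightarrow> D_xi_xi T (v i) p + D_xi T (v i) p \<le> 0"
    and "\<And>i. i \<in> {1, 2} \<Longrightarrow>
           \<exists>B>0. \<forall>\<xi>. \<forall>t\<in>{0..T}. (\<xi> < - B \<longrightarrow> v i (\<xi>, t) = 1) \<and>
                                    (\<xi> > B \<longrightarrow> v i (\<xi>, t) \<le> exp (- \<xi>))"
  shows "\<forall>p\<in>strip T. v 1 p = v 2 p"
proof
  fix p assume p: "p \<in> strip T"
  interpret credit_rating \<delta> \<sigma>\<^sub>H \<sigma>\<^sub>L \<gamma> T by unfold_locales (rule assms)+
  have adm: "admissible (v i)" if "i \<in> {1, 2}" for i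
    unfolding admissible_def using assms(9)[OF that] assms(10)[OF that] by blast
  have "(1::nat) \<in> {1, 2}" "(2::nat) \<in> {1, 2}" by simp_all
  note assms(12)[OF this(1)] assms(12)[OF this(2)]
  then obtain B1 B2 where B1: "\<And>\<xi> t. t \<in> {0..T} \<Longrightarrow> \<xi> < - B1 \<Longrightarrow> v 1 (\<xi>, t) = 1"
    and B2: "\<And>\<xi> t. t \<in> {0..T} \<Longrightarrow> \<xi> < - B2 \<Longrightarrow> v 2 (\<xi>, t) = 1"
    by blast
  show "v 1 p = v 2 p"
  proof (rule uniqueness[OF adm adm _ p])
    \<comment> \<open>Left of both thresholds the two solutions equal 1, which provides the common
      left boundary. The additional 1 makes the inequalities \<open>x < - B1\<close> and
      \<open>x < - B2\<close> strict.\<close>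
    fix x t assume "t \<in> {0..T}" "x \<le> - max B1 B2 - 1"
    then show "v 1 (x, t) = v 2 (x, t)" using B1[of t x] B2[of t x] by auto
  qed auto
qed

end
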